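(* Let $T_n$ be a tree on $n$ vertices. Assume that for some tree $T_m$ (on $m$ vertices) we have $$\hom(T_m,T_n)<\hom(T_m,P_n).$$ Then $T_n$ is (isomorphic to) $Y_{1,1,n-3}$ and $n$ is even.
   Context: Graphs are finite, undirected, without loops and multiple edges. $\hom(H,G)$ denotes the number of homomorphisms from $H$ to $G$, i.e. maps $f:V(H)\to V(G)$ such that images of adjacent vertices are adjacent. $P_n$ is the path on $n$ vertices. For positive integers $a,b,c$, $Y_{a,b,c}$ is the tree on $a+b+c+1$ vertices which has exactly $3$ leaves and whose unique vertex of degree $3$ has distances $a,b,c$ from the three leaves, respectively. *)

theory Defs
  imports "Graph_Theory.Graph_Theory" "HOL-Library.FuncSet"
begin

text \<open>
  A finite simple graph is a \<open>pair_graph\<close>: a finite vertex set with a symmetric irreflexive arc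
  relation, so an edge \<open>{u, v}\<close> is the pair of arcs \<open>(u, v)\<close> and \<open>(v, u)\<close>.
\<close>

text \<open>
  Extensional functions represent maps defined on \<open>pverts H\<close> only, so each map is counted once.
\<close>

definition hom_set :: "'b pair_pre_digraph \<Rightarrow> 'a pair_pre_digraph \<Rightarrow> ('b \<Rightarrow> 'a) set" where
  "hom_set H G =
     {f \<in> pverts H \<rightarrow>\<^sub>E pverts G. \<forall>(u, v) \<in> parcs H. (f u, f v) \<in> parcs G}"

definition hom_count :: "'b pair_pre_digraph \<Rightarrow> 'a pair_pre_digraph \<Rightarrow> nat" where
  "hom_count H G = card (hom_set H G)"

text \<open>
  The constant \<open>tree\<close> of the library is meant for directed graphs: it counts \<open>u, v, u\<close> as a cycle,
  so no symmetric digraph with an edge satisfies it.  Cycles of an undirected graph are the cycles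
  of length at least 3.  The library's \<open>connected\<close> includes that there is a vertex.
\<close>

definition undirected_tree :: "'a pair_pre_digraph \<Rightarrow> bool" where
  "undirected_tree G \<longleftrightarrow>
     pair_graph G \<and> Digraph_Component.connected (with_proj G) \<and>
     \<not> (\<exists>p. pre_digraph.cycle (with_proj G) p \<and> 3 \<le> length p)"

definition path_graph :: "nat \<Rightarrow> nat pair_pre_digraph" where
  "path_graph n =
     \<lparr> pverts = {..<n}, parcs = {(i, j). i < n \<and> j < n \<and> (j = i + 1 \<or> i = j + 1)} \<rparr>"

text \<open>
  The centre of \<open>Y_graph a b c\<close> is \<open>0\<close>; its three arms are \<open>1, \<dots>, a\<close>, then \<open>a + 1, \<dots>, a + b\<close>, then
  \<open>a + b + 1, \<dots>, a + b + c\<close>, each listed outwards from the centre.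
  Meant for positive \<open>a\<close>, \<open>b\<close>, \<open>c\<close>.
\<close>

definition Y_graph :: "nat \<Rightarrow> nat \<Rightarrow> nat \<Rightarrow> nat pair_pre_digraph" where
  "Y_graph a b c =
     \<lparr> pverts = {0..a + b + c},
       parcs = symcl {(if i = a + 1 \<or> i = a + b + 1 then 0 else i - 1, i) | i.
                        i \<in> {1..a + b + c}} \<rparr>"


lemma undirected_tree_if_parent:
  fixes par :: "nat \<Rightarrow> nat"
  assumes V: "pverts G = {0..N}"
    and E: "parcs G = symcl {(par i, i) | i. i \<in> {1..N}}"
    and par: "\<And>i. 1 \<le> i \<Longrightarrow> i \<le> N \<Longrightarrow> par i < i"
  shows "undirected_tree G"
proof -
  have E_iff: "(x, y) \<in> parcs G \<longleftrightarrow>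
      (1 \<le> y \<and> y \<le> N \<and> x = par y) \<or> (1 \<le> x \<and> x \<le> N \<and> y = par x)" for x y
    unfolding E symcl_def by auto
  have E_sub: "parcs G \<subseteq> {0..N} \<times> {0..N}"
    using par by (fastforce simp: E_iff)
  interpret G: pair_graph G
  proof (unfold_locales, goal_cases)
    case (1 e) then show ?case using E_sub V by auto
  next
    case (2 e) then show ?case using E_sub V by auto
  next
    case 3 show ?case by (simp add: V)
  next
    case 4 show ?case using finite_subset[OF E_sub] by simp
  next
    case (5 e) then show ?case using par by (cases e) (fastforce simp: E_iff)
  next
    case 6 show ?case by (auto simp: symmetric_def sym_def E_iff)
  qed
  have reach0: "0 \<rightarrow>\<^sup>*\<^bsub>with_proj G\<^esub> i" if "i \<le> N" for i
    using that
  proof (induction i rule: less_induct)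
    case (less i)
    show ?case
    proof (cases "i = 0")
      case True then show ?thesis by (simp add: V)
    next
      case False
      with less.prems have p: "par i < i" "(par i, i) \<in> parcs G"
        using par[of i] by (auto simp: E_iff)
      with less have "0 \<rightarrow>\<^sup>*\<^bsub>with_proj G\<^esub> par i" by auto
      then show ?thesis using p by (metis G.reachable_adj_trans)
    qed
  qed
  have symcl: "symcl (parcs G) = parcs G"
    by (auto simp: symcl_def E_iff)
  have "strongly_connected (with_proj G)"
    unfolding strongly_connected_def
  proof (intro conjI ballI)
    show "verts (with_proj G) \<noteq> {}" by (simp add: V)
  next
    fix u v assume "u \<in> verts (with_proj G)" "v \<in> verts (with_proj G)"
    then have uv: "u \<le> N" "v \<le> N" by (auto simp: V)
    have "u \<rightarrow>\<^sup>*\<^bsub>with_proj G\<^esub> 0" using G.symmetric_reachable' reach0[OF uv(1)] by blast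
    then show "u \<rightarrow>\<^sup>*\<^bsub>with_proj G\<^esub> v" using reach0[OF uv(2)] G.reachable_trans by blast
  qed
  then have conn: "Digraph_Component.connected (with_proj G)"
    by (auto simp: connected_conv strongly_connected_def reachable_def symcl)
  have acyc: False if cyc: "pre_digraph.cycle (with_proj G) p" and len: "3 \<le> length p" for p
  proof -
    define L where "L = length p"
    obtain u where aw: "G.awalk u p u" and dist: "distinct (tl (pawalk_verts u p))" and ne: "p \<noteq> []"
      using cyc unfolding G.cycle_def by blast
    have cas: "pcas u p u" and sub: "set p \<subseteq> parcs G"
      using aw by (auto simp: G.awalk_def)
    have verts: "tl (pawalk_verts u p) = map snd p" if "pcas u p v" for u v p
      using that
    proof (induction p arbitrary: u)
      case (Cons e p)
      then show ?case by (cases p) auto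
    qed simp
    have steps: "fst (p ! 0) = u \<and> snd (p ! (length p - 1)) = v \<and>
        (\<forall>i. Suc i < length p \<longrightarrow> fst (p ! Suc i) = snd (p ! i))"
      if "pcas u p v" "p \<noteq> []" for u v p
      using that
    proof (induction p arbitrary: u)
      case (Cons e p)
      show ?case
      proof (cases p)
        case Nil then show ?thesis using Cons.prems by auto
      next
        case (Cons e' p')
        then have ih: "fst (p ! 0) = snd e" "snd (p ! (length p - 1)) = v"
          "\<forall>i. Suc i < length p \<longrightarrow> fst (p ! Suc i) = snd (p ! i)"
          using Cons.IH[of "snd e"] Cons.prems by auto
        show ?thesis
        proof (intro conjI allI impI)
          show "fst ((e # p) ! 0) = u" using Cons.prems by simp
          show "snd ((e # p) ! (length (e # p) - 1)) = v" using ih Cons by simp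
          fix i assume "Suc i < length (e # p)"
          then show "fst ((e # p) ! Suc i) = snd ((e # p) ! i)" using ih by (cases i) auto
        qed
      qed
    qed simp
    have L: "3 \<le> L" using len L_def by simp
    have next_arc: "fst (p ! ((i + 1) mod L)) = snd (p ! i)" if "i < L" for i
    proof (cases "Suc i = L")
      case True
      then have "i = length p - 1" by (simp add: L_def)
      then show ?thesis using True steps[OF cas ne] by (simp add: mod_self)
    next
      case False
      then show ?thesis using that steps[OF cas ne] by (simp add: L_def)
    qed
    have dsnd: "distinct (map snd p)" using dist verts[OF cas] by simp
    define M where "M = Max (snd ` set p)"
    have "M \<in> snd ` set p" unfolding M_def using ne by (intro Max_in) auto
    then obtain k where k: "k < L" "snd (p ! k) = M" by (metis L_def image_iff in_set_conv_nth)
    have leM: "snd (p ! i) \<le> M" if "i < L" for i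
      unfolding M_def using that by (intro Max_ge) (auto simp: L_def)
    define l j where "l = (k + 1) mod L" and "j = (k + (L - 1)) mod L"
    have lj: "l < L" "j < L" using L by (auto simp: l_def j_def)
    have "(j + 1) mod L = (k + (L - 1) + 1) mod L" unfolding j_def by (rule mod_add_left_eq)
    also have "\<dots> = k" using k(1) L by simp
    finally have jk: "fst (p ! k) = snd (p ! j)" using next_arc[OF lj(2)] by simp
    have lk: "fst (p ! l) = M" using next_arc[OF k(1)] k(2) by (simp add: l_def)
    have "p ! k \<in> parcs G" "p ! l \<in> parcs G" using sub k(1) lj by (auto simp: L_def)
    then have arcs: "(snd (p ! j), M) \<in> parcs G" "(M, snd (p ! l)) \<in> parcs G"
      using jk lk k(2) by (metis prod.collapse)+
    have "snd (p ! j) = par M" "snd (p ! l) = par M"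
      using arcs leM[OF lj(1)] leM[OF lj(2)] par[of "snd (p ! j)"] par[of "snd (p ! l)"]
      unfolding E_iff by linarith+
    then have "j = l" using dsnd lj by (metis L_def length_map nth_eq_iff_index_eq nth_map)
    moreover have "j \<noteq> l"
    proof (cases "k = 0")
      case True then show ?thesis using L by (simp add: j_def l_def)
    next
      case False
      then have "k + (L - 1) = (k - 1) + L" using L by simp
      then have "j = k - 1" using k(1) unfolding j_def
        by (metis mod_add_self2 mod_less less_imp_diff_less)
      moreover have "l = (if k + 1 = L then 0 else k + 1)" using k(1) by (simp add: l_def)
      ultimately show ?thesis using False L by auto
    qed
    ultimately show False by simp
  qed
  have "pair_graph G" by (rule G.pair_graph)
  with conn acyc show ?thesis unfolding undirected_tree_def by blast
qed

lemma undirected_tree_path_graph: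
  assumes "1 \<le> n"
  shows "undirected_tree (path_graph n)"
proof (rule undirected_tree_if_parent)
  show "pverts (path_graph n) = {0..n - 1}" using assms by (auto simp: path_graph_def)
  show "parcs (path_graph n) = symcl {(i - 1, i) | i. i \<in> {1..n - 1}}"
  proof (intro set_eqI, clarify)
    fix x y
    have "(x, y) \<in> symcl {(i - 1, i) | i. i \<in> {1..n - 1}} \<longleftrightarrow>
        (1 \<le> y \<and> y \<le> n - 1 \<and> x = y - 1) \<or> (1 \<le> x \<and> x \<le> n - 1 \<and> y = x - 1)"
      unfolding symcl_def by auto
    also have "\<dots> \<longleftrightarrow> (x, y) \<in> parcs (path_graph n)"
      by (simp add: path_graph_def) linarith
    finally show "(x, y) \<in> parcs (path_graph n) \<longleftrightarrow>
        (x, y) \<in> symcl {(i - 1, i) | i. i \<in> {1..n - 1}}" by simp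
  qed
qed simp

lemma card_verts_path_graph: "card (pverts (path_graph n)) = n"
  by (simp add: path_graph_def)

context
  fixes a b c :: nat
  assumes pos: "1 \<le> a" "1 \<le> b" "1 \<le> c"
begin

private definition par :: "nat \<Rightarrow> nat" where
  "par i = (if i = a + 1 \<or> i = a + b + 1 then 0 else i - 1)"

lemma undirected_tree_Y_graph: "undirected_tree (Y_graph a b c)"
  by (rule undirected_tree_if_parent[where N = "a + b + c" and par = par])
    (simp_all add: Y_graph_def par_def)

lemma card_verts_Y_graph: "card (pverts (Y_graph a b c)) = a + b + c + 1"
  by (simp add: Y_graph_def)

private lemma arcs_iff: "(x, y) \<in> parcs (Y_graph a b c) \<longleftrightarrow>
   (1 \<le> y \<and> y \<le> a + b + c \<and> x = par y) \<or> (1 \<le> x \<and> x \<le> a + b + c \<and> y = par x)"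
  proof -
  have "parcs (Y_graph a b c) = symcl {(par i, i) | i. i \<in> {1..a + b + c}}"
    by (simp add: Y_graph_def par_def)
  then show ?thesis unfolding symcl_def by auto
qed

lemma degree_Y_graph:
  assumes "v \<in> pverts (Y_graph a b c)"
  shows "out_degree (with_proj (Y_graph a b c)) v =
    (if v = 0 then 3 else if v \<in> {a, a + b, a + b + c} then 1 else 2)"
proof -
  have v: "v \<le> a + b + c" using assms by (simp add: Y_graph_def)
  have *: "out_arcs (with_proj (Y_graph a b c)) v =
      Pair v ` {y. (v, y) \<in> parcs (Y_graph a b c)}"
    by (auto simp: out_arcs_def)
  have "out_degree (with_proj (Y_graph a b c)) v = card {y. (v, y) \<in> parcs (Y_graph a b c)}"
    unfolding out_degree_def * by (rule card_image) (simp add: inj_on_def)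
  also have "{y. (v, y) \<in> parcs (Y_graph a b c)} =
     (if v = 0 then {1, a + 1, a + b + 1}
      else if v \<in> {a, a + b, a + b + c} then {par v} else {par v, v + 1})"
    (is "?L = ?R")
  proof (rule set_eqI)
    fix y
    have "y \<in> ?L \<longleftrightarrow>
        (1 \<le> y \<and> y \<le> a + b + c \<and> v = par y) \<or> (1 \<le> v \<and> v \<le> a + b + c \<and> y = par v)"
      by (simp add: arcs_iff)
    also have "(1 \<le> y \<and> y \<le> a + b + c \<and> v = par y) \<longleftrightarrow>
        (if v = 0 then y = 1 \<or> y = a + 1 \<or> y = a + b + 1
         else v \<notin> {a, a + b, a + b + c} \<and> y = v + 1)"
      using v pos by (simp add: par_def) linarith
    finally show "y \<in> ?L \<longleftrightarrow> y \<in> ?R" using v by auto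
  qed
  also have "card \<dots> = (if v = 0 then 3 else if v \<in> {a, a + b, a + b + c} then 1 else 2)"
    using pos by (simp add: par_def)
  finally show ?thesis .
qed

private definition depth :: "nat \<Rightarrow> nat" where
  "depth i = (if i \<le> a then i else if i \<le> a + b then i - a else i - a - b)"

lemma distance_Y_graph:
  defines "dst \<equiv> wf_digraph.\<mu> (with_proj (Y_graph a b c)) (\<lambda>_. 1) 0"
  shows "dst a = ereal a" "dst (a + b) = ereal b" "dst (a + b + c) = ereal c"
proof -
  interpret G: pair_graph "Y_graph a b c"
    using undirected_tree_Y_graph by (simp add: undirected_tree_def)
  have V: "pverts (Y_graph a b c) = {0..a + b + c}" by (simp add: Y_graph_def)
  have cost: "G.awalk_cost (\<lambda>_. 1) p = real (length p)" for p
    by (induction p) auto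
  have par_depth: "depth i = Suc (depth (par i))" "par i < i" if "1 \<le> i" for i
    using that pos by (auto simp: depth_def par_def)
  have walk: "\<exists>p. G.awalk 0 p i \<and> length p = depth i" if "i \<le> a + b + c" for i
    using that
  proof (induction i rule: less_induct)
    case (less i)
    show ?case
    proof (cases "i = 0")
      case True
      then show ?thesis by (intro exI[of _ "[]"]) (auto simp: G.awalk_Nil_iff V depth_def)
    next
      case False
      then have i: "1 \<le> i" by simp
      then obtain p where p: "G.awalk 0 p (par i)" "length p = depth (par i)"
        using less par_depth(2)[OF i] by (meson less_imp_le order_trans)
      have arc: "(par i, i) \<in> parcs (Y_graph a b c)" using less.prems i by (simp add: arcs_iff)
      have "G.awalk (par i) [(par i, i)] i"
        using arc V less.prems par_depth(2)[OF i] by (auto simp: G.awalk_def)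
      then have "G.awalk 0 (p @ [(par i, i)]) i" using p(1) G.awalk_appendI by blast
      then show ?thesis using p(2) par_depth(1)[OF i] by (intro exI[of _ "p @ [(par i, i)]"]) simp
    qed
  qed
  have lip: "depth v \<le> depth u + length p" if "G.awalk u p v" for u p v
    using that
  proof (induction p arbitrary: u)
    case Nil then show ?case by (simp add: G.awalk_Nil_iff)
  next
    case (Cons e p)
    obtain x y where e: "e = (x, y)" by (cases e)
    from Cons.prems e have xy: "(x, y) \<in> parcs (Y_graph a b c)" "x = u" "G.awalk y p v"
      by (auto simp: G.awalk_Cons_iff)
    then have "depth y \<le> depth x + 1"
      using par_depth(1) by (fastforce simp: arcs_iff)
    then show ?case using Cons.IH[OF xy(3)] xy(2) by simp
  qed
  have d: "dst i = ereal (depth i)" if i: "i \<le> a + b + c" for i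
  proof (rule antisym)
    obtain p where p: "G.awalk 0 p i" "length p = depth i" using walk[OF i] by blast
    show "dst i \<le> ereal (depth i)"
      unfolding dst_def using G.min_cost_le_walk_cost[OF p(1), of "\<lambda>_. 1"] p(2) cost by simp
    have "real (depth i) \<le> real (length p)" if "G.awalk 0 p i" for p
      using lip[OF that] by (simp add: depth_def)
    then show "ereal (depth i) \<le> dst i"
      unfolding dst_def G.\<mu>_def by (intro INF_greatest) (simp add: cost)
  qed
  show "dst a = ereal a" "dst (a + b) = ereal b" "dst (a + b + c) = ereal c"
    using d[of a] d[of "a + b"] d[of "a + b + c"] pos by (auto simp: depth_def)
qed

end

end

theory Submission
  imports Defs Complex_Main
begin

text \<open>
  Homomorphisms from a tree \<open>T\<close> on \<open>m\<close> vertices into the path on \<open>n\<close> vertices are compared with those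
  into a tree \<open>G\<close> on \<open>n\<close> vertices. Three devices bound the second number from below.

  Folding (\<open>card_homs_fold\<close>, \<open>bridged_fold\<close>): if a branch of \<open>G\<close> is moved by an even distance along a
  path towards its middle, homomorphisms into the old tree inject into homomorphisms into the new
  one, since the parts of \<open>T\<close> that visit the branch can be reflected as a whole. So a tree with three
  leaves in which some arm is even beats the path. Reflections respect the bipartition, which is why
  parity matters and why other devices are needed.

  Entropy (\<open>homs_entropy_bound\<close>): a stationary Markov chain on \<open>G\<close>, run along \<open>T\<close>, is a random
  homomorphism whose entropy depends on \<open>m\<close> but not on the shape of \<open>T\<close>, and the number of homomorphisms is at
  least the exponential of the entropy. If the entropy rate is at least \<open>ln 2\<close>, this grows like
  \<open>2 ^ (m - 1)\<close>, the rate at which homomorphisms into paths grow. The simple random walk settles trees with a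
  vertex of degree 4 or with three branch vertices (\<open>branchy_homs\<close>).

  Gluing (\<open>card_homs_glue\<close>, \<open>spine_glue\<close>): count homomorphisms into a long path inside \<open>G\<close> exactly,
  and apply the entropy bound only to a small subtree around the branch vertices, which must supply
  \<open>2 ^ (m - 1)\<close> homomorphisms for each vertex off the path. This suffices because one more vertex
  increases the number of homomorphisms into a path by at most \<open>2 ^ (m - 1)\<close> (\<open>path_homs_step\<close>).

  The remaining trees \<open>G\<close> have one or two vertices of degree 3 and no other branch vertex. With two
  of them, folding shortens one arm at each to length 1 or 2, and gluing finishes the proof
  (\<open>dumbbell_homs\<close>); this needs \<open>T\<close> not to be a star, but for stars the count is a power sum of
  degrees and convexity is enough (\<open>star_path_homs_le\<close>). With one branch vertex and only odd arms, at
  least two of them of length 3 or more, folding leads to arms 1, \<open>p\<close> and \<open>k\<close>. Either no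
  homomorphism from \<open>T\<close> covers the path from end to end, and a tree with an even arm decides, or \<open>T\<close>
  contains a long path, and gluing with the tree of arms 1, 3 and 3 works (\<open>odd_arms_homs\<close>). What is
  left is an odd arm together with two arms of length 1.
\<close>

section \<open>Homomorphisms, folding and gluing\<close>

text \<open>
  The constraint on arcs is imposed within \<open>S\<close> only, so that \<open>S\<close> may be a part of a larger source, and
  \<open>E\<close> may relate elements outside \<open>V\<close>, so that one arc relation serves all subgraphs of the target.
\<close>

definition homs :: "'b set \<Rightarrow> ('b \<times> 'b) set \<Rightarrow> 'a set \<Rightarrow> ('a \<times> 'a) set \<Rightarrow> ('b \<Rightarrow> 'a) set" where
  "homs S A V E = {f \<in> S \<rightarrow>\<^sub>E V. \<forall>(x, y) \<in> A. x \<in> S \<longrightarrow> y \<in> S \<longrightarrow> (f x, f y) \<in> E}"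

lemma homs_iff:
  "f \<in> homs S A V E \<longleftrightarrow>
    f \<in> S \<rightarrow>\<^sub>E V \<and> (\<forall>x y. (x, y) \<in> A \<longrightarrow> x \<in> S \<longrightarrow> y \<in> S \<longrightarrow> (f x, f y) \<in> E)"
  unfolding homs_def by blast

lemma homs_in: "f \<in> homs S A V E \<Longrightarrow> x \<in> S \<Longrightarrow> f x \<in> V"
  unfolding homs_iff by blast

lemma homs_arc: "f \<in> homs S A V E \<Longrightarrow> (x, y) \<in> A \<Longrightarrow> x \<in> S \<Longrightarrow> y \<in> S \<Longrightarrow> (f x, f y) \<in> E"
  unfolding homs_iff by blast

lemma homs_eqI:
  "f \<in> homs S A V E \<Longrightarrow> g \<in> homs S A' V' E' \<Longrightarrow> (\<And>x. x \<in> S \<Longrightarrow> f x = g x) \<Longrightarrow> f = g"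
  by (rule extensionalityI[of f S g]) (auto simp: homs_iff PiE_def)

lemma homs_restrictI:
  assumes "\<And>x. x \<in> S \<Longrightarrow> f x \<in> V"
    and "\<And>x y. (x, y) \<in> A \<Longrightarrow> x \<in> S \<Longrightarrow> y \<in> S \<Longrightarrow> (f x, f y) \<in> E"
  shows "restrict f S \<in> homs S A V E"
  using assms unfolding homs_iff by auto

lemma homs_range: "f \<in> homs S A V E \<Longrightarrow> (\<And>x. x \<in> S \<Longrightarrow> f x \<in> W) \<Longrightarrow> f \<in> homs S A W E"
  unfolding homs_iff PiE_iff by blast

lemma homs_mono: "V \<subseteq> W \<Longrightarrow> homs S A V E \<subseteq> homs S A W E"
  using homs_range[of _ S A V E W] homs_in[of _ S A V E] by blast

lemma homs_Int: "homs S A V E \<inter> homs S A W E = homs S A (V \<inter> W) E"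
  by (auto simp: homs_iff PiE_iff)

lemma finite_homs: "finite S \<Longrightarrow> finite V \<Longrightarrow> finite (homs S A V E)"
  by (rule finite_subset[of _ "S \<rightarrow>\<^sub>E V"]) (auto simp: homs_def intro: finite_PiE)

text \<open>
  An injective homomorphism between the targets, in particular the inclusion of a subgraph, carries
  homomorphisms along injectively.
\<close>

definition embeds :: "('c \<Rightarrow> 'a) \<Rightarrow> 'c set \<Rightarrow> ('c \<times> 'c) set \<Rightarrow> 'a set \<Rightarrow> ('a \<times> 'a) set \<Rightarrow> bool" where
  "embeds \<phi> V E V' E' \<longleftrightarrow> inj_on \<phi> V \<and> \<phi> ` V \<subseteq> V' \<and>
    (\<forall>x\<in>V. \<forall>y\<in>V. (x, y) \<in> E \<longrightarrow> (\<phi> x, \<phi> y) \<in> E')"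

lemma card_homs_embed:
  assumes "embeds \<phi> V E V' E'" "finite S" "finite V'"
  shows "card (homs S A V E) \<le> card (homs S A V' E')"
proof (rule card_inj_on_le)
  let ?F = "\<lambda>f. restrict (\<phi> \<circ> f) S"
  have inj: "inj_on \<phi> V" using assms by (simp add: embeds_def)
  show "inj_on ?F (homs S A V E)"
  proof (rule inj_onI)
    fix f g assume f: "f \<in> homs S A V E" and g: "g \<in> homs S A V E" and eq: "?F f = ?F g"
    show "f = g"
    proof (rule homs_eqI[OF f g])
      fix x assume x: "x \<in> S"
      then have "\<phi> (f x) = \<phi> (g x)" using fun_cong[OF eq, of x] by simp
      then show "f x = g x" using inj homs_in[OF f x] homs_in[OF g x] by (auto dest: inj_onD)
    qed
  qed
  show "?F ` homs S A V E \<subseteq> homs S A V' E'"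
  proof clarify
    fix f assume f: "f \<in> homs S A V E"
    show "?F f \<in> homs S A V' E'"
      using assms(1) homs_in[OF f] homs_arc[OF f]
      by (intro homs_restrictI) (auto simp: embeds_def)
  qed
  show "finite (homs S A V' E')" using assms by (simp add: finite_homs)
qed

text \<open>
  Folding. Homomorphisms that use the branch \<open>B\<close> reach it through the side \<open>L\<close> of the cut vertex
  \<open>r\<close>. Deleting from the source the vertices that are sent to \<open>r\<close>, each component that meets \<open>B\<close>
  stays inside \<open>L\<close>, so it can be moved by \<open>\<sigma>\<close> as a whole. This loses nothing: the new map has the
  same fibre over \<open>r\<close> and its components that meet \<open>B\<close> are exactly the ones that were moved.
\<close>

lemma card_homs_fold:
  assumes fin: "finite S" "finite V"
    and symE: "sym E1" "sym E2"
    and L: "L \<subseteq> V" "r \<notin> L" and B: "B \<subseteq> L"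
    and closed: "\<And>x y. x \<in> L \<Longrightarrow> y \<in> V \<Longrightarrow> (x, y) \<in> E1 \<Longrightarrow> y \<in> L \<or> y = r"
    and inj: "inj_on \<sigma> L" and ran: "\<sigma> ` L \<subseteq> V - {r}" and fixB: "\<And>x. x \<in> B \<Longrightarrow> \<sigma> x = x"
    and hom: "\<And>x y. x \<in> L \<Longrightarrow> y \<in> L \<Longrightarrow> (x, y) \<in> E1 \<Longrightarrow> (\<sigma> x, \<sigma> y) \<in> E2"
    and homr: "\<And>x. x \<in> L \<Longrightarrow> (x, r) \<in> E1 \<Longrightarrow> (\<sigma> x, r) \<in> E2"
    and rest: "\<And>x y. x \<in> V - B \<Longrightarrow> y \<in> V - B \<Longrightarrow> (x, y) \<in> E1 \<Longrightarrow> (x, y) \<in> E2"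
  shows "card (homs S A V E1) \<le> card (homs S A V E2)"
proof (rule card_inj_on_le)
  \<comment> \<open>\<open>R f\<close> joins vertices of one component, and \<open>C f\<close> consists of the components that meet \<open>B\<close>.\<close>
  define R where
    "R f = {(x, y). x \<in> S \<and> y \<in> S \<and> ((x, y) \<in> A \<or> (y, x) \<in> A) \<and> f x \<noteq> r \<and> f y \<noteq> r}" for f :: "'a \<Rightarrow> 'b"
  define C where "C f = {u. \<exists>u'\<in>S. f u' \<in> B \<and> (u', u) \<in> (R f)\<^sup>*}" for f :: "'a \<Rightarrow> 'b"
  define F where "F f = restrict (\<lambda>u. if u \<in> C f then \<sigma> (f u) else f u) S" for f :: "'a \<Rightarrow> 'b"
  have CL: "u \<in> S \<and> f u \<in> L" if f: "f \<in> homs S A V E1" and u: "u \<in> C f" for f u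
  proof -
    obtain u' where u': "u' \<in> S" "f u' \<in> B" "(u', u) \<in> (R f)\<^sup>*" using u by (auto simp: C_def)
    from u'(3) show ?thesis
    proof induction
      case base then show ?case using u' B by auto
    next
      case (step y z)
      have "(f y, f z) \<in> E1" using step homs_arc[OF f] symE(1) by (auto simp: R_def sym_def)
      then have "f z \<in> L \<or> f z = r" using step closed homs_in[OF f, of z] by (auto simp: R_def)
      then show ?case using step by (auto simp: R_def)
    qed
  qed
  have Cstep: "y \<in> C f" if "x \<in> C f" "(x, y) \<in> R f" for x y f
    using that unfolding C_def by (blast intro: rtrancl_into_rtrancl)
  have CB: "u \<in> C f" if "u \<in> S" "f u \<in> B" for u f
    using that unfolding C_def by blast
  have Fr: "F f u = r \<longleftrightarrow> f u = r" if f: "f \<in> homs S A V E1" and u: "u \<in> S" for f u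
    using CL[OF f, of u] ran L u by (auto simp: F_def)
  have FB: "F f u \<in> B \<longleftrightarrow> f u \<in> B" if f: "f \<in> homs S A V E1" and u: "u \<in> S" for f u
  proof (cases "u \<in> C f")
    case True
    then have "f u \<in> L" using CL[OF f] by blast
    then have "\<sigma> (f u) \<in> B \<longleftrightarrow> f u \<in> B" using fixB inj B by (metis inj_onD subsetD)
    then show ?thesis using True u by (simp add: F_def)
  next
    case False
    then show ?thesis using u by (simp add: F_def)
  qed
  have RF: "R (F f) = R f" if f: "f \<in> homs S A V E1" for f
    using Fr[OF f] by (auto simp: R_def)
  have CF: "C (F f) = C f" if f: "f \<in> homs S A V E1" for f
    using FB[OF f] unfolding C_def RF[OF f] by auto
  show "inj_on F (homs S A V E1)"
  proof (rule inj_onI)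
    fix f g assume f: "f \<in> homs S A V E1" and g: "g \<in> homs S A V E1" and eq: "F f = F g"
    have C: "C f = C g" using CF[OF f] CF[OF g] eq by simp
    show "f = g"
    proof (rule homs_eqI[OF f g])
      fix x assume x: "x \<in> S"
      show "f x = g x"
      proof (cases "x \<in> C f")
        case True
        then have "\<sigma> (f x) = \<sigma> (g x)" using fun_cong[OF eq, of x] x C by (simp add: F_def)
        then show ?thesis using inj CL[OF f True] CL[OF g] True C by (auto dest: inj_onD)
      next
        case False
        then show ?thesis using fun_cong[OF eq, of x] x C by (simp add: F_def)
      qed
    qed
  qed
  show "F ` homs S A V E1 \<subseteq> homs S A V E2"
  proof clarify
    fix f assume f: "f \<in> homs S A V E1"
    show "F f \<in> homs S A V E2" unfolding F_def
    proof (rule homs_restrictI)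
      fix x assume "x \<in> S"
      then show "(if x \<in> C f then \<sigma> (f x) else f x) \<in> V"
        using CL[OF f, of x] ran homs_in[OF f] by auto
    next
      fix x y assume xy: "(x, y) \<in> A" "x \<in> S" "y \<in> S"
      have e: "(f x, f y) \<in> E1" using homs_arc[OF f xy] .
      have out: "f u \<in> V - B" if "u \<in> S" "u \<notin> C f" for u
        using that CB homs_in[OF f] by auto
      have xr: "f y = r" if "x \<in> C f" "y \<notin> C f"
        using that Cstep[of x f y] CL[OF f, of x] L xy by (auto simp: R_def)
      have yr: "f x = r" if "y \<in> C f" "x \<notin> C f"
        using that Cstep[of y f x] CL[OF f, of y] L xy by (auto simp: R_def)
      have e': "(f y, f x) \<in> E1" using e symE by (simp add: symD)
      show "(if x \<in> C f then \<sigma> (f x) else f x, if y \<in> C f then \<sigma> (f y) else f y) \<in> E2"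
      proof (cases "x \<in> C f")
        case True
        show ?thesis
        proof (cases "y \<in> C f")
          case True
          then show ?thesis using \<open>x \<in> C f\<close> hom CL[OF f] e by auto
        next
          case False
          then show ?thesis using True xr homr CL[OF f, of x] e by auto
        qed
      next
        case False
        show ?thesis
        proof (cases "y \<in> C f")
          case True
          then have "(\<sigma> (f y), r) \<in> E2" using yr False homr CL[OF f, of y] e' by auto
          then show ?thesis using False True yr symE by (auto dest: symD)
        next
          case False
          then show ?thesis using \<open>x \<notin> C f\<close> rest out xy e by auto
        qed
      qed
    qed
  qed
  show "finite (homs S A V E2)" using fin by (simp add: finite_homs)
qed

text \<open>
  A homomorphism into both parts is one into their intersection.
\<close>

lemma card_homs_glue:
  assumes "finite S" "finite V1" "finite V2"
  shows "card (homs S A V1 E) + card (homs S A V2 E)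
    \<le> card (homs S A (V1 \<union> V2) E) + card (homs S A (V1 \<inter> V2) E)"
proof -
  let ?H = "\<lambda>V. homs S A V E"
  have "card (?H V1 \<union> ?H V2) \<le> card (?H (V1 \<union> V2))"
    using homs_mono[of V1 "V1 \<union> V2" S A E] homs_mono[of V2 "V1 \<union> V2" S A E]
    by (intro card_mono) (auto simp: finite_homs assms)
  then show ?thesis
    using card_Un_Int[of "?H V1" "?H V2"] homs_Int[of S A V1 E V2] finite_homs[OF assms(1,2), of A E]
      finite_homs[OF assms(1,3), of A E] by simp
qed

section \<open>Trees grown leaf by leaf\<close>

text \<open>
  Trees as the vertex sets that arise by attaching leaves. This is the form in which acyclicity and
  connectedness are used below; that \<open>A\<close> is symmetric and irreflexive on the set is built in.
\<close>

inductive grown :: "('b \<times> 'b) set \<Rightarrow> 'b set \<Rightarrow> bool" for A where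
  single: "(v, v) \<notin> A \<Longrightarrow> grown A {v}"
| attach: "grown A S \<Longrightarrow> u \<in> S \<Longrightarrow> v \<notin> S \<Longrightarrow>
    (\<And>x. x \<in> insert v S \<Longrightarrow> (x, v) \<in> A \<longleftrightarrow> x = u) \<Longrightarrow>
    (\<And>x. x \<in> insert v S \<Longrightarrow> (v, x) \<in> A \<longleftrightarrow> x = u) \<Longrightarrow> grown A (insert v S)"

lemma grown_finite: "grown A S \<Longrightarrow> finite S \<and> S \<noteq> {}"
  by (induction rule: grown.induct) auto

lemma grown_card: "grown A S \<Longrightarrow> 1 \<le> card S"
  using grown_finite[of A S] by (simp add: Suc_leI card_gt_0_iff)

lemma grown_crossing:
  assumes "grown A S" "S0 \<subseteq> S" "S0 \<noteq> {}" "S0 \<noteq> S"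
  shows "\<exists>u\<in>S0. \<exists>v\<in>S - S0. (u, v) \<in> A"
  using assms
proof (induction arbitrary: S0 rule: grown.induct)
  case (single v)
  then show ?case by auto
next
  case (attach S u v)
  consider "S0 \<inter> S = {}" | "S0 \<inter> S = S" | "S0 \<inter> S \<noteq> {}" "S0 \<inter> S \<noteq> S" by blast
  then show ?case
  proof cases
    case 1
    then have "S0 = {v}" using attach.prems by auto
    then show ?thesis using attach.hyps by blast
  next
    case 2
    then show ?thesis using attach.hyps attach.prems by blast
  next
    case 3
    then obtain x y where "x \<in> S0 \<inter> S" "y \<in> S - (S0 \<inter> S)" "(x, y) \<in> A"
      using attach.IH[of "S0 \<inter> S"] by blast
    then show ?thesis by blast
  qed
qed

definition simple_path :: "('b \<times> 'b) set \<Rightarrow> 'b set \<Rightarrow> 'b list \<Rightarrow> bool" where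
  "simple_path A S ts \<longleftrightarrow>
    ts \<noteq> [] \<and> distinct ts \<and> set ts \<subseteq> S \<and> successively (\<lambda>x y. (x, y) \<in> A) ts"

lemma grown_simple_path:
  assumes "grown A S" "u \<in> S" "w \<in> S"
  shows "\<exists>ts. simple_path A S ts \<and> hd ts = u \<and> last ts = w"
  using assms
proof (induction arbitrary: u w rule: grown.induct)
  case (single v)
  then show ?case by (intro exI[of _ "[v]"]) (auto simp: simple_path_def)
next
  case (attach S r v)
  consider "u = v" "w = v" | "u = v" "w \<in> S" | "u \<in> S" "w = v" | "u \<in> S" "w \<in> S"
    using attach.prems by blast
  then show ?case
  proof cases
    case 1
    then show ?thesis by (intro exI[of _ "[v]"]) (auto simp: simple_path_def)
  next
    case 2
    then obtain ts where ts: "simple_path A S ts" "hd ts = r" "last ts = w"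
      using attach.IH attach.hyps by blast
    then show ?thesis using 2 attach.hyps
      by (intro exI[of _ "v # ts"]) (auto simp: simple_path_def successively_Cons)
  next
    case 3
    then obtain ts where ts: "simple_path A S ts" "hd ts = u" "last ts = r"
      using attach.IH attach.hyps by blast
    then show ?thesis using 3 attach.hyps
      by (intro exI[of _ "ts @ [v]"]) (auto simp: simple_path_def successively_append_iff)
  next
    case 4
    then obtain ts where "simple_path A S ts" "hd ts = u" "last ts = w"
      using attach.IH by blast
    then show ?thesis by (intro exI[of _ ts]) (auto simp: simple_path_def)
  qed
qed

lemma grown_card_arcs:
  assumes "grown A S"
  shows "card {(x, y). x \<in> S \<and> y \<in> S \<and> (x, y) \<in> A} = 2 * (card S - 1)"
  using assms
proof (induction rule: grown.induct)
  case (single v)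
  then have eq: "{(x, y). x \<in> {v} \<and> y \<in> {v} \<and> (x, y) \<in> A} = {}" by auto
  show ?case unfolding eq by simp
next
  case (attach S u v)
  let ?B = "{(x, y). x \<in> S \<and> y \<in> S \<and> (x, y) \<in> A}"
  have S: "finite S" "1 \<le> card S" using attach.hyps grown_finite grown_card by blast+
  have eq: "{(x, y). x \<in> insert v S \<and> y \<in> insert v S \<and> (x, y) \<in> A} = {(u, v), (v, u)} \<union> ?B"
    using attach.hyps by auto
  have "finite ?B" by (rule finite_subset[of _ "S \<times> S"]) (auto simp: S)
  then have "card ({(u, v), (v, u)} \<union> ?B) = card {(u, v), (v, u)} + card ?B"
    using attach.hyps by (intro card_Un_disjoint) auto
  moreover have "card {(u, v), (v, u)} = 2" using attach.hyps(2,3) by (subst card_2_iff) blast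
  ultimately show ?case unfolding eq using S attach.IH attach.hyps by simp
qed

definition deg :: "'a set \<Rightarrow> ('a \<times> 'a) set \<Rightarrow> 'a \<Rightarrow> nat" where
  "deg V E x = card {y \<in> V. (x, y) \<in> E}"

lemma grown_sum_deg:
  assumes "grown E V"
  shows "(\<Sum>x\<in>V. deg V E x) = 2 * (card V - 1)"
proof -
  have fin: "finite V" using assms grown_finite by blast
  have "{(x, y). x \<in> V \<and> y \<in> V \<and> (x, y) \<in> E} = (SIGMA x:V. {y \<in> V. (x, y) \<in> E})" by auto
  then have "card {(x, y). x \<in> V \<and> y \<in> V \<and> (x, y) \<in> E} = (\<Sum>x\<in>V. deg V E x)"
    using fin by (simp add: deg_def)
  then show ?thesis using grown_card_arcs[OF assms] by simp
qed

lemma grown_deg_pos: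
  assumes "grown E V" "x \<in> V" "2 \<le> card V"
  shows "1 \<le> deg V E x"
proof -
  have "{x} \<noteq> V" using assms(3) by auto
  then have "{y \<in> V. (x, y) \<in> E} \<noteq> {}" using grown_crossing[OF assms(1), of "{x}"] assms(2) by auto
  moreover have "finite V" using assms grown_finite by blast
  ultimately have "0 < deg V E x" by (simp add: deg_def card_gt_0_iff)
  then show ?thesis by simp
qed

text \<open>
  A leaf attached to a star gives a star or a path on four vertices through the centre.
\<close>

lemma grown_star_or_path4:
  assumes "grown A S"
  shows "(\<exists>c\<in>S. \<forall>x\<in>S. \<forall>y\<in>S. (x, y) \<in> A \<longleftrightarrow> x \<noteq> y \<and> (x = c \<or> y = c)) \<or>
    (\<exists>ts. simple_path A S ts \<and> length ts = 4)"
  using assms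
proof (induction rule: grown.induct)
  case (single v)
  then show ?case by auto
next
  case (attach S u v)
  from attach.IH show ?case
  proof
    assume "\<exists>ts. simple_path A S ts \<and> length ts = 4"
    then show ?thesis by (metis simple_path_def subset_insertI2)
  next
    assume "\<exists>c\<in>S. \<forall>x\<in>S. \<forall>y\<in>S. (x, y) \<in> A \<longleftrightarrow> x \<noteq> y \<and> (x = c \<or> y = c)"
    then obtain c where c: "c \<in> S" "\<And>x y. x \<in> S \<Longrightarrow> y \<in> S \<Longrightarrow> (x, y) \<in> A \<longleftrightarrow> x \<noteq> y \<and> (x = c \<or> y = c)"
      by blast
    consider "u = c" | "u \<noteq> c" "S = {c, u}" | x where "u \<noteq> c" "x \<in> S" "x \<noteq> c" "x \<noteq> u"
      using attach.hyps c by blast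
    then show ?thesis
    proof cases
      case 1
      then show ?thesis using c attach.hyps by (intro disjI1 bexI[of _ c]) auto
    next
      case 2
      then have "\<forall>x\<in>insert v S. \<forall>y\<in>insert v S. (x, y) \<in> A \<longleftrightarrow> x \<noteq> y \<and> (x = u \<or> y = u)"
        using c attach.hyps by auto
      then show ?thesis using attach.hyps by blast
    next
      case 3
      then show ?thesis using c attach.hyps
        by (intro disjI2 exI[of _ "[x, c, u, v]"]) (auto simp: simple_path_def)
    qed
  qed
qed

text \<open>
  Extending a homomorphism from a part of a connected source one adjacent vertex at a time leaves at
  most \<open>d\<close> choices in each step.
\<close>

lemma card_homs_extend:
  assumes gr: "grown A S" and V: "finite V"
    and d: "\<And>x. x \<in> V \<Longrightarrow> card {y \<in> V. (x, y) \<in> E} \<le> d"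
    and S0: "S0 \<subseteq> S" "S0 \<noteq> {}"
  shows "card (homs S A V E) \<le> d ^ (card S - card S0) * card (homs S0 A V E)"
  using S0
proof (induction "card S - card S0" arbitrary: S0)
  case 0
  have "finite S" using gr grown_finite by blast
  then have "S0 = S" using 0 by (simp add: card_subset_eq card_mono le_antisym)
  then show ?case by simp
next
  case (Suc k)
  have finS: "finite S" using gr grown_finite by blast
  then have finS0: "finite S0" using Suc.prems finite_subset by blast
  have "S0 \<noteq> S" using Suc.hyps(2) by auto
  then obtain u v where uv: "u \<in> S0" "v \<in> S" "v \<notin> S0" "(u, v) \<in> A"
    using grown_crossing[OF gr Suc.prems] by blast
  let ?S1 = "insert v S0"
  let ?N = "\<lambda>g. {y \<in> V. (g u, y) \<in> E}"
  have "card (homs ?S1 A V E) \<le> card (SIGMA g:homs S0 A V E. ?N g)"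
  proof (rule card_inj_on_le)
    let ?F = "\<lambda>f. (restrict f S0, f v)"
    show "inj_on ?F (homs ?S1 A V E)"
    proof (rule inj_onI)
      fix f g assume f: "f \<in> homs ?S1 A V E" and g: "g \<in> homs ?S1 A V E" and eq: "?F f = ?F g"
      show "f = g"
      proof (rule homs_eqI[OF f g])
        fix x assume "x \<in> ?S1"
        then show "f x = g x" using eq by (auto simp: restrict_def fun_eq_iff split: if_splits)
      qed
    qed
    show "?F ` homs ?S1 A V E \<subseteq> (SIGMA g:homs S0 A V E. ?N g)"
    proof clarify
      fix f assume f: "f \<in> homs ?S1 A V E"
      have "restrict f S0 \<in> homs S0 A V E"
        using homs_in[OF f] homs_arc[OF f] by (intro homs_restrictI) auto
      then show "restrict f S0 \<in> homs S0 A V E \<and> f v \<in> ?N (restrict f S0)"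
        using homs_in[OF f, of v] homs_arc[OF f uv(4)] uv by auto
    qed
    show "finite (SIGMA g:homs S0 A V E. ?N g)"
      using finite_homs[OF finS0 V] V by auto
  qed
  also have "\<dots> = (\<Sum>g\<in>homs S0 A V E. card (?N g))"
    using finite_homs[OF finS0 V] V by simp
  also have "\<dots> \<le> (\<Sum>g\<in>homs S0 A V E. d)"
    using uv by (intro sum_mono d) (auto simp: homs_iff)
  finally have step: "card (homs ?S1 A V E) \<le> d * card (homs S0 A V E)" by (simp add: mult.commute)
  have "card S0 < card S" using Suc.hyps(2) by simp
  then have k: "k = card S - card ?S1" "card S - card S0 = Suc k"
    using Suc.hyps(2) finS0 uv by auto
  have "card (homs S A V E) \<le> d ^ k * card (homs ?S1 A V E)"
    using Suc.hyps(1)[OF k(1)] Suc.prems uv k by auto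
  also have "\<dots> \<le> d ^ k * (d * card (homs S0 A V E))" using step by simp
  finally show ?case using k by (simp add: mult_ac)
qed

primrec walks :: "'a set \<Rightarrow> ('a \<times> 'a) set \<Rightarrow> nat \<Rightarrow> 'a \<Rightarrow> nat" where
  "walks V E 0 x = 1"
| "walks V E (Suc k) x = (\<Sum>y\<in>{y \<in> V. (x, y) \<in> E}. walks V E k y)"

text \<open>
  Along a path in the source a homomorphism traces a walk in the target. Further arcs between the
  vertices of the path can only exclude some walks.
\<close>

lemma card_homs_simple_path_le:
  assumes V: "finite V" and ts: "simple_path A S ts"
  shows "card (homs (set ts) A V E) \<le> (\<Sum>x\<in>V. walks V E (length ts - 1) x)"
proof -
  let ?H = "\<lambda>ts x. {f \<in> homs (set ts) A V E. f (hd ts) = x}"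
  have fin: "finite (?H ts x)" for ts x
    by (rule finite_subset[OF _ finite_homs[of "set ts" V A E]]) (auto simp: V)
  have pointed: "card (?H ts x) \<le> walks V E (length ts - 1) x"
    if "ts \<noteq> []" "distinct ts" "successively (\<lambda>x y. (x, y) \<in> A) ts" for ts x
    using that
  proof (induction ts arbitrary: x rule: list_nonempty_induct)
    case (single t)
    have "?H [t] x \<subseteq> {restrict (\<lambda>_. x) {t}}"
      by (auto simp: homs_iff PiE_iff restrict_def extensional_def)
    then have "card (?H [t] x) \<le> card {restrict (\<lambda>_. x) {t}}" by (intro card_mono) simp
    then show ?case by simp
  next
    case (cons t ts)
    let ?N = "{y \<in> V. (x, y) \<in> E}"
    have hd: "(t, hd ts) \<in> A" "hd ts \<in> set ts" "t \<notin> set ts"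
      using cons.prems cons.hyps by (auto simp: successively_Cons)
    have "card (?H (t # ts) x) \<le> card (\<Union>y\<in>?N. ?H ts y)"
    proof (rule card_inj_on_le)
      let ?F = "\<lambda>f. restrict f (set ts)"
      show "inj_on ?F (?H (t # ts) x)"
      proof (rule inj_onI)
        fix f g assume f: "f \<in> ?H (t # ts) x" and g: "g \<in> ?H (t # ts) x" and eq: "?F f = ?F g"
        have f': "f \<in> homs (set (t # ts)) A V E" and g': "g \<in> homs (set (t # ts)) A V E"
          using f g by auto
        show "f = g"
        proof (rule homs_eqI[OF f' g'])
          fix y assume "y \<in> set (t # ts)"
          then show "f y = g y"
            using f g eq by (auto simp: restrict_def fun_eq_iff split: if_splits)
        qed
      qed
      show "?F ` ?H (t # ts) x \<subseteq> (\<Union>y\<in>?N. ?H ts y)"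
      proof clarify
        fix f assume f: "f \<in> homs (set (t # ts)) A V E" and x: "x = f (hd (t # ts))"
        have "?F f \<in> homs (set ts) A V E"
          using homs_in[OF f] homs_arc[OF f] by (intro homs_restrictI) auto
        moreover have "f (hd ts) \<in> V" "(f t, f (hd ts)) \<in> E"
          using homs_in[OF f] homs_arc[OF f hd(1)] hd by auto
        ultimately show "?F f \<in> (\<Union>y\<in>{y \<in> V. (f (hd (t # ts)), y) \<in> E}. ?H ts y)"
          using hd by auto
      qed
      show "finite (\<Union>y\<in>?N. ?H ts y)" using V fin by auto
    qed
    also have "\<dots> \<le> (\<Sum>y\<in>?N. card (?H ts y))" using V by (intro card_UN_le) auto
    also have "\<dots> \<le> (\<Sum>y\<in>?N. walks V E (length ts - 1) y)"
      using cons by (intro sum_mono cons.IH) (auto simp: successively_Cons)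
    also have "\<dots> = walks V E (length (t # ts) - 1) x"
      using cons.hyps by (cases ts) auto
    finally show ?case .
  qed
  have "homs (set ts) A V E = (\<Union>x\<in>V. ?H ts x)"
    using ts homs_in by (fastforce simp: simple_path_def)
  then have "card (homs (set ts) A V E) \<le> (\<Sum>x\<in>V. card (?H ts x))"
    using card_UN_le[OF V, of "?H ts"] by simp
  also have "\<dots> \<le> (\<Sum>x\<in>V. walks V E (length ts - 1) x)"
    using pointed ts by (intro sum_mono) (auto simp: simple_path_def)
  finally show ?thesis .
qed

section \<open>Homomorphisms into paths\<close>

definition path_arcs :: "(nat \<times> nat) set" where
  "path_arcs = {(i, j). j = i + 1 \<or> i = j + 1}"

definition path_homs :: "'b set \<Rightarrow> ('b \<times> 'b) set \<Rightarrow> nat \<Rightarrow> nat" where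
  "path_homs S A n = card (homs S A {..<n} path_arcs)"

lemma sym_path_arcs: "sym path_arcs"
  by (auto simp: path_arcs_def sym_def)

lemma card_path_neighbours: "card {y \<in> {..<n}. (x, y) \<in> path_arcs} \<le> 2"
proof -
  have "{y \<in> {..<n}. (x, y) \<in> path_arcs} \<subseteq> {x - 1, x + 1}" by (auto simp: path_arcs_def)
  then have "card {y \<in> {..<n}. (x, y) \<in> path_arcs} \<le> card {x - 1, x + 1}"
    by (intro card_mono) auto
  also have "\<dots> \<le> 2" by (simp add: card_insert_if)
  finally show ?thesis .
qed

lemma grown_path: "grown path_arcs {..<Suc n}"
proof (induction n)
  case 0
  have "{..<Suc 0} = {0}" by auto
  moreover have "grown path_arcs {0}" by (rule grown.single) (simp add: path_arcs_def)
  ultimately show ?case by simp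
next
  case (Suc n)
  have "grown path_arcs (insert (Suc n) {..<Suc n})"
    by (rule grown.attach[OF Suc, of n]) (auto simp: path_arcs_def)
  then show ?case by (simp add: lessThan_Suc)
qed

lemma path_homs_interval:
  assumes "finite S"
  shows "card (homs S A {a..<b} path_arcs) = path_homs S A (b - a)"
  unfolding path_homs_def
proof (rule antisym)
  have "embeds (\<lambda>x. x - a) {a..<b} path_arcs {..<b - a} path_arcs"
    by (auto simp: embeds_def path_arcs_def inj_on_def)
  then show "card (homs S A {a..<b} path_arcs) \<le> card (homs S A {..<b - a} path_arcs)"
    by (rule card_homs_embed) (use assms in auto)
  have "embeds (\<lambda>x. x + a) {..<b - a} path_arcs {a..<b} path_arcs"
    by (auto simp: embeds_def path_arcs_def inj_on_def)
  then show "card (homs S A {..<b - a} path_arcs) \<le> card (homs S A {a..<b} path_arcs)"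
    by (rule card_homs_embed) (use assms in auto)
qed

text \<open>
  The paths on \<open>j + 1\<close> vertices obtained from the path on \<open>j + 2\<close> vertices by deleting one end
  overlap in a path on \<open>j\<close> vertices, so the number of homomorphisms into a path is convex in its
  length. The second difference counts the homomorphisms that reach both ends.
\<close>

lemma path_homs_convex:
  assumes "finite S"
  shows "2 * path_homs S A (j + 1) \<le> path_homs S A (j + 2) + path_homs S A j"
proof -
  have "{..<j + 1} \<union> {1..<j + 2} = {..<j + 2}" "{..<j + 1} \<inter> {1..<j + 2} = {1..<j + 1}" by auto
  then show ?thesis
    using card_homs_glue[OF assms, of "{..<j + 1}" "{1..<j + 2}" A path_arcs]
      path_homs_interval[OF assms, of A 1 "j + 2"] path_homs_interval[OF assms, of A 1 "j + 1"]
    by (simp add: path_homs_def)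
qed

lemma path_homs_linear:
  assumes "finite S"
    and nofull: "\<not> (\<exists>f \<in> homs S A {..<j + 2} path_arcs. 0 \<in> f ` S \<and> j + 1 \<in> f ` S)"
  shows "path_homs S A (j + 2) + path_homs S A j = 2 * path_homs S A (j + 1)"
proof -
  let ?H = "\<lambda>V. homs S A V path_arcs"
  have "?H {..<j + 2} = ?H {..<j + 1} \<union> ?H {1..<j + 2}"
  proof (intro equalityI subsetI)
    fix f assume f: "f \<in> ?H {..<j + 2}"
    show "f \<in> ?H {..<j + 1} \<union> ?H {1..<j + 2}"
    proof (cases "0 \<in> f ` S")
      case True
      then have "j + 1 \<notin> f ` S" using nofull f by blast
      have "\<forall>x\<in>S. f x < j + 1"
      proof
        fix x assume x: "x \<in> S"
        then have "f x < j + 2" using homs_in[OF f] by auto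
        moreover have "f x \<noteq> j + 1" using \<open>j + 1 \<notin> f ` S\<close> x by (metis imageI)
        ultimately show "f x < j + 1" by linarith
      qed
      then show ?thesis using homs_range[OF f, of "{..<j + 1}"] by simp
    next
      case False
      then have "\<forall>x\<in>S. 1 \<le> f x" by (metis One_nat_def Suc_leI imageI neq0_conv)
      then show ?thesis using homs_range[OF f, of "{1..<j + 2}"] homs_in[OF f] by simp
    qed
  next
    fix f assume "f \<in> ?H {..<j + 1} \<union> ?H {1..<j + 2}"
    moreover have "{..<j + 1} \<subseteq> {..<j + 2}" "{1..<j + 2} \<subseteq> {..<j + 2}" by auto
    ultimately show "f \<in> ?H {..<j + 2}" using homs_mono by blast
  qed
  moreover have "{..<j + 1} \<inter> {1..<j + 2} = {1..<j + 1}" by auto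
  then have "?H {..<j + 1} \<inter> ?H {1..<j + 2} = ?H {1..<j + 1}" unfolding homs_Int by simp
  ultimately show ?thesis
    using card_Un_Int[of "?H {..<j + 1}" "?H {1..<j + 2}"] finite_homs[OF assms(1), of "{..<j + 1}" A path_arcs]
      finite_homs[OF assms(1), of "{1..<j + 2}" A path_arcs]
      path_homs_interval[OF assms(1), of A 1 "j + 2"] path_homs_interval[OF assms(1), of A 1 "j + 1"]
    by (simp add: path_homs_def)
qed

lemma path_homs_le:
  assumes "grown A S"
  shows "path_homs S A n \<le> n * 2 ^ (card S - 1)"
proof -
  obtain v where v: "v \<in> S" using assms grown_finite by blast
  have "homs {v} A {..<n} path_arcs \<subseteq> {v} \<rightarrow>\<^sub>E {..<n}" by (auto simp: homs_def)
  then have "card (homs {v} A {..<n} path_arcs) \<le> card ({v} \<rightarrow>\<^sub>E {..<n})"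
    by (intro card_mono) (auto intro: finite_PiE)
  then have "card (homs {v} A {..<n} path_arcs) \<le> n" by (simp add: card_PiE)
  moreover have "path_homs S A n \<le> 2 ^ (card S - card {v}) * card (homs {v} A {..<n} path_arcs)"
    unfolding path_homs_def
    by (rule card_homs_extend[OF assms]) (use v card_path_neighbours in auto)
  ultimately have "path_homs S A n \<le> 2 ^ (card S - 1) * n"
    by (auto elim!: order_trans)
  then show ?thesis by (simp add: mult.commute)
qed

text \<open>
  A convex sequence that grew once by more than \<open>2 ^ (m - 1)\<close> would do so from then on, and so
  outgrow the linear bound above.
\<close>

lemma path_homs_step:
  assumes "grown A S"
  shows "path_homs S A (j + 1) \<le> path_homs S A j + 2 ^ (card S - 1)"
proof (rule ccontr)
  let ?h = "path_homs S A" and ?c = "2 ^ (card S - 1) :: nat"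
  have fin: "finite S" using assms grown_finite by blast
  assume "\<not> ?thesis"
  then have big: "?h (j + 1) \<ge> ?h j + ?c + 1" by simp
  have step: "?h (j + t + 1) \<ge> ?h (j + t) + ?c + 1" for t
  proof (induction t)
    case 0 then show ?case using big by simp
  next
    case (Suc t) then show ?case using path_homs_convex[OF fin, of A "j + t"] by simp
  qed
  have "?h (j + t) \<ge> t * (?c + 1)" for t
  proof (induction t)
    case (Suc t) then show ?case using step[of t] by simp
  qed simp
  \<comment> \<open>This many steps make the surplus of 1 per step exceed \<open>j * ?c\<close>.\<close>
  from this[of "j * ?c + 1"] path_homs_le[OF assms, of "j + (j * ?c + 1)"]
  show False by (simp add: algebra_simps)
qed

lemma path_homs_steps:
  assumes "grown A S"
  shows "path_homs S A (j + t) \<le> path_homs S A j + t * 2 ^ (card S - 1)"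
proof (induction t)
  case (Suc t)
  then show ?case using path_homs_step[OF assms, of "j + t"] by simp
qed simp

text \<open>
  The walks along any path in the source bound the count, because each of the remaining vertices at
  most doubles it.
\<close>

lemma path_homs_walks:
  assumes gr: "grown A S" and ts: "simple_path A S ts"
  shows "path_homs S A n
    \<le> 2 ^ (card S - length ts) * (\<Sum>x<n. walks {..<n} path_arcs (length ts - 1) x)"
proof -
  have "card (set ts) = length ts" using ts by (simp add: simple_path_def distinct_card)
  moreover have "path_homs S A n \<le> 2 ^ (card S - card (set ts)) * card (homs (set ts) A {..<n} path_arcs)"
    unfolding path_homs_def
    by (rule card_homs_extend[OF gr]) (use ts card_path_neighbours in \<open>auto simp: simple_path_def\<close>)
  moreover have "card (homs (set ts) A {..<n} path_arcs) \<le> (\<Sum>x<n. walks {..<n} path_arcs (length ts - 1) x)"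
    by (rule card_homs_simple_path_le) (use ts in auto)
  ultimately show ?thesis by (auto elim!: order_trans intro: mult_le_mono2)
qed

lemma simple_path_length:
  assumes "grown A S" "simple_path A S ts"
  shows "length ts \<le> card S"
  using assms by (metis card_mono distinct_card grown_finite simple_path_def)

lemma walks_path3:
  "walks {..<3} path_arcs (Suc k) 0 = walks {..<3} path_arcs k (Suc 0)"
  "walks {..<3} path_arcs (Suc k) (Suc 0) = walks {..<3} path_arcs k 0 + walks {..<3} path_arcs k 2"
  "walks {..<3} path_arcs (Suc k) 2 = walks {..<3} path_arcs k (Suc 0)"
proof -
  have eq: "{y \<in> {..<3}. (0, y) \<in> path_arcs} = {1}" "{y \<in> {..<3}. (Suc 0, y) \<in> path_arcs} = {0, 2}"
    "{y \<in> {..<3}. (2, y) \<in> path_arcs} = {1}"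
    by (auto simp: path_arcs_def)
  show
    "walks {..<3} path_arcs (Suc k) 0 = walks {..<3} path_arcs k (Suc 0)"
    "walks {..<3} path_arcs (Suc k) (Suc 0) = walks {..<3} path_arcs k 0 + walks {..<3} path_arcs k 2"
    "walks {..<3} path_arcs (Suc k) 2 = walks {..<3} path_arcs k (Suc 0)"
    unfolding walks.simps eq by simp_all
qed

lemma sum_lessThan_3: "(\<Sum>x<3. f x) = f 0 + f (Suc 0) + f 2" for f :: "nat \<Rightarrow> nat"
  by (simp add: numeral_3_eq_3 numeral_2_eq_2)

text \<open>
  A path on four vertices has \<open>8 = 2 ^ 3\<close> homomorphisms into the path on three vertices, so there the
  source has at most \<open>2 ^ (m - 1)\<close>; from there on the count grows by at most \<open>2 ^ (m - 1)\<close> per vertex.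
\<close>

lemma path_homs_path4:
  assumes gr: "grown A S" and ts: "simple_path A S ts" "length ts = 4"
  shows "path_homs S A (j + 3) \<le> (j + 1) * 2 ^ (card S - 1)"
proof -
  have len: "length ts - 1 = Suc (Suc (Suc 0))" using ts by simp
  have "(\<Sum>x<3. walks {..<3} path_arcs (length ts - 1) x) = 8"
    unfolding sum_lessThan_3 len walks_path3 by simp
  then have "path_homs S A 3 \<le> 2 ^ (card S - 4) * 2 ^ 3"
    using path_homs_walks[OF gr ts(1), of 3] ts by simp
  also have "\<dots> = 2 ^ (card S - 1)"
    unfolding power_add[symmetric] using simple_path_length[OF gr ts(1)] ts by (simp add: Suc_diff_le)
  finally show ?thesis using path_homs_steps[OF gr, of 3 j] by (simp add: add.commute)
qed

text \<open>
  A path on five vertices has only \<open>12 = 3 / 4 * 2 ^ 4\<close> homomorphisms into the path on three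
  vertices, which leaves \<open>3 / 4 + 4 = 19 / 4\<close> times \<open>2 ^ (m - 1)\<close> for the path on seven vertices.
\<close>

lemma path_homs_path5:
  assumes gr: "grown A S" and ts: "simple_path A S ts" "length ts = 5"
  shows "4 * path_homs S A 7 \<le> 19 * 2 ^ (card S - 1)"
proof -
  have len: "length ts - 1 = Suc (Suc (Suc (Suc 0)))" using ts by simp
  have "(\<Sum>x<3. walks {..<3} path_arcs (length ts - 1) x) = 12"
    unfolding sum_lessThan_3 len walks_path3 by simp
  then have "4 * path_homs S A 3 \<le> 3 * (2 ^ (card S - 5) * 2 ^ 4)"
    using path_homs_walks[OF gr ts(1), of 3] ts by simp
  also have "2 ^ (card S - 5) * 2 ^ 4 = (2 ^ (card S - 1) :: nat)"
    unfolding power_add[symmetric] using simple_path_length[OF gr ts(1)] ts by simp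
  finally show ?thesis using path_homs_steps[OF gr, of 3 4] by simp
qed

lemma path_homs_le_edges:
  assumes gr: "grown A S" and m: "2 \<le> card S"
  shows "path_homs S A (Suc n) \<le> n * 2 ^ (card S - 1)"
proof -
  obtain u where u: "u \<in> S" using gr grown_finite by blast
  moreover have "{u} \<noteq> S" using m by auto
  ultimately obtain v where v: "v \<in> S" "v \<noteq> u" "(u, v) \<in> A"
    using grown_crossing[OF gr, of "{u}"] by auto
  then have ts: "simple_path A S [u, v]" using u by (auto simp: simple_path_def)
  have "(\<Sum>x<Suc n. walks {..<Suc n} path_arcs 1 x) = (\<Sum>x<Suc n. deg {..<Suc n} path_arcs x)"
    by (simp add: deg_def)
  also have "\<dots> = 2 * n" using grown_sum_deg[OF grown_path, of n] by simp
  finally have "path_homs S A (Suc n) \<le> 2 ^ (card S - 2) * (2 * n)"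
    using path_homs_walks[OF gr ts, of "Suc n"] by (simp add: numeral_2_eq_2)
  also have "\<dots> = n * (2 ^ (card S - 2) * 2 ^ 1)" by simp
  also have "2 ^ (card S - 2) * 2 ^ 1 = (2 ^ (card S - 1) :: nat)"
    unfolding power_add[symmetric] using m by (intro arg_cong[of _ _ "power 2"]) simp
  finally show ?thesis .
qed

text \<open>
  A homomorphism that reaches both ends of a path with \<open>n\<close> vertices maps the path between two
  suitable vertices of the source onto it, so that path has at least \<open>n\<close> vertices.
\<close>

lemma full_hom_path5:
  assumes gr: "grown A S" and f: "f \<in> homs S A {..<n} path_arcs" and n: "5 \<le> n"
    and full: "0 \<in> f ` S" "n - 1 \<in> f ` S"
  shows "\<exists>ts. simple_path A S ts \<and> length ts = 5"
proof -
  obtain u w where uw: "u \<in> S" "f u = 0" "w \<in> S" "f w = n - 1" using full by (metis imageE)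
  obtain ts where ts: "simple_path A S ts" "hd ts = u" "last ts = w"
    using grown_simple_path[OF gr uw(1,3)] by blast
  have "f (last ts) + 1 \<le> f (hd ts) + length ts"
    if "ts \<noteq> []" "set ts \<subseteq> S" "successively (\<lambda>x y. (x, y) \<in> A) ts" for ts
    using that
  proof (induction ts rule: list_nonempty_induct)
    case (cons t ts)
    then have "(t, hd ts) \<in> A" "t \<in> S" "hd ts \<in> S" by (auto simp: successively_Cons)
    then have "f (hd ts) \<le> f t + 1" using homs_arc[OF f] by (fastforce simp: path_arcs_def)
    then show ?case using cons by (auto simp: successively_Cons)
  qed simp
  from this[of ts] have "n \<le> length ts" using ts uw n by (auto simp: simple_path_def)
  then have "length (take 5 ts) = 5" using n by simp
  moreover have "simple_path A S (take 5 ts)"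
  proof -
    have "successively (\<lambda>x y. (x, y) \<in> A) (take 5 ts)"
      using ts by (metis append_take_drop_id simple_path_def successively_append_iff)
    then show ?thesis using ts set_take_subset[of 5 ts] by (auto simp: simple_path_def)
  qed
  ultimately show ?thesis by blast
qed

text \<open>
  After the image \<open>x\<close> of the centre is chosen, the leaves go independently to neighbours of \<open>x\<close>.
\<close>

lemma card_homs_star:
  assumes fin: "finite S" "finite V" and E: "sym E" and c: "c \<in> S"
    and star: "\<forall>x\<in>S. \<forall>y\<in>S. (x, y) \<in> A \<longleftrightarrow> x \<noteq> y \<and> (x = c \<or> y = c)"
  shows "card (homs S A V E) = (\<Sum>x\<in>V. deg V E x ^ (card S - 1))"
proof -
  let ?N = "\<lambda>x. {y \<in> V. (x, y) \<in> E}"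
  let ?P = "SIGMA x:V. (S - {c}) \<rightarrow>\<^sub>E ?N x"
  have "bij_betw (\<lambda>f. (f c, restrict f (S - {c}))) (homs S A V E) ?P"
  proof (rule bij_betw_byWitness[where f' = "\<lambda>(x, g). g(c := x)"])
    show "\<forall>f\<in>homs S A V E. (case (f c, restrict f (S - {c})) of (x, g) \<Rightarrow> g(c := x)) = f"
    proof
      fix f assume "f \<in> homs S A V E"
      then have "f x = undefined" if "x \<notin> S" for x
        using that by (auto simp: homs_iff PiE_iff extensional_def)
      then show "(case (f c, restrict f (S - {c})) of (x, g) \<Rightarrow> g(c := x)) = f"
        by (auto simp: fun_eq_iff restrict_def)
    qed
    show "\<forall>p\<in>?P. ((case p of (x, g) \<Rightarrow> g(c := x)) c,
        restrict (case p of (x, g) \<Rightarrow> g(c := x)) (S - {c})) = p"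
      by (auto simp: PiE_iff extensional_def fun_eq_iff restrict_def)
    show "(\<lambda>f. (f c, restrict f (S - {c}))) ` homs S A V E \<subseteq> ?P"
    proof clarify
      fix f assume f: "f \<in> homs S A V E"
      have "f x \<in> ?N (f c)" if "x \<in> S - {c}" for x
        using that homs_in[OF f, of x] homs_arc[OF f, of c x] c star by auto
      then show "f c \<in> V \<and> restrict f (S - {c}) \<in> (S - {c}) \<rightarrow>\<^sub>E ?N (f c)"
        using homs_in[OF f c] unfolding restrict_PiE_iff by blast
    qed
    show "(\<lambda>(x, g). g(c := x)) ` ?P \<subseteq> homs S A V E"
    proof clarify
      fix x g assume x: "x \<in> V" and g: "g \<in> (S - {c}) \<rightarrow>\<^sub>E ?N x"
      have N: "g y \<in> V \<and> (x, g y) \<in> E \<and> (g y, x) \<in> E" if "y \<in> S" "y \<noteq> c" for y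
        using PiE_mem[OF g, of y] that E by (auto dest: symD)
      show "g(c := x) \<in> homs S A V E"
        unfolding homs_iff
      proof (intro conjI allI impI)
        show "g(c := x) \<in> S \<rightarrow>\<^sub>E V"
          using N x c PiE_arb[OF g] by (intro PiE_I) (auto split: if_splits)
        fix y z assume "(y, z) \<in> A" "y \<in> S" "z \<in> S"
        then have "y \<noteq> z" "y = c \<or> z = c" "y \<in> S" "z \<in> S" using star by auto
        then show "((g(c := x)) y, (g(c := x)) z) \<in> E" using N by auto
      qed
    qed
  qed
  then have "card (homs S A V E) = card ?P" by (rule bij_betw_same_card)
  also have "\<dots> = (\<Sum>x\<in>V. card ((S - {c}) \<rightarrow>\<^sub>E ?N x))"
    using fin by (intro card_SigmaI) (auto intro: finite_PiE)
  also have "\<dots> = (\<Sum>x\<in>V. deg V E x ^ (card S - 1))"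
    using fin c by (simp add: card_PiE deg_def)
  finally show ?thesis .
qed

lemma power_secant: "1 \<le> d \<Longrightarrow> (int d - 2) * (2 ^ j - 1) + 2 ^ j \<le> int d ^ j"
proof (induction j)
  case (Suc j)
  let ?q = "(2::int) ^ j"
  define e where "e = int d - 1"
  have e: "0 \<le> e" "int d = e + 1" using Suc.prems by (simp_all add: e_def)
  have q: "1 \<le> ?q" by simp
  have "e \<le> e * e" using e by (cases "e = 0") (auto simp: mult_le_cancel_left1)
  then have "e * (?q - 1) \<le> e * e * (?q - 1)" using q by (intro mult_right_mono) auto
  then have "(int d - 2) * (2 * ?q - 1) + 2 * ?q \<le> ((int d - 2) * (?q - 1) + ?q) * int d"
    unfolding e(2) by (simp add: algebra_simps)
  also have "\<dots> \<le> int d ^ j * int d" using Suc by (intro mult_right_mono) auto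
  finally show ?case by (simp add: mult.commute)
qed simp

text \<open>
  For a star the count is a power sum of the degrees of the target. The line through the values of
  \<open>d ^ j\<close> at the degrees \<open>1\<close> and \<open>2\<close> of a path lies below \<open>d ^ j\<close>, and all trees on \<open>n\<close> vertices
  have the same degree sum.
\<close>

lemma star_path_homs_le:
  assumes T: "grown A S" and c: "c \<in> S"
    and star: "\<forall>x\<in>S. \<forall>y\<in>S. (x, y) \<in> A \<longleftrightarrow> x \<noteq> y \<and> (x = c \<or> y = c)"
    and G: "grown E V" and E: "sym E" and n: "2 \<le> card V"
  shows "path_homs S A (card V) \<le> card (homs S A V E)"
proof -
  define j where "j = card S - 1"
  define q where "q = (2::int) ^ j"
  define l where "l d = (int d - 2) * (q - 1) + q" for d
  define n where "n = card V"
  have n2: "2 \<le> n" and grP: "grown path_arcs {..<n}" using n grown_path[of "n - 1"] by (auto simp: n_def)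
  have sum_l: "(\<Sum>x\<in>W. l (deg W F x)) = 2 * (int n - 1) * (q - 1) + int n * (2 - q)"
    if "grown F W" "card W = n" for F :: "('c \<times> 'c) set" and W
  proof -
    have "int (\<Sum>x\<in>W. deg W F x) = 2 * (int n - 1)"
      using grown_sum_deg[OF that(1)] that(2) n2 by simp
    then have "(\<Sum>x\<in>W. int (deg W F x)) = 2 * (int n - 1)" by simp
    moreover have "l d = int d * (q - 1) + (2 - q)" for d by (simp add: l_def algebra_simps)
    ultimately show ?thesis using that(2) by (simp add: sum.distrib flip: sum_distrib_right)
  qed
  have path_deg: "int (deg {..<n} path_arcs x ^ j) = l (deg {..<n} path_arcs x)" if "x < n" for x
  proof -
    have "1 \<le> deg {..<n} path_arcs x" using grown_deg_pos[OF grP, of x] that n2 by simp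
    moreover have "deg {..<n} path_arcs x \<le> 2" unfolding deg_def by (rule card_path_neighbours)
    ultimately have "deg {..<n} path_arcs x = 1 \<or> deg {..<n} path_arcs x = 2" by linarith
    then show ?thesis by (auto simp: l_def q_def)
  qed
  have finS: "finite S" and finV: "finite V" using T G grown_finite by blast+
  have "int (path_homs S A n) = (\<Sum>x<n. int (deg {..<n} path_arcs x ^ j))"
    unfolding path_homs_def j_def
    using card_homs_star[OF finS _ sym_path_arcs c star, of "{..<n}"] by simp
  also have "\<dots> = (\<Sum>x<n. l (deg {..<n} path_arcs x))" by (intro sum.cong refl path_deg) simp
  also have "\<dots> = (\<Sum>x\<in>V. l (deg V E x))"
    using sum_l[OF grP] sum_l[OF G] by (simp add: n_def)
  also have "\<dots> \<le> (\<Sum>x\<in>V. int (deg V E x ^ j))"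
  proof (rule sum_mono)
    fix x assume "x \<in> V"
    then have "1 \<le> deg V E x" using grown_deg_pos[OF G] n by auto
    then show "l (deg V E x) \<le> int (deg V E x ^ j)" using power_secant by (simp add: l_def q_def)
  qed
  also have "\<dots> = int (card (homs S A V E))"
    unfolding j_def using card_homs_star[OF finS finV E c star] by simp
  finally show ?thesis by (simp add: n_def)
qed

section \<open>Undirected trees\<close>

lemma (in pair_wf_digraph) awalk_of_vertex_list:
  assumes "successively (\<lambda>x y. (x, y) \<in> parcs G) (x # xs)" "x \<in> pverts G"
  shows "awalk x (zip (x # xs) xs) (last (x # xs)) \<and> pawalk_verts x (zip (x # xs) xs) = x # xs"
  using assms
proof (induction xs arbitrary: x)
  case Nil
  then show ?case by (simp add: awalk_Nil_iff)
next
  case (Cons y ys)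
  then have "(x, y) \<in> parcs G" by simp
  moreover from this have "y \<in> pverts G" by (rule in_arcsD2)
  ultimately show ?case using Cons.IH[of y] Cons.prems by (simp add: awalk_Cons_iff)
qed

text \<open>
  A largest subtree that arises by attaching leaves is everything: connectedness supplies an
  adjacent vertex outside, and two arcs from it into the subtree would close a cycle.
\<close>

lemma undirected_tree_grown:
  assumes "undirected_tree G"
  shows "grown (parcs G) (pverts G)" "sym (parcs G)"
proof -
  from assms have conn: "Digraph_Component.connected (with_proj G)"
    and acyclic: "\<And>p. pre_digraph.cycle (with_proj G) p \<Longrightarrow> length p < 3"
    by (auto simp: undirected_tree_def not_le)
  interpret pair_graph G using assms by (simp add: undirected_tree_def)
  let ?A = "parcs G" and ?V = "pverts G"
  show symA: "sym ?A" using arcs_symmetric by (auto simp: sym_def)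
  then have symcl: "symcl ?A = ?A" by (auto simp: symcl_def sym_def)
  have ne: "?V \<noteq> {}" and reach: "(u, v) \<in> rtrancl_on ?V ?A" if "u \<in> ?V" "v \<in> ?V" for u v
    using conn that symcl by (auto simp: connected_conv)
  have crossing: "\<exists>u\<in>S. \<exists>v\<in>?V - S. (u, v) \<in> ?A" if S: "u \<in> S" "S \<subseteq> ?V" "S \<noteq> ?V" for S u
  proof (rule ccontr)
    assume no: "\<not> ?thesis"
    obtain v where v: "v \<in> ?V" "v \<notin> S" using S by blast
    have "(u, v) \<in> rtrancl_on ?V ?A" using reach v S by blast
    then have "v \<in> S"
    proof (induction rule: rtrancl_on_induct)
      case base then show ?case using S by simp
    next
      case (step y z) then show ?case using no by blast
    qed
    then show False using v by simp
  qed
  obtain v0 where v0: "v0 \<in> ?V" using conn by (auto simp: connected_conv)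
  have "grown ?A {v0}" using no_loops' by (blast intro: grown.single)
  then have ex: "{v0} \<subseteq> ?V \<and> grown ?A {v0}" using v0 by simp
  have bound: "\<forall>S. S \<subseteq> ?V \<and> grown ?A S \<longrightarrow> card S < Suc (card ?V)"
    using pair_finite_verts by (simp add: card_mono less_Suc_eq_le)
  obtain S where S: "S \<subseteq> ?V" "grown ?A S"
    and max: "\<And>S'. S' \<subseteq> ?V \<Longrightarrow> grown ?A S' \<Longrightarrow> card S' \<le> card S"
    using ex_has_greatest_nat[of "\<lambda>S. S \<subseteq> ?V \<and> grown ?A S", OF ex bound] by (elim exE conjE) simp
  have "S = ?V"
  proof (rule ccontr)
    assume "S \<noteq> ?V"
    then obtain u v where uv: "u \<in> S" "v \<in> ?V" "v \<notin> S" "(u, v) \<in> ?A"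
      using crossing[of _ S] S grown_finite[OF S(2)] by blast
    have unique: "x = u" if x: "x \<in> S" "(x, v) \<in> ?A" for x
    proof (rule ccontr)
      assume "x \<noteq> u"
      obtain ts where ts: "simple_path ?A S ts" "hd ts = u" "last ts = x"
        using grown_simple_path[OF S(2) uv(1) x(1)] by blast
      have vu: "(v, u) \<in> ?A" using symD[OF symA uv(4)] .
      have "successively (\<lambda>x y. (x, y) \<in> ?A) (v # ts @ [v])"
        using ts x vu by (auto simp: simple_path_def successively_Cons successively_append_iff)
      note w = awalk_of_vertex_list[OF this uv(2)]
      have "ts \<noteq> []" using ts by (simp add: simple_path_def)
      moreover have "distinct (ts @ [v])" using ts uv by (auto simp: simple_path_def)
      ultimately have "cycle (zip (v # ts @ [v]) (ts @ [v]))"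
        using w unfolding cycle_def by (intro exI[of _ v]) auto
      then have "length (zip (v # ts @ [v]) (ts @ [v])) < 3" by (rule acyclic)
      then have "length ts \<le> 1" by simp
      then show False using ts \<open>x \<noteq> u\<close> \<open>ts \<noteq> []\<close> by (cases ts) auto
    qed
    have "grown ?A (insert v S)"
    proof (rule grown.attach[OF S(2) uv(1,3)])
      fix x assume x: "x \<in> insert v S"
      show xv: "(x, v) \<in> ?A \<longleftrightarrow> x = u" using x unique uv(4) no_loops'[of v v] by blast
      have "(v, x) \<in> ?A \<longleftrightarrow> (x, v) \<in> ?A" by (meson symA symD)
      then show "(v, x) \<in> ?A \<longleftrightarrow> x = u" using xv by simp
    qed
    then have "card (insert v S) \<le> card S" using max S uv by blast
    moreover have "finite S" using S grown_finite by blast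
    ultimately show False using uv by simp
  qed
  then show "grown ?A ?V" using S by simp
qed

section \<open>The entropy bound\<close>

lemma gibbs_inequality:
  fixes p t :: "'a \<Rightarrow> real"
  assumes fin: "finite Y" and pos: "\<And>y. y \<in> Y \<Longrightarrow> 0 < p y" and one: "(\<Sum>y\<in>Y. p y) = 1"
  shows "exp (\<Sum>y\<in>Y. p y * (t y - ln (p y))) \<le> (\<Sum>y\<in>Y. exp (t y))"
proof -
  define Z where "Z = (\<Sum>y\<in>Y. exp (t y))"
  have "Y \<noteq> {}" using one by auto
  then have Z: "0 < Z" unfolding Z_def using fin by (intro sum_pos) auto
  have "(\<Sum>y\<in>Y. p y * (t y - ln (p y) - ln Z)) \<le> (\<Sum>y\<in>Y. exp (t y) / Z - p y)"
  proof (rule sum_mono)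
    fix y assume y: "y \<in> Y"
    have "ln (exp (t y) / (p y * Z)) \<le> exp (t y) / (p y * Z) - 1"
      using pos[OF y] Z by (intro ln_le_minus_one) auto
    moreover have "ln (exp (t y) / (p y * Z)) = t y - ln (p y) - ln Z"
      using pos[OF y] Z by (simp add: ln_div ln_mult)
    ultimately have "p y * (t y - ln (p y) - ln Z) \<le> p y * (exp (t y) / (p y * Z) - 1)"
      using pos[OF y] by (intro mult_left_mono) auto
    also have "\<dots> = exp (t y) / Z - p y" using pos[OF y] Z by (simp add: field_simps)
    finally show "p y * (t y - ln (p y) - ln Z) \<le> exp (t y) / Z - p y" .
  qed
  also have "\<dots> = 0" using one Z by (simp add: sum_subtractf Z_def flip: sum_divide_distrib)
  finally have "(\<Sum>y\<in>Y. p y * (t y - ln (p y))) - (\<Sum>y\<in>Y. p y * ln Z) \<le> 0"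
    by (simp add: algebra_simps flip: sum_subtractf)
  then have "(\<Sum>y\<in>Y. p y * (t y - ln (p y))) \<le> ln Z"
    using one by (simp flip: sum_distrib_right)
  then show ?thesis using Z exp_le_cancel_iff[of _ "ln Z"] by (simp add: Z_def)
qed

lemma sum_homs_attach:
  fixes F :: "('b \<Rightarrow> 'a) \<Rightarrow> real"
  assumes fin: "finite S" "finite V" and E: "sym E" and uv: "u \<in> S" "v \<notin> S"
    and in_arcs: "\<And>x. x \<in> insert v S \<Longrightarrow> (x, v) \<in> A \<longleftrightarrow> x = u"
    and out_arcs: "\<And>x. x \<in> insert v S \<Longrightarrow> (v, x) \<in> A \<longleftrightarrow> x = u"
  shows "(\<Sum>f\<in>homs (insert v S) A V E. F f) =
    (\<Sum>f\<in>homs S A V E. \<Sum>y\<in>{y \<in> V. (f u, y) \<in> E}. F (f(v := y)))"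
proof -
  let ?N = "\<lambda>x. {y \<in> V. (x, y) \<in> E}"
  let ?P = "SIGMA f:homs S A V E. ?N (f u)"
  have "bij_betw (\<lambda>(f, y). f(v := y)) ?P (homs (insert v S) A V E)"
  proof (rule bij_betw_byWitness[where f' = "\<lambda>f. (restrict f S, f v)"])
    show "\<forall>p\<in>?P. (restrict (case p of (f, y) \<Rightarrow> f(v := y)) S, (case p of (f, y) \<Rightarrow> f(v := y)) v) = p"
    proof
      fix p assume "p \<in> ?P"
      then obtain f y where p: "p = (f, y)" "f \<in> homs S A V E" by blast
      then have "f x = undefined" if "x \<notin> S" for x
        using that by (auto simp: homs_iff PiE_iff extensional_def)
      then show "(restrict (case p of (f, y) \<Rightarrow> f(v := y)) S, (case p of (f, y) \<Rightarrow> f(v := y)) v) = p"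
        using uv p(1) by (auto simp: fun_eq_iff restrict_def)
    qed
    show "\<forall>f\<in>homs (insert v S) A V E. (case (restrict f S, f v) of (f, y) \<Rightarrow> f(v := y)) = f"
    proof
      fix f assume "f \<in> homs (insert v S) A V E"
      then have "f x = undefined" if "x \<notin> insert v S" for x
        using that by (auto simp: homs_iff PiE_iff extensional_def)
      then show "(case (restrict f S, f v) of (f, y) \<Rightarrow> f(v := y)) = f"
        by (auto simp: fun_eq_iff restrict_def)
    qed
    show "(\<lambda>(f, y). f(v := y)) ` ?P \<subseteq> homs (insert v S) A V E"
    proof clarify
      fix f y assume f: "f \<in> homs S A V E" and y: "y \<in> V" "(f u, y) \<in> E"
      show "f(v := y) \<in> homs (insert v S) A V E"
        unfolding homs_iff
      proof (intro conjI allI impI)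
        have "f \<in> S \<rightarrow>\<^sub>E V" using f by (simp add: homs_iff)
        then show "f(v := y) \<in> insert v S \<rightarrow>\<^sub>E V" using y(1) by (rule PiE_fun_upd[rotated])
        have y': "(y, f u) \<in> E" using symD[OF E y(2)] .
        fix a b assume ab: "(a, b) \<in> A" "a \<in> insert v S" "b \<in> insert v S"
        consider "b = v" "a = u" | "a = v" "b = u" | "a \<in> S" "b \<in> S"
          using ab in_arcs out_arcs by auto
        then show "((f(v := y)) a, (f(v := y)) b) \<in> E"
          using y y' uv homs_arc[OF f ab(1)] by cases auto
      qed
    qed
    show "(\<lambda>f. (restrict f S, f v)) ` homs (insert v S) A V E \<subseteq> ?P"
    proof clarify
      fix f assume f: "f \<in> homs (insert v S) A V E"
      have "restrict f S \<in> homs S A V E"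
        using homs_in[OF f] homs_arc[OF f] by (intro homs_restrictI) auto
      moreover have "f v \<in> V" "(f u, f v) \<in> E"
        using homs_in[OF f] homs_arc[OF f, of u v] in_arcs[of u] uv by auto
      ultimately show "restrict f S \<in> homs S A V E \<and> f v \<in> ?N (restrict f S u)" using uv by simp
    qed
  qed
  then have "(\<Sum>f\<in>homs (insert v S) A V E. F f) = (\<Sum>p\<in>?P. F (case p of (f, y) \<Rightarrow> f(v := y)))"
    by (simp add: sum.reindex_bij_betw)
  also have "\<dots> = (\<Sum>(f, y)\<in>?P. F (f(v := y)))" by (simp add: case_prod_beta)
  also have "\<dots> = (\<Sum>f\<in>homs S A V E. \<Sum>y\<in>?N (f u). F (f(v := y)))"
    using fin by (subst sum.Sigma) (auto simp: finite_homs)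
  finally show ?thesis .
qed

text \<open>
  A Markov chain on the target, run along the source tree from an arbitrary start vertex, gives a
  random homomorphism whose entropy does not depend on the shape of the tree: every edge contributes
  the entropy rate of the chain. The count is at least the exponential of that entropy. The
  potentials \<open>\<theta>\<close> make the statement inductive: a new leaf is summed out by Gibbs' inequality, which
  changes the potential of its neighbour by an amount whose stationary mean is known.
\<close>

lemma homs_entropy_bound:
  fixes P :: "'a \<Rightarrow> 'a \<Rightarrow> real" and \<pi> :: "'a \<Rightarrow> real" and \<theta> :: "'b \<Rightarrow> 'a \<Rightarrow> real"
  assumes gr: "grown A S" and V: "finite V" and E: "sym E"
  defines "N \<equiv> \<lambda>x. {y \<in> V. (x, y) \<in> E}"
  assumes P: "\<And>x y. x \<in> V \<Longrightarrow> y \<in> N x \<Longrightarrow> 0 < P x y" "\<And>x. x \<in> V \<Longrightarrow> (\<Sum>y\<in>N x. P x y) = 1"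
    and \<pi>: "\<And>x. x \<in> V \<Longrightarrow> 0 < \<pi> x" "(\<Sum>x\<in>V. \<pi> x) = 1"
    and stat: "\<And>y. y \<in> V \<Longrightarrow> (\<Sum>x\<in>N y. \<pi> x * P x y) = \<pi> y"
  shows "exp (- (\<Sum>x\<in>V. \<pi> x * ln (\<pi> x))
      - real (card S - 1) * (\<Sum>x\<in>V. \<Sum>y\<in>N x. \<pi> x * P x y * ln (P x y))
      + (\<Sum>u\<in>S. \<Sum>x\<in>V. \<pi> x * \<theta> u x))
    \<le> (\<Sum>f\<in>homs S A V E. exp (\<Sum>u\<in>S. \<theta> u (f u)))"
  using gr
proof (induction arbitrary: \<theta> rule: grown.induct)
  case (single v)
  have bij: "bij_betw (\<lambda>x. restrict (\<lambda>_. x) {v}) V (homs {v} A V E)"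
    by (rule bij_betw_byWitness[where f' = "\<lambda>f. f v"])
      (use single in \<open>auto simp: homs_iff PiE_iff extensional_def fun_eq_iff restrict_def\<close>)
  have "(\<Sum>f\<in>homs {v} A V E. exp (\<Sum>u\<in>{v}. \<theta> u (f u))) = (\<Sum>x\<in>V. exp (\<theta> v x))"
    by (subst sum.reindex_bij_betw[OF bij, symmetric]) simp
  moreover have "exp (\<Sum>x\<in>V. \<pi> x * (\<theta> v x - ln (\<pi> x))) \<le> (\<Sum>x\<in>V. exp (\<theta> v x))"
    by (rule gibbs_inequality) (use V \<pi> in auto)
  ultimately show ?case by (simp add: algebra_simps sum_subtractf)
next
  case (attach S u v)
  \<comment> \<open>Summing out the leaf \<open>v\<close> adds \<open>q\<close> to the potential of its neighbour \<open>u\<close>.\<close>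
  define s where "s = (\<Sum>x\<in>V. \<Sum>y\<in>N x. \<pi> x * P x y * ln (P x y))"
  define q where "q x = (\<Sum>y\<in>N x. P x y * (\<theta> v y - ln (P x y)))" for x
  define \<theta>' where "\<theta>' = \<theta>(u := \<lambda>x. \<theta> u x + q x)"
  have fin: "finite S" and card: "1 \<le> card S" using attach.hyps grown_finite grown_card by blast+
  have finN: "finite (N x)" for x using V by (simp add: N_def)
  have \<theta>': "(\<Sum>w\<in>S. \<theta>' w (f w)) = (\<Sum>w\<in>S. \<theta> w (f w)) + q (f u)" for f :: "'b \<Rightarrow> 'a"
  proof -
    have "(\<Sum>w\<in>S. \<theta>' w (f w)) = \<theta>' u (f u) + (\<Sum>w\<in>S - {u}. \<theta>' w (f w))"
      using fin attach.hyps by (simp add: sum.remove)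
    also have "(\<Sum>w\<in>S - {u}. \<theta>' w (f w)) = (\<Sum>w\<in>S - {u}. \<theta> w (f w))"
      by (intro sum.cong) (auto simp: \<theta>'_def)
    finally show ?thesis using fin attach.hyps by (simp add: sum.remove \<theta>'_def)
  qed
  have sym_iff: "(x, y) \<in> E \<longleftrightarrow> (y, x) \<in> E" for x y by (meson E symD)
  have swap: "(\<Sum>x\<in>V. \<Sum>y\<in>N x. g x y) = (\<Sum>y\<in>V. \<Sum>x\<in>N y. g x y)" for g :: "'a \<Rightarrow> 'a \<Rightarrow> real"
  proof -
    have "(\<Sum>x\<in>V. \<Sum>y\<in>N x. g x y) = (\<Sum>x\<in>V. \<Sum>y\<in>V. if (x, y) \<in> E then g x y else 0)"
      unfolding N_def using V by (intro sum.cong refl sum.inter_filter)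
    also have "\<dots> = (\<Sum>y\<in>V. \<Sum>x\<in>V. if (x, y) \<in> E then g x y else 0)"
      by (rule sum.swap)
    also have "\<dots> = (\<Sum>y\<in>V. \<Sum>x\<in>V. if (y, x) \<in> E then g x y else 0)"
      using sym_iff by (intro sum.cong refl) metis
    also have "\<dots> = (\<Sum>y\<in>V. \<Sum>x\<in>N y. g x y)"
      unfolding N_def using V by (intro sum.cong refl sum.inter_filter[symmetric])
    finally show ?thesis .
  qed
  have "(\<Sum>x\<in>V. \<pi> x * q x) = (\<Sum>x\<in>V. \<Sum>y\<in>N x. \<pi> x * P x y * \<theta> v y) - s"
    unfolding q_def s_def sum_subtractf[symmetric] sum_distrib_left
    by (intro sum.cong refl) (simp add: algebra_simps)
  also have "(\<Sum>x\<in>V. \<Sum>y\<in>N x. \<pi> x * P x y * \<theta> v y) = (\<Sum>y\<in>V. \<Sum>x\<in>N y. \<pi> x * P x y * \<theta> v y)"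
    by (rule swap)
  also have "\<dots> = (\<Sum>y\<in>V. \<pi> y * \<theta> v y)"
    by (intro sum.cong refl) (simp add: stat flip: sum_distrib_right)
  finally have mean_q: "(\<Sum>x\<in>V. \<pi> x * q x) = (\<Sum>y\<in>V. \<pi> y * \<theta> v y) - s" .
  have mean: "(\<Sum>w\<in>S. \<Sum>x\<in>V. \<pi> x * \<theta>' w x) =
      (\<Sum>w\<in>insert v S. \<Sum>x\<in>V. \<pi> x * \<theta> w x) - s"
  proof -
    have "(\<Sum>w\<in>S. \<Sum>x\<in>V. \<pi> x * \<theta>' w x) =
        (\<Sum>x\<in>V. \<pi> x * \<theta>' u x) + (\<Sum>w\<in>S - {u}. \<Sum>x\<in>V. \<pi> x * \<theta>' w x)"
      using fin attach.hyps by (simp add: sum.remove)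
    also have "(\<Sum>w\<in>S - {u}. \<Sum>x\<in>V. \<pi> x * \<theta>' w x) = (\<Sum>w\<in>S - {u}. \<Sum>x\<in>V. \<pi> x * \<theta> w x)"
      by (intro sum.cong) (auto simp: \<theta>'_def)
    also have "(\<Sum>x\<in>V. \<pi> x * \<theta>' u x) = (\<Sum>x\<in>V. \<pi> x * \<theta> u x) + (\<Sum>x\<in>V. \<pi> x * q x)"
      by (simp add: \<theta>'_def distrib_left sum.distrib)
    finally show ?thesis using fin attach.hyps by (simp add: sum.remove mean_q)
  qed
  have "exp (- (\<Sum>x\<in>V. \<pi> x * ln (\<pi> x)) - real (card (insert v S) - 1) * s
      + (\<Sum>w\<in>insert v S. \<Sum>x\<in>V. \<pi> x * \<theta> w x))
    = exp (- (\<Sum>x\<in>V. \<pi> x * ln (\<pi> x)) - real (card S - 1) * s + (\<Sum>w\<in>S. \<Sum>x\<in>V. \<pi> x * \<theta>' w x))"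
    unfolding mean using fin card attach.hyps by (simp add: of_nat_diff algebra_simps)
  also have "\<dots> \<le> (\<Sum>f\<in>homs S A V E. exp (\<Sum>w\<in>S. \<theta>' w (f w)))"
    unfolding s_def by (rule attach.IH)
  also have "\<dots> \<le> (\<Sum>f\<in>homs S A V E. \<Sum>y\<in>N (f u). exp (\<Sum>w\<in>insert v S. \<theta> w ((f(v := y)) w)))"
  proof (rule sum_mono)
    fix f assume f: "f \<in> homs S A V E"
    then have fu: "f u \<in> V" using attach.hyps by (auto intro: homs_in)
    have "exp (\<Sum>w\<in>S. \<theta>' w (f w)) = exp (\<Sum>w\<in>S. \<theta> w (f w)) * exp (q (f u))"
      by (simp add: \<theta>' exp_add)
    also have "\<dots> \<le> exp (\<Sum>w\<in>S. \<theta> w (f w)) * (\<Sum>y\<in>N (f u). exp (\<theta> v y))"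
      unfolding q_def by (intro mult_left_mono gibbs_inequality) (use finN P fu in auto)
    also have "\<dots> = (\<Sum>y\<in>N (f u). exp (\<theta> v y + (\<Sum>w\<in>S. \<theta> w (f w))))"
      by (simp add: sum_distrib_left exp_add mult.commute)
    also have "\<dots> = (\<Sum>y\<in>N (f u). exp (\<Sum>w\<in>insert v S. \<theta> w ((f(v := y)) w)))"
    proof (rule sum.cong[OF refl])
      fix y
      have "(\<Sum>w\<in>S. \<theta> w ((f(v := y)) w)) = (\<Sum>w\<in>S. \<theta> w (f w))"
        using attach.hyps by (intro sum.cong) auto
      then show "exp (\<theta> v y + (\<Sum>w\<in>S. \<theta> w (f w))) = exp (\<Sum>w\<in>insert v S. \<theta> w ((f(v := y)) w))"
        using fin attach.hyps by simp
    qed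
    finally show "exp (\<Sum>w\<in>S. \<theta>' w (f w))
      \<le> (\<Sum>y\<in>N (f u). exp (\<Sum>w\<in>insert v S. \<theta> w ((f(v := y)) w)))" .
  qed
  also have "\<dots> = (\<Sum>f\<in>homs (insert v S) A V E. exp (\<Sum>w\<in>insert v S. \<theta> w (f w)))"
    unfolding N_def by (rule sum_homs_attach[OF fin V E attach.hyps(2,3), symmetric]) (use attach.hyps in auto)
  finally show ?case unfolding s_def .
qed

text \<open>
  The reversible case: a random walk whose steps are proportional to edge weights \<open>w\<close>. Its
  stationary weight at \<open>x\<close> is the sum \<open>W x\<close> of the weights at \<open>x\<close>.
\<close>

lemma homs_weighted_walk_bound:
  fixes w :: "'a \<Rightarrow> 'a \<Rightarrow> real" and W :: "'a \<Rightarrow> real"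
  assumes gr: "grown A S" and V: "finite V" "V \<noteq> {}" and E: "sym E"
    and w: "\<And>x y. x \<in> V \<Longrightarrow> y \<in> V \<Longrightarrow> (x, y) \<in> E \<Longrightarrow> 0 < w x y \<and> w y x = w x y"
    and W: "\<And>x. x \<in> V \<Longrightarrow> W x = (\<Sum>y\<in>{y \<in> V. (x, y) \<in> E}. w x y)" "\<And>x. x \<in> V \<Longrightarrow> 0 < W x"
  defines "T \<equiv> \<Sum>x\<in>V. W x"
  shows "exp (ln T - (\<Sum>x\<in>V. W x * ln (W x)) / T + real (card S - 1) *
      ((\<Sum>x\<in>V. W x * ln (W x) - (\<Sum>y\<in>{y \<in> V. (x, y) \<in> E}. w x y * ln (w x y))) / T))
    \<le> card (homs S A V E)"
proof -
  let ?N = "\<lambda>x. {y \<in> V. (x, y) \<in> E}"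
  have T: "0 < T" unfolding T_def using V W by (intro sum_pos) auto
  have wp: "0 < w x y" if "x \<in> V" "y \<in> ?N x" for x y using w that by auto
  define H where "H = (\<Sum>x\<in>V. W x / T * ln (W x / T))"
  define R where "R = (\<Sum>x\<in>V. \<Sum>y\<in>?N x. W x / T * (w x y / W x) * ln (w x y / W x))"
  have "exp (- H - real (card S - 1) * R + (\<Sum>u\<in>S. \<Sum>x\<in>V. W x / T * 0))
      \<le> (\<Sum>f\<in>homs S A V E. exp (\<Sum>u\<in>S. 0))"
    unfolding H_def R_def
  proof (rule homs_entropy_bound[OF gr V(1) E])
    fix y assume y: "y \<in> V"
    have "(\<Sum>x\<in>?N y. W x / T * (w x y / W x)) = (\<Sum>x\<in>?N y. w y x / T)"
    proof (rule sum.cong[OF refl])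
      fix x assume "x \<in> ?N y"
      then show "W x / T * (w x y / W x) = w y x / T" using w[OF y, of x] W(2)[of x] by simp
    qed
    then show "(\<Sum>x\<in>?N y. W x / T * (w x y / W x)) = W y / T"
      using W(1)[OF y] by (simp flip: sum_divide_distrib)
  next
    show "0 < w x y / W x" if "x \<in> V" "y \<in> ?N x" for x y using wp[OF that] W(2)[OF that(1)] by simp
    show "(\<Sum>y\<in>?N x. w x y / W x) = 1" if "x \<in> V" for x
      using W(1)[OF that] W(2)[OF that] by (simp flip: sum_divide_distrib)
    show "0 < W x / T" if "x \<in> V" for x using W(2)[OF that] T by simp
    show "(\<Sum>x\<in>V. W x / T) = 1" using T by (simp add: T_def flip: sum_divide_distrib)
  qed
  moreover have "H = (\<Sum>x\<in>V. W x * ln (W x)) / T - ln T"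
  proof -
    have "(\<Sum>x\<in>V. W x / T * ln (W x / T)) = (\<Sum>x\<in>V. W x * ln (W x) / T - W x * (ln T / T))"
    proof (rule sum.cong[OF refl])
      fix x assume "x \<in> V"
      then have "ln (W x / T) = ln (W x) - ln T" using W(2)[of x] T by (simp add: ln_div)
      then show "W x / T * ln (W x / T) = W x * ln (W x) / T - W x * (ln T / T)"
        by (simp add: right_diff_distrib)
    qed
    also have "\<dots> = (\<Sum>x\<in>V. W x * ln (W x)) / T - T * (ln T / T)"
      by (simp add: sum_subtractf T_def flip: sum_divide_distrib sum_distrib_right)
    finally show ?thesis using T by (simp add: H_def)
  qed
  moreover have "R =
      - ((\<Sum>x\<in>V. W x * ln (W x) - (\<Sum>y\<in>?N x. w x y * ln (w x y))) / T)"
  proof -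
    have "(\<Sum>y\<in>?N x. W x / T * (w x y / W x) * ln (w x y / W x)) =
        - ((W x * ln (W x) - (\<Sum>y\<in>?N x. w x y * ln (w x y))) / T)" if x: "x \<in> V" for x
    proof -
      have "(\<Sum>y\<in>?N x. W x / T * (w x y / W x) * ln (w x y / W x)) =
          (\<Sum>y\<in>?N x. (w x y * ln (w x y) - w x y * ln (W x)) / T)"
        using W(2)[OF x] wp[OF x] T by (intro sum.cong refl) (simp add: ln_div algebra_simps)
      also have "\<dots> = ((\<Sum>y\<in>?N x. w x y * ln (w x y)) - W x * ln (W x)) / T"
        using W(1)[OF x] by (simp add: sum_subtractf flip: sum_divide_distrib sum_distrib_right)
      finally show ?thesis by (simp only: minus_divide_left minus_diff_eq)
    qed
    then show ?thesis by (simp add: R_def sum_negf flip: sum_divide_distrib)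
  qed
  ultimately show ?thesis by (simp add: algebra_simps)
qed

text \<open>
  The case of entropy rate \<open>ln 2\<close>. The factor in front of the power of 2 is the exponential of the entropy of
  the stationary distribution.
\<close>

lemma homs_doubling_bound:
  fixes w :: "'a \<Rightarrow> 'a \<Rightarrow> real" and W :: "'a \<Rightarrow> real"
  assumes gr: "grown A S" and V: "finite V" "V \<noteq> {}" and E: "sym E"
    and w: "\<And>x y. x \<in> V \<Longrightarrow> y \<in> V \<Longrightarrow> (x, y) \<in> E \<Longrightarrow> 0 < w x y \<and> w y x = w x y"
    and W: "\<And>x. x \<in> V \<Longrightarrow> W x = (\<Sum>y\<in>{y \<in> V. (x, y) \<in> E}. w x y)" "\<And>x. x \<in> V \<Longrightarrow> 0 < W x"
    and T: "T = (\<Sum>x\<in>V. W x)"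
    and rate: "(\<Sum>x\<in>V. W x * ln (W x) - (\<Sum>y\<in>{y \<in> V. (x, y) \<in> E}. w x y * ln (w x y))) = T * ln 2"
  shows "T * exp (- ((\<Sum>x\<in>V. W x * ln (W x)) / T)) * 2 ^ (card S - 1) \<le> card (homs S A V E)"
proof -
  have Tpos: "0 < T" unfolding T using V W by (intro sum_pos) auto
  have "exp (real (card S - 1) * ln 2) = (2::real) ^ (card S - 1)"
    by (simp add: exp_of_nat_mult)
  moreover have "exp (ln T - a + b) = T * exp (- a) * exp b" for a b
    using Tpos by (simp add: exp_add exp_diff exp_minus divide_inverse)
  moreover have "T * ln 2 / T = ln 2" using Tpos by simp
  ultimately have "exp (ln T - (\<Sum>x\<in>V. W x * ln (W x)) / T + real (card S - 1) * (T * ln 2 / T)) =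
      T * exp (- ((\<Sum>x\<in>V. W x * ln (W x)) / T)) * 2 ^ (card S - 1)"
    by (simp only:)
  then show ?thesis
    using homs_weighted_walk_bound[OF gr V E w W] rate by (simp add: T)
qed

section \<open>Trees with many branches\<close>

definition branchy :: "'a set \<Rightarrow> ('a \<times> 'a) set \<Rightarrow> bool" where
  "branchy V E \<longleftrightarrow> (\<exists>x\<in>V. 4 \<le> deg V E x) \<or> (\<exists>X\<subseteq>V. card X = 3 \<and> (\<forall>x\<in>X. 3 \<le> deg V E x))"

text \<open>
  The contribution of a vertex of degree \<open>d\<close> to the entropy, after the part that is linear in \<open>d\<close> has
  been subtracted with a slope that makes degrees 1 and 2 neutral. For \<open>d = 3\<close> the bound is the inequality
  \<open>2 ^ 14 \<le> 3 ^ 9\<close>; three such vertices then weigh as much as one of degree 4.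
\<close>

lemma degree_entropy:
  fixes d :: nat
  assumes "1 \<le> d"
  defines "g \<equiv> real d * ln d - (2 * real d - 2) * ln 2"
  shows "0 \<le> g" "3 \<le> d \<Longrightarrow> 2 / 3 * ln 2 \<le> g" "4 \<le> d \<Longrightarrow> 2 * ln 2 \<le> g"
proof -
  show big: "2 * ln 2 \<le> g" if "4 \<le> d"
  proof -
    have "ln 4 = 2 * ln (2::real)" using ln_realpow[of 2 2] by simp
    moreover have "ln 4 \<le> ln (real d)" using that by simp
    ultimately have "real d * (2 * ln 2) \<le> real d * ln d" by (intro mult_left_mono) auto
    then show ?thesis by (simp add: g_def algebra_simps)
  qed
  have three: "2 / 3 * ln 2 \<le> g" if "d = 3"
  proof -
    have "14 * ln (2::real) = ln (2 ^ 14)" by (subst ln_realpow) simp_all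
    also have "\<dots> \<le> ln (3 ^ 9)" by simp
    also have "\<dots> = 9 * ln (3::real)" by (subst ln_realpow) simp_all
    finally have "14 * ln (2::real) \<le> 9 * ln 3" .
    then show ?thesis using that by (simp add: g_def)
  qed
  have ln2: "0 \<le> ln (2::real)" by simp
  show "2 / 3 * ln 2 \<le> g" if "3 \<le> d"
  proof (cases "d = 3")
    case False
    then have "2 * ln 2 \<le> g" using that big by simp
    then show ?thesis using ln2 by linarith
  qed (rule three)
  consider "d = 1" | "d = 2" | "d = 3" | "4 \<le> d" using assms(1) by linarith
  then show "0 \<le> g"
  proof cases
    case 3 then show ?thesis using three ln2 by linarith
  next
    case 4 then show ?thesis using big ln2 by linarith
  qed (auto simp: g_def)
qed

text \<open>
  The simple random walk on a tree with enough branching has entropy rate at least \<open>ln 2\<close>: leaves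
  lose and branch vertices gain, and the degree sum turns the balance into the non-negative
  contributions bounded above.
\<close>

lemma branchy_homs:
  assumes T: "grown A S" "2 \<le> card S" and G: "grown E V" "sym E" "2 \<le> card V"
    and branchy: "branchy V E"
  shows "(card V - 1) * 2 ^ (card S - 1) \<le> card (homs S A V E)"
proof -
  define n where "n = card V"
  define d where "d x = real (deg V E x)" for x
  define X where "X = (\<Sum>x\<in>V. d x * ln (d x))"
  define D where "D = (\<Sum>x\<in>V. d x)"
  define g where "g x = d x * ln (d x) - (2 * d x - 2) * ln 2" for x
  have finV: "finite V" "V \<noteq> {}" using G grown_finite by blast+
  have dpos: "1 \<le> deg V E x" if "x \<in> V" for x using grown_deg_pos[OF G(1) that G(3)] .
  have D: "D = 2 * (real n - 1)"
  proof -
    have "D = real (\<Sum>x\<in>V. deg V E x)" by (simp add: D_def d_def)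
    also have "\<dots> = real (2 * (n - 1))" unfolding grown_sum_deg[OF G(1)] n_def ..
    finally show ?thesis using G(3) by (simp add: n_def)
  qed
  have g: "0 \<le> g x" "3 \<le> deg V E x \<Longrightarrow> 2 / 3 * ln 2 \<le> g x" "4 \<le> deg V E x \<Longrightarrow> 2 * ln 2 \<le> g x"
    if "x \<in> V" for x
    using degree_entropy[OF dpos[OF that]] by (simp_all add: g_def d_def)
  have sub: "(\<Sum>x\<in>Y. g x) \<le> (\<Sum>x\<in>V. g x)" if "Y \<subseteq> V" for Y
    using that finV g by (intro sum_mono2) auto
  have "2 * ln 2 \<le> (\<Sum>x\<in>V. g x)"
    using branchy unfolding branchy_def
  proof (elim disjE bexE exE conjE)
    fix x assume "x \<in> V" "4 \<le> deg V E x"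
    then show ?thesis using sub[of "{x}"] g(3)[of x] by simp
  next
    fix Y assume Y: "Y \<subseteq> V" "card Y = 3" "\<forall>x\<in>Y. 3 \<le> deg V E x"
    then have "(\<Sum>x\<in>Y. 2 / 3 * ln 2) \<le> (\<Sum>x\<in>Y. g x)" using g by (intro sum_mono) auto
    then show ?thesis using sub[OF Y(1)] Y(2) by simp
  qed
  also have "(\<Sum>x\<in>V. g x) = X - (\<Sum>x\<in>V. (2 * d x - 2) * ln 2)"
    by (simp add: g_def X_def sum_subtractf)
  also have "(\<Sum>x\<in>V. (2 * d x - 2) * ln 2) = (2 * D - 2 * real n) * ln 2"
    by (simp add: D_def n_def sum_subtractf flip: sum_distrib_right sum_distrib_left)
  finally have X: "D * ln 2 \<le> X" unfolding D by (simp add: algebra_simps)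
  have Dpos: "0 < D" using D G(3) by (simp add: n_def)
  have "exp (ln D - X / D + real (card S - 1) * (X / D)) \<le> card (homs S A V E)"
  proof -
    have "exp (ln (\<Sum>x\<in>V. d x) - (\<Sum>x\<in>V. d x * ln (d x)) / (\<Sum>x\<in>V. d x) + real (card S - 1) *
        ((\<Sum>x\<in>V. d x * ln (d x) - (\<Sum>y\<in>{y \<in> V. (x, y) \<in> E}. 1 * ln 1)) / (\<Sum>x\<in>V. d x)))
      \<le> card (homs S A V E)"
      by (rule homs_weighted_walk_bound[OF T(1) finV G(2)])
        (use dpos in \<open>fastforce simp: d_def deg_def\<close>)+
    then show ?thesis by (simp add: X_def D_def)
  qed
  moreover have "ln D + real (card S - 2) * ln 2 \<le> ln D - X / D + real (card S - 1) * (X / D)"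
  proof -
    have "real (card S - 1) = real (card S - 2) + 1" using T(2) by (simp add: of_nat_diff)
    then have "ln D - X / D + real (card S - 1) * (X / D) = ln D + real (card S - 2) * (X / D)"
      by (simp add: algebra_simps)
    moreover have "ln 2 \<le> X / D" using X Dpos by (simp add: field_simps)
    then have "real (card S - 2) * ln 2 \<le> real (card S - 2) * (X / D)"
      by (intro mult_left_mono) auto
    ultimately show ?thesis by linarith
  qed
  ultimately have "exp (ln D + real (card S - 2) * ln 2) \<le> card (homs S A V E)"
    by (meson exp_le_cancel_iff order_trans)
  also have "exp (ln D + real (card S - 2) * ln 2) = D * 2 ^ (card S - 2)"
    using Dpos by (simp add: exp_add exp_of_nat_mult)
  also have "\<dots> = (real n - 1) * (2 * 2 ^ (card S - 2))" by (simp add: D)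
  also have "2 * 2 ^ (card S - 2) = (2::real) ^ (card S - 1)"
    using T(2) by (simp flip: power_Suc)
  finally have "(real n - 1) * 2 ^ (card S - 1) \<le> real (card (homs S A V E))" .
  then have "real ((n - 1) * 2 ^ (card S - 1)) \<le> real (card (homs S A V E))"
    using G(3) by (simp add: n_def of_nat_diff)
  then show ?thesis unfolding n_def by linarith
qed

text \<open>
  A frame consists of \<open>k\<close> disjoint paths, the arms. Arm \<open>s\<close> has the vertices
  \<open>p s 0, \<dots>, p s (l s)\<close>, and its initial vertex is shared: it is the vertex with index \<open>b s\<close>.
  The initial vertex of the last arm is the only one that is listed as a vertex of its own.
\<close>

definition frame_idx :: "nat \<Rightarrow> (nat \<Rightarrow> nat) \<Rightarrow> (nat \<times> nat) set" where
  "frame_idx k l = insert (k - 1, 0) (SIGMA s:{..<k}. {1..l s})"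

definition frame ::
  "nat \<Rightarrow> (nat \<Rightarrow> nat \<times> nat) \<Rightarrow> 'a set \<Rightarrow> ('a \<times> 'a) set \<Rightarrow> (nat \<Rightarrow> nat \<Rightarrow> 'a) \<Rightarrow> (nat \<Rightarrow> nat) \<Rightarrow> bool" where
  "frame k b V E p l \<longleftrightarrow>
    inj_on (\<lambda>(s, t). p s t) (frame_idx k l) \<and> (\<lambda>(s, t). p s t) ` frame_idx k l \<subseteq> V \<and>
    (\<forall>s<k. 1 \<le> l s \<and> p s 0 = (\<lambda>(s, t). p s t) (b s) \<and> b s \<in> frame_idx k l \<and>
      (fst (b s) = s \<longrightarrow> snd (b s) = 0) \<and> (\<forall>t<l s. (p s t, p s (Suc t)) \<in> E))"

lemma frame_arm:
  assumes "frame k b V E p l" "s < k"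
  shows "1 \<le> l s" "p s 0 = (\<lambda>(s, t). p s t) (b s)" "b s \<in> frame_idx k l"
    "fst (b s) = s \<longrightarrow> snd (b s) = 0" "\<And>t. t < l s \<Longrightarrow> (p s t, p s (Suc t)) \<in> E"
  using assms unfolding frame_def by blast+

text \<open>The common initial vertex of the three arms is listed with the last arm, as \<open>(2, 0)\<close>.\<close>

definition tripod where
  "tripod = frame 3 (\<lambda>_. (2, 0))"

text \<open>Arm 4 joins two branch vertices; arms 0 and 1 start at one of them, arms 2 and 3 at the other.\<close>

definition dumbbell where
  "dumbbell V E p l = frame 5 (\<lambda>s. if s = 2 \<or> s = 3 then (4, l 4) else (4, 0)) V E p l"

lemma card_frame_idx: "card (frame_idx k l) = (\<Sum>s<k. l s) + 1"
  unfolding frame_idx_def by (subst card_insert_disjoint) auto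

lemma frame_size:
  assumes "frame k b V E p l" "finite V"
  shows "(\<Sum>s<k. l s) + 1 \<le> card V"
  using card_inj_on_le[of "\<lambda>(s, t). p s t" "frame_idx k l" V] assms
  by (simp add: frame_def card_frame_idx)

lemma frame_neighbour:
  assumes fr: "frame k b V E p l" and G: "grown E V" and small: "(\<Sum>s<k. l s) + 1 \<noteq> card V"
  obtains s t v where "(s, t) \<in> frame_idx k l" "v \<in> V" "v \<notin> (\<lambda>(s, t). p s t) ` frame_idx k l"
    "(p s t, v) \<in> E"
proof -
  let ?X = "(\<lambda>(s, t). p s t) ` frame_idx k l"
  have "card ?X \<noteq> card V" using fr small by (simp add: frame_def card_image card_frame_idx)
  then have "?X \<noteq> V" by blast
  moreover have "?X \<subseteq> V" "?X \<noteq> {}" using fr by (auto simp: frame_def frame_idx_def)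
  ultimately show ?thesis using grown_crossing[OF G, of ?X] that by fastforce
qed

text \<open>
  A new vertex next to the end of an arm prolongs that arm. The indices \<open>b s\<close> of the initial vertices
  stay valid because they are old indices.
\<close>

lemma frame_extend:
  assumes fr: "frame k b V E p l" and s: "s < k" and v: "v \<in> V" "v \<notin> (\<lambda>(s, t). p s t) ` frame_idx k l"
    and e: "(p s (l s), v) \<in> E"
  defines "p' \<equiv> p(s := (p s)(Suc (l s) := v))" and "l' \<equiv> l(s := Suc (l s))"
  shows "frame k b V E p' l'"
proof -
  have idx: "frame_idx k l' = insert (s, Suc (l s)) (frame_idx k l)"
    using s by (auto simp: frame_idx_def l'_def split: if_splits)
  have new: "(s, Suc (l s)) \<notin> frame_idx k l" by (auto simp: frame_idx_def)
  have same: "(\<lambda>(s, t). p' s t) i = (\<lambda>(s, t). p s t) i" if "i \<in> frame_idx k l" for i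
    using that new by (cases i) (auto simp: p'_def)
  have img: "(\<lambda>(s, t). p' s t) ` frame_idx k l = (\<lambda>(s, t). p s t) ` frame_idx k l"
    by (rule image_cong[OF refl same])
  have "inj_on (\<lambda>(s, t). p' s t) (frame_idx k l)"
    using fr same by (auto simp: frame_def cong: inj_on_cong)
  moreover have "(\<lambda>(s, t). p' s t) (s, Suc (l s)) = v" by (simp add: p'_def)
  ultimately have inj: "inj_on (\<lambda>(s, t). p' s t) (frame_idx k l')"
    unfolding idx using v img new by (simp add: inj_on_insert)
  have "(\<lambda>(s, t). p' s t) ` frame_idx k l' \<subseteq> V"
    unfolding idx using fr v img by (simp add: frame_def p'_def)
  moreover have "1 \<le> l' r \<and> p' r 0 = (\<lambda>(s, t). p' s t) (b r) \<and> b r \<in> frame_idx k l' \<and>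
      (fst (b r) = r \<longrightarrow> snd (b r) = 0) \<and> (\<forall>t<l' r. (p' r t, p' r (Suc t)) \<in> E)" if r: "r < k" for r
  proof -
    have fr': "1 \<le> l r" "p r 0 = (\<lambda>(s, t). p s t) (b r)" "b r \<in> frame_idx k l"
      "fst (b r) = r \<longrightarrow> snd (b r) = 0" "\<forall>t<l r. (p r t, p r (Suc t)) \<in> E"
      using fr r by (auto simp: frame_def)
    have "p' r 0 = p r 0" by (simp add: p'_def)
    moreover have "(p' r t, p' r (Suc t)) \<in> E" if "t < l' r" for t
      using that fr'(5) e by (auto simp: p'_def l'_def less_Suc_eq split: if_splits)
    ultimately show ?thesis using fr' same[OF fr'(3)] idx by (auto simp: l'_def)
  qed
  ultimately show ?thesis using inj unfolding frame_def by blast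
qed

lemma deg_ge:
  assumes "finite V" "Y \<subseteq> V" "\<And>y. y \<in> Y \<Longrightarrow> (x, y) \<in> E"
  shows "card Y \<le> deg V E x"
  unfolding deg_def using assms by (intro card_mono) auto

lemma frame_in: "frame k b V E p l \<Longrightarrow> (s, t) \<in> frame_idx k l \<Longrightarrow> p s t \<in> V"
  by (auto simp: frame_def)

lemma frame_eq:
  "frame k b V E p l \<Longrightarrow> (s, t) \<in> frame_idx k l \<Longrightarrow> (s', t') \<in> frame_idx k l \<Longrightarrow>
    p s t = p s' t' \<longleftrightarrow> s = s' \<and> t = t'"
  using inj_on_eq_iff[of "\<lambda>(s, t). p s t" "frame_idx k l" "(s, t)" "(s', t')"]
  by (simp add: frame_def)

lemma frame_deg3:
  assumes fr: "frame k b V E p l" and V: "finite V" "sym E" and s: "s < k" "1 \<le> t" "t < l s"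
    and v: "v \<in> V" "v \<notin> (\<lambda>(s, t). p s t) ` frame_idx k l" "(p s t, v) \<in> E"
  shows "3 \<le> deg V E (p s t)"
proof -
  obtain i where i: "i \<in> frame_idx k l" "i \<noteq> (s, Suc t)" "p s (t - 1) = (\<lambda>(s, t). p s t) i"
  proof (cases "t = 1")
    case True
    have bs: "b s \<in> frame_idx k l" "fst (b s) = s \<longrightarrow> snd (b s) = 0" "p s 0 = (\<lambda>(s, t). p s t) (b s)"
      using fr s by (auto simp: frame_def)
    then have "b s \<noteq> (s, Suc t)" by auto
    then show ?thesis using bs True that[of "b s"] by simp
  next
    case False
    then have "1 \<le> t - 1" "t - 1 \<le> l s" "t - 1 \<noteq> Suc t" using s by linarith+
    then show ?thesis using s that[of "(s, t - 1)"] by (auto simp: frame_idx_def)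
  qed
  have up: "(s, Suc t) \<in> frame_idx k l" using s by (auto simp: frame_idx_def)
  let ?F = "\<lambda>(s, t). p s t"
  have inj: "inj_on ?F (frame_idx k l)" and arm: "\<And>t. t < l s \<Longrightarrow> (p s t, p s (Suc t)) \<in> E"
    using fr s by (auto simp: frame_def)
  have "?F i \<noteq> ?F (s, Suc t)" using inj_on_eq_iff[OF inj i(1) up] i(2) by blast
  then have "p s (t - 1) \<noteq> p s (Suc t)" using i(3) by simp
  moreover have "v \<noteq> ?F j" if "j \<in> frame_idx k l" for j using v(2) that by blast
  from this[OF i(1)] this[OF up] have "v \<noteq> p s (t - 1)" "v \<noteq> p s (Suc t)" using i(3) by simp_all
  ultimately have "card {p s (t - 1), p s (Suc t), v} = 3" by auto
  moreover have "(p s (t - 1), p s t) \<in> E" using arm[of "t - 1"] s by simp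
  then have "(p s t, p s (t - 1)) \<in> E" by (rule symD[OF V(2)])
  moreover have "(p s t, p s (Suc t)) \<in> E" using arm s by simp
  moreover have "p s (t - 1) \<in> V" "p s (Suc t) \<in> V" using fr i up by (auto simp: frame_def)
  ultimately show ?thesis
    using deg_ge[OF V(1), of "{p s (t - 1), p s (Suc t), v}" "p s t" E] v by auto
qed

section \<open>The shapes of trees with few branches\<close>

lemma in_frame_idx: "(s, t) \<in> frame_idx k l \<longleftrightarrow> s = k - 1 \<and> t = 0 \<or> s < k \<and> 1 \<le> t \<and> t \<le> l s"
  by (auto simp: frame_idx_def)

lemma less_3_cases: "s < (3::nat) \<longleftrightarrow> s = 0 \<or> s = 1 \<or> s = 2" by auto

lemma less_5_cases: "s < (5::nat) \<longleftrightarrow> s = 0 \<or> s = 1 \<or> s = 2 \<or> s = 3 \<or> s = 4" by auto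

lemma sum_increment:
  fixes l :: "'i \<Rightarrow> nat"
  assumes "finite I" "s \<in> I"
  shows "(\<Sum>r\<in>I. (l(s := Suc (l s))) r) = Suc (\<Sum>r\<in>I. l r)"
proof -
  have "(\<Sum>r\<in>I - {s}. (l(s := Suc (l s))) r) = (\<Sum>r\<in>I - {s}. l r)" by (intro sum.cong) auto
  then show ?thesis using sum.remove[OF assms, of l] sum.remove[OF assms, of "l(s := Suc (l s))"] by simp
qed

text \<open>
  A longest path that is not spanning has a further neighbour. By maximality that neighbour is
  attached to an inner vertex, which becomes the centre of a tripod. The next two lemmas continue in
  the same way with a largest tripod and a largest dumbbell.
\<close>

lemma spanning_path_or_tripod:
  assumes G: "grown E V" "sym E"
  shows "(\<exists>\<phi>. embeds \<phi> {..<card V} path_arcs V E) \<or> (\<exists>p l. tripod V E p l)"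
proof -
  have finV: "finite V" using G grown_finite by blast
  let ?P = "\<lambda>k. \<exists>\<phi>. embeds \<phi> {..<Suc k} path_arcs V E"
  obtain v0 where "v0 \<in> V" using G grown_finite by blast
  then have P0: "?P 0" by (intro exI[of _ "\<lambda>_. v0"]) (auto simp: embeds_def path_arcs_def inj_on_def)
  have bound: "\<forall>k. ?P k \<longrightarrow> k < card V"
  proof (intro allI impI)
    fix k assume "?P k"
    then obtain \<phi> where "inj_on \<phi> {..<Suc k}" "\<phi> ` {..<Suc k} \<subseteq> V" by (auto simp: embeds_def)
    then have "card {..<Suc k} \<le> card V" using finV by (rule card_inj_on_le)
    then show "k < card V" by simp
  qed
  have "\<exists>k. ?P k \<and> (\<forall>j. ?P j \<longrightarrow> j \<le> k)" by (rule ex_has_greatest_nat[OF P0 bound])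
  then obtain k where k: "?P k \<and> (\<forall>j. ?P j \<longrightarrow> j \<le> k)" ..
  note max = conjunct2[OF k, rule_format]
  from conjunct1[OF k] obtain \<phi> where emb: "embeds \<phi> {..<Suc k} path_arcs V E" by blast
  have inj: "\<phi> x = \<phi> y \<longleftrightarrow> x = y" if "x \<le> k" "y \<le> k" for x y
    using inj_on_eq_iff[of \<phi> "{..<Suc k}" x y] emb that by (simp add: embeds_def)
  have \<phi>V: "\<phi> x \<in> V" if "x \<le> k" for x using emb that by (auto simp: embeds_def)
  have up: "(\<phi> x, \<phi> (Suc x)) \<in> E" if "x < k" for x
    using emb that by (auto simp: embeds_def path_arcs_def)
  have down: "(\<phi> (Suc x), \<phi> x) \<in> E" if "x < k" for x using symD[OF G(2) up[OF that]] .
  show ?thesis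
  proof (cases "Suc k = card V")
    case True
    then show ?thesis using emb by auto
  next
    case False
    have "card (\<phi> ` {..<Suc k}) = Suc k" using emb by (simp add: embeds_def card_image)
    then have neq: "\<phi> ` {..<Suc k} \<noteq> V" using False by metis
    have sub: "\<phi> ` {..<Suc k} \<subseteq> V" using emb by (simp add: embeds_def)
    have "\<exists>u\<in>\<phi> ` {..<Suc k}. \<exists>v\<in>V - \<phi> ` {..<Suc k}. (u, v) \<in> E"
      by (rule grown_crossing[OF G(1) sub _ neq]) (simp add: lessThan_Suc)
    then obtain z v where z: "z \<le> k" and v: "v \<in> V" "v \<notin> \<phi> ` {..<Suc k}" and zv: "(\<phi> z, v) \<in> E"
      by (auto simp: less_Suc_eq_le)
    have vz: "(v, \<phi> z) \<in> E" using symD[OF G(2) zv] .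
    have new: "\<phi> x \<noteq> v" if "x \<le> k" for x using v that by auto
    have "z \<noteq> k"
    proof
      assume "z = k"
      then have "embeds (\<lambda>x. if x = Suc k then v else \<phi> x) {..<Suc (Suc k)} path_arcs V E"
        using inj new new[symmetric] \<phi>V v up down zv vz
        by (auto simp: embeds_def inj_on_def path_arcs_def less_Suc_eq_le)
      then have "Suc k \<le> k" using max by blast
      then show False by simp
    qed
    moreover have "z \<noteq> 0"
    proof
      assume "z = 0"
      have "embeds (\<lambda>x. if x = 0 then v else \<phi> (x - 1)) {..<Suc (Suc k)} path_arcs V E"
        unfolding embeds_def
      proof (intro conjI ballI impI)
        show "inj_on (\<lambda>x. if x = 0 then v else \<phi> (x - 1)) {..<Suc (Suc k)}"
        proof (rule inj_onI)
          fix x y assume xy: "x \<in> {..<Suc (Suc k)}" "y \<in> {..<Suc (Suc k)}"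
            "(if x = 0 then v else \<phi> (x - 1)) = (if y = 0 then v else \<phi> (y - 1))"
          then have "x - 1 \<le> k" "y - 1 \<le> k" by auto
          then show "x = y" using xy inj[of "x - 1" "y - 1"] new[of "x - 1"] new[of "y - 1"]
            by (auto split: if_splits)
        qed
        show "(\<lambda>x. if x = 0 then v else \<phi> (x - 1)) ` {..<Suc (Suc k)} \<subseteq> V"
          using \<phi>V v by auto
        fix x y assume "x \<in> {..<Suc (Suc k)}" "y \<in> {..<Suc (Suc k)}" "(x, y) \<in> path_arcs"
        then show "(if x = 0 then v else \<phi> (x - 1), if y = 0 then v else \<phi> (y - 1)) \<in> E"
          using up[of "x - 1"] down[of "y - 1"] zv vz \<open>z = 0\<close> by (auto simp: path_arcs_def)
      qed
      then have "Suc k \<le> k" using max by blast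
      then show False by simp
    qed
    ultimately have z': "0 < z" "z < k" using z by auto
    define p where "p s t = (if s = 0 then \<phi> (z + t) else if s = Suc 0 then \<phi> (z - t)
      else if t = 0 then \<phi> z else v)" for s t :: nat
    define l where "l s = (if s = 0 then k - z else if s = 1 then z else 1)" for s :: nat
    have "tripod V E p l"
      unfolding tripod_def frame_def
    proof (intro conjI allI impI)
      show "inj_on (\<lambda>(s, t). p s t) (frame_idx 3 l)"
      proof -
        define \<psi> where "\<psi> x = (if x = Suc k then v else \<phi> x)" for x
        define pos where "pos = (\<lambda>(s, t). if s = 0 then z + t else if s = Suc 0 then z - t
          else if t = 0 then z else Suc k)"
        have le: "pos i \<le> Suc k" if "i \<in> frame_idx 3 l" for i
          using that z' by (auto simp: in_frame_idx less_3_cases pos_def l_def split: prod.splits)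
        have "inj_on pos (frame_idx 3 l)"
        proof (rule inj_onI, clarify)
          fix s t s' t' assume "(s, t) \<in> frame_idx 3 l" "(s', t') \<in> frame_idx 3 l"
            "pos (s, t) = pos (s', t')"
          then show "s = s' \<and> t = t'" using z'
            unfolding in_frame_idx less_3_cases pos_def l_def by (simp split: if_split_asm) arith+
        qed
        moreover have "inj_on \<psi> {..Suc k}"
          using inj new new[symmetric] by (intro inj_onI) (auto simp: \<psi>_def le_Suc_eq split: if_splits)
        then have "inj_on \<psi> (pos ` frame_idx 3 l)" by (rule inj_on_subset) (use le in auto)
        ultimately have "inj_on (\<psi> \<circ> pos) (frame_idx 3 l)" by (rule comp_inj_on)
        moreover have "(\<lambda>(s, t). p s t) i = (\<psi> \<circ> pos) i" if "i \<in> frame_idx 3 l" for i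
          using that z' by (cases i) (auto simp: in_frame_idx less_3_cases pos_def l_def p_def \<psi>_def)
        ultimately show ?thesis by (simp cong: inj_on_cong)
      qed
      show "(\<lambda>(s, t). p s t) ` frame_idx 3 l \<subseteq> V"
        using z' \<phi>V v by (auto simp: in_frame_idx less_3_cases p_def l_def)
      fix s :: nat assume s: "s < 3"
      show "1 \<le> l s" using s z' by (auto simp: less_3_cases l_def)
      show "p s 0 = (\<lambda>(s, t). p s t) (2, 0)" using s by (auto simp: less_3_cases p_def)
      show "(2, 0) \<in> frame_idx 3 l" by (simp add: in_frame_idx)
      show "snd (2::nat, 0::nat) = 0" by simp
      fix t assume "t < l s"
      moreover have "(\<phi> (z - t), \<phi> (z - Suc t)) \<in> E" if "t < z"
        using down[of "z - Suc t"] that z' by (simp add: Suc_diff_Suc)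
      ultimately show "(p s t, p s (Suc t)) \<in> E"
        using s z' zv up[of "z + t"] by (auto simp: less_3_cases p_def l_def)
    qed
    then show ?thesis by blast
  qed
qed

lemma spanning_tripod_or_dumbbell:
  assumes G: "grown E V" "sym E" and tri: "tripod V E p0 l0" and nb: "\<not> branchy V E"
  shows "(\<exists>p l. tripod V E p l \<and> (\<Sum>s<3. l s) + 1 = card V) \<or> (\<exists>p l. dumbbell V E p l)"
proof -
  have finV: "finite V" using G grown_finite by blast
  let ?P = "\<lambda>(p, l). tripod V E p l"
  let ?f = "\<lambda>(p :: nat \<Rightarrow> nat \<Rightarrow> 'a, l). \<Sum>s<3. l s :: nat"
  have P0: "?P (p0, l0)" using tri by simp
  have bound: "\<forall>x. ?P x \<longrightarrow> ?f x < card V"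
    by (auto simp: tripod_def Suc_le_eq dest!: frame_size[OF _ finV])
  have "\<exists>x. ?P x \<and> (\<forall>y. ?P y \<longrightarrow> ?f y \<le> ?f x)" by (rule ex_has_greatest_nat[OF P0 bound])
  then obtain x where x: "?P x" "\<forall>y. ?P y \<longrightarrow> ?f y \<le> ?f x" by (elim exE conjE) (rule that)
  obtain p l where pl: "x = (p, l)" by (cases x)
  have tri: "tripod V E p l" using x(1) pl by simp
  have max: "(\<Sum>s<3. l' s) \<le> (\<Sum>s<3. l s)" if "tripod V E p' l'" for p' l'
    using x(2)[rule_format, of "(p', l')"] that pl by simp
  note fr = tri[unfolded tripod_def]
  show ?thesis
  proof (cases "(\<Sum>s<3. l s) + 1 = card V")
    case True
    then show ?thesis using tri by blast
  next
    case False
    obtain s t v where st: "(s, t) \<in> frame_idx 3 l"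
      and v: "v \<in> V" "v \<notin> (\<lambda>(s, t). p s t) ` frame_idx 3 l" and e: "(p s t, v) \<in> E"
      by (rule frame_neighbour[OF fr G(1) False]) (rule that)
    have new: "p s t \<noteq> v" if "(s, t) \<in> frame_idx 3 l" for s t
      using imageI[OF that, of "\<lambda>(s, t). p s t"] v(2) by auto
    have len: "1 \<le> l s" "p s 0 = p 2 0" "\<And>t. t < l s \<Longrightarrow> (p s t, p s (Suc t)) \<in> E" if "s < 3" for s
    proof -
      show "1 \<le> l s" by (rule frame_arm(1)[OF fr that])
      show "p s 0 = p 2 0" using frame_arm(2)[OF fr that] by (simp only: case_prod_conv)
      show "(p s t, p s (Suc t)) \<in> E" if "t < l s" for t by (rule frame_arm(5)[OF fr \<open>s < 3\<close> that])
    qed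
    consider "s = 2" "t = 0" | "s < 3" "t = l s" | "s < 3" "1 \<le> t" "t < l s"
      using st by (auto simp: in_frame_idx le_less)
    then show ?thesis
    proof cases
      case 1
      have idx: "(0, 1) \<in> frame_idx 3 l" "(1, 1) \<in> frame_idx 3 l" "(2, 1) \<in> frame_idx 3 l"
        using len(1)[of 0] len(1)[of 1] len(1)[of 2] by (auto simp: in_frame_idx)
      let ?Y = "{p 0 1, p 1 1, p 2 1, v}"
      have "card ?Y = 4"
        using frame_eq[OF fr] idx new[OF idx(1)] new[OF idx(2)] new[OF idx(3)] by simp
      moreover have "?Y \<subseteq> V" using frame_in[OF fr] idx v by simp
      moreover have "(p 2 0, y) \<in> E" if "y \<in> ?Y" for y
        using that len(2)[of 0] len(3)[of 0 0] len(2)[of 1] len(3)[of 1 0] len(3)[of 2 0]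
          len(1)[of 0] len(1)[of 1] len(1)[of 2] e 1 by auto
      ultimately have "4 \<le> deg V E (p 2 0)" using deg_ge[OF finV, of ?Y "p 2 0" E] by simp
      then have "branchy V E" using frame_in[OF fr st] 1 by (auto simp: branchy_def)
      then show ?thesis using nb by simp
    next
      case 2
      have "tripod V E (p(s := (p s)(Suc (l s) := v))) (l(s := Suc (l s)))"
        unfolding tripod_def by (rule frame_extend[OF fr 2(1) v]) (use e 2 in simp)
      then have "(\<Sum>r<3. (l(s := Suc (l s))) r) \<le> (\<Sum>r<3. l r)" by (rule max)
      moreover have "(\<Sum>r<3. (l(s := Suc (l s))) r) = Suc (\<Sum>r<3. l r)"
        by (rule sum_increment) (use 2 in auto)
      ultimately show ?thesis by simp
    next
      case 3
      obtain a c where ac: "a < 3" "c < 3" "a \<noteq> c" "a \<noteq> s" "c \<noteq> s"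
      proof -
        have "s = 0 \<or> s = 1 \<or> s = 2" using 3 by auto
        then show ?thesis using that[of 0 1] that[of 0 2] that[of 1 2] by auto
      qed
      \<comment> \<open>Vertex \<open>t\<close> of arm \<open>s\<close> becomes the second branch vertex, with the new vertex \<open>v\<close> as arm 3.
        Apart from \<open>v\<close>, the new indices are translated into the old ones by \<open>\<rho>\<close>.\<close>
      define p' where "p' r u = (if r = 0 then p a u else if r = 1 then p c u
        else if r = 2 then p s (t + u) else if r = 3 then (if u = 0 then p s t else v) else p s u)"
        for r u :: nat
      define l' where "l' r = (if r = 0 then l a else if r = 1 then l c
        else if r = 2 then l s - t else if r = 3 then 1 else t)" for r :: nat
      define \<rho> where "\<rho> = (\<lambda>(r :: nat, u). if r = 0 then (a, u) else if r = 1 then (c, u)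
        else if r = 2 then (s, t + u) else if u = 0 then (2, 0) else (s, u :: nat))"
      let ?I = "frame_idx 5 l' - {(3, 1)}"
      have \<rho>: "\<rho> i \<in> frame_idx 3 l \<and> (\<lambda>(s, t). p' s t) i = (\<lambda>(s, t). p s t) (\<rho> i)"
        if "i \<in> ?I" for i
        using that ac 3 len(2)[of s]
        by (cases i) (auto simp: \<rho>_def in_frame_idx less_5_cases l'_def p'_def split: if_splits)
      have inj\<rho>: "inj_on \<rho> ?I"
      proof (rule inj_on_inverseI)
        fix i assume "i \<in> ?I"
        then show "(\<lambda>(q, w). if w = 0 then (4, 0) else if q = a then (0, w) else if q = c then (1, w)
            else if w \<le> t then (4, w) else (2, w - t)) (\<rho> i) = i"
          using ac 3 by (cases i) (auto simp: \<rho>_def in_frame_idx less_5_cases l'_def)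
      qed
      have inj: "inj_on (\<lambda>(s, t). p s t) (frame_idx 3 l)" using fr by (simp add: frame_def)
      have inj': "inj_on (\<lambda>(s, t). p' s t) ?I"
      proof (rule inj_onI)
        fix i j assume ij: "i \<in> ?I" "j \<in> ?I" "(\<lambda>(s, t). p' s t) i = (\<lambda>(s, t). p' s t) j"
        then have "\<rho> i = \<rho> j" using \<rho>[OF ij(1)] \<rho>[OF ij(2)] inj_on_eq_iff[OF inj] by metis
        then show "i = j" using inj_on_eq_iff[OF inj\<rho>] ij by blast
      qed
      have img: "(\<lambda>(s, t). p' s t) ` ?I \<subseteq> (\<lambda>(s, t). p s t) ` frame_idx 3 l"
        using \<rho> by blast
      have whole: "frame_idx 5 l' = insert (3, 1) ?I" by (auto simp: in_frame_idx l'_def)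
      have p31: "(\<lambda>(s, t). p' s t) (3, 1) = v" by (simp add: p'_def)
      have "dumbbell V E p' l'"
        unfolding dumbbell_def frame_def
      proof (intro conjI allI impI)
        show "inj_on (\<lambda>(s, t). p' s t) (frame_idx 5 l')"
          by (subst whole) (use inj' img v(2) p31 in \<open>simp only: inj_on_insert, blast\<close>)
        show "(\<lambda>(s, t). p' s t) ` frame_idx 5 l' \<subseteq> V"
          by (subst whole) (use img v(1) p31 fr in \<open>simp only: image_insert frame_def, blast\<close>)
        fix r :: nat assume r: "r < 5"
        let ?b = "if r = 2 \<or> r = 3 then (4, l' 4) else (4, 0)"
        show "1 \<le> l' r" using r 3 len(1) ac by (auto simp: less_5_cases l'_def)
        show "p' r 0 = (\<lambda>(s, t). p' s t) ?b"
          using r 3 ac len(2)[of a] len(2)[of c] len(2)[of s] by (auto simp: less_5_cases p'_def l'_def)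
        show "?b \<in> frame_idx 5 l'" using 3 by (auto simp: in_frame_idx l'_def)
        show "snd ?b = 0" if "fst ?b = r" using that by (auto split: if_splits)
        fix u assume "u < l' r"
        then show "(p' r u, p' r (Suc u)) \<in> E"
          using r 3 ac len(3)[of a u] len(3)[of c u] len(3)[of s u] len(3)[of s "t + u"] e
          by (auto simp: less_5_cases p'_def l'_def split: if_splits)
      qed
      then show ?thesis by blast
    qed
  qed
qed

lemma spanning_dumbbell:
  assumes G: "grown E V" "sym E" and dum: "dumbbell V E p0 l0" and nb: "\<not> branchy V E"
  shows "\<exists>p l. dumbbell V E p l \<and> (\<Sum>s<5. l s) + 1 = card V"
proof -
  have finV: "finite V" using G grown_finite by blast
  let ?P = "\<lambda>(p, l). dumbbell V E p l"
  let ?f = "\<lambda>(p :: nat \<Rightarrow> nat \<Rightarrow> 'a, l). \<Sum>s<5. l s :: nat"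
  have P0: "?P (p0, l0)" using dum by simp
  have bound: "\<forall>x. ?P x \<longrightarrow> ?f x < card V"
    by (auto simp: dumbbell_def Suc_le_eq dest!: frame_size[OF _ finV])
  have "\<exists>x. ?P x \<and> (\<forall>y. ?P y \<longrightarrow> ?f y \<le> ?f x)" by (rule ex_has_greatest_nat[OF P0 bound])
  then obtain x where x: "?P x" "\<forall>y. ?P y \<longrightarrow> ?f y \<le> ?f x" by (elim exE conjE) (rule that)
  obtain p l where pl: "x = (p, l)" by (cases x)
  have dum: "dumbbell V E p l" using x(1) pl by simp
  have max: "(\<Sum>s<5. l' s) \<le> (\<Sum>s<5. l s)" if "dumbbell V E p' l'" for p' l'
    using x(2)[rule_format, of "(p', l')"] that pl by simp
  note fr = dum[unfolded dumbbell_def]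
  have "(\<Sum>s<5. l s) + 1 = card V"
  proof (rule ccontr)
    assume small: "(\<Sum>s<5. l s) + 1 \<noteq> card V"
    obtain s t v where st: "(s, t) \<in> frame_idx 5 l"
      and v: "v \<in> V" "v \<notin> (\<lambda>(s, t). p s t) ` frame_idx 5 l" and e: "(p s t, v) \<in> E"
      by (rule frame_neighbour[OF fr G(1) small]) (rule that)
    have new: "p s t \<noteq> v" if "(s, t) \<in> frame_idx 5 l" for s t
      using imageI[OF that, of "\<lambda>(s, t). p s t"] v(2) by auto
    have len: "1 \<le> l s" "\<And>t. t < l s \<Longrightarrow> (p s t, p s (Suc t)) \<in> E" if "s < 5" for s
      using frame_arm[OF fr that] by blast+
    have base: "p 0 0 = p 4 0" "p 1 0 = p 4 0" "p 2 0 = p 4 (l 4)" "p 3 0 = p 4 (l 4)"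
    proof -
      have "p s 0 = (\<lambda>(s, t). p s t) (if s = 2 \<or> s = 3 then (4, l 4) else (4, 0))" if "s < 5" for s
        using fr that by (simp add: frame_def)
      from this[of 0] this[of 1] this[of 2] this[of 3]
      show "p 0 0 = p 4 0" "p 1 0 = p 4 0" "p 2 0 = p 4 (l 4)" "p 3 0 = p 4 (l 4)" by simp_all
    qed
    have L: "1 \<le> l 0" "1 \<le> l 1" "1 \<le> l 2" "1 \<le> l 3" "1 \<le> l 4" using len(1) by auto
    have idx: "(0, 1) \<in> frame_idx 5 l" "(1, 1) \<in> frame_idx 5 l" "(2, 1) \<in> frame_idx 5 l"
      "(3, 1) \<in> frame_idx 5 l" "(4, 1) \<in> frame_idx 5 l" "(4, l 4 - 1) \<in> frame_idx 5 l"
      "(4, 0) \<in> frame_idx 5 l" "(4, l 4) \<in> frame_idx 5 l"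
      using L by (auto simp: in_frame_idx)
    let ?Y = "{p 0 1, p 1 1, p 4 1}" and ?Z = "{p 2 1, p 3 1, p 4 (l 4 - 1)}"
    have card: "card ?Y = 3" "card ?Z = 3" using frame_eq[OF fr] idx by simp_all
    have YV: "?Y \<subseteq> V" "?Z \<subseteq> V" using frame_in[OF fr] idx by simp_all
    have last_back: "(p 4 (l 4), p 4 (l 4 - 1)) \<in> E"
      using symD[OF G(2) len(2)[of 4 "l 4 - 1"]] L by simp
    have Yarc: "(p 4 0, y) \<in> E" if "y \<in> ?Y" for y
      using that len(2)[of 0 0] len(2)[of 1 0] len(2)[of 4 0] L base by auto
    have Zarc: "(p 4 (l 4), y) \<in> E" if "y \<in> ?Z" for y
      using that len(2)[of 2 0] len(2)[of 3 0] last_back L base by auto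
    have vYZ: "v \<notin> ?Y" "v \<notin> ?Z" using new idx by (metis empty_iff insert_iff)+
    have d3: "3 \<le> deg V E (p 4 0)" "3 \<le> deg V E (p 4 (l 4))"
      using deg_ge[OF finV YV(1) Yarc] deg_ge[OF finV YV(2) Zarc] card by simp_all
    have "s = 4 \<and> t = 0 \<or> s < 5 \<and> 1 \<le> t \<and> t \<le> l s" using st by (simp add: in_frame_idx)
    then have "s = 4 \<and> t = 0 \<or> s = 4 \<and> t = l s \<or> s < 4 \<and> t = l s \<or> s < 5 \<and> 1 \<le> t \<and> t < l s"
      by arith
    then consider "s = 4" "t = 0" | "s = 4" "t = l s" | "s < 4" "t = l s" | "s < 5" "1 \<le> t" "t < l s"
      by blast
    then show False
    proof cases
      case 1
      have "card (insert v ?Y) \<le> deg V E (p 4 0)"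
        by (rule deg_ge[OF finV]) (use v e 1 YV Yarc in auto)
      moreover have "card (insert v ?Y) = 4"
        using vYZ(1) card(1) by (subst card_insert_disjoint) simp_all
      ultimately have "branchy V E" using frame_in[OF fr st] 1 unfolding branchy_def by force
      then show False using nb by simp
    next
      case 2
      have "card (insert v ?Z) \<le> deg V E (p 4 (l 4))"
        by (rule deg_ge[OF finV]) (use v e 2 YV Zarc in auto)
      moreover have "card (insert v ?Z) = 4"
        using vYZ(2) card(2) by (subst card_insert_disjoint) simp_all
      ultimately have "branchy V E" using frame_in[OF fr st] 2 unfolding branchy_def by force
      then show False using nb by simp
    next
      case 3
      have s5: "s < 5" using 3 by simp
      have "dumbbell V E (p(s := (p s)(Suc (l s) := v))) (l(s := Suc (l s)))"
      proof -
        have "(l(s := Suc (l s))) 4 = l 4" using 3 by simp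
        moreover have "(p s (l s), v) \<in> E" using e 3 by simp
        ultimately show ?thesis
          unfolding dumbbell_def using frame_extend[OF fr s5 v] by (simp only:)
      qed
      then have "(\<Sum>r<5. (l(s := Suc (l s))) r) \<le> (\<Sum>r<5. l r)" by (rule max)
      moreover have "(\<Sum>r<5. (l(s := Suc (l s))) r) = Suc (\<Sum>r<5. l r)"
        by (rule sum_increment) (use s5 in auto)
      ultimately show False by simp
    next
      case 4
      have "3 \<le> deg V E (p s t)" by (rule frame_deg3[OF fr finV G(2) 4 v e])
      moreover have "p 4 (l 4) \<noteq> p s t" "p 4 0 \<noteq> p s t" "p 4 0 \<noteq> p 4 (l 4)"
        using frame_eq[OF fr idx(8) st] frame_eq[OF fr idx(7) st] frame_eq[OF fr idx(7,8)] 4 L by auto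
      then have "card {p 4 0, p 4 (l 4), p s t} = 3" by simp
      moreover have "{p 4 0, p 4 (l 4), p s t} \<subseteq> V" using frame_in[OF fr] idx st by simp
      ultimately have "branchy V E"
        using d3 unfolding branchy_def by (intro disjI2 exI[of _ "{p 4 0, p 4 (l 4), p s t}"]) simp
      then show False using nb by simp
    qed
  qed
  then show ?thesis using dum by blast
qed

section \<open>Moving a branch along a path\<close>

lemma in_symcl: "(x, y) \<in> symcl R \<longleftrightarrow> (x, y) \<in> R \<or> (y, x) \<in> R"
  by (auto simp: symcl_def)

lemma sym_symcl: "sym (symcl R)"
  by (auto simp: sym_def in_symcl)

lemma embeds_symclI:
  assumes "inj_on \<phi> V" "\<And>x. x \<in> V \<Longrightarrow> \<phi> x \<in> V'" "sym E'"
    and "\<And>x y. (x, y) \<in> R \<Longrightarrow> x \<in> V \<Longrightarrow> y \<in> V \<Longrightarrow> (\<phi> x, \<phi> y) \<in> E'"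
  shows "embeds \<phi> V (symcl R) V' E'"
  using assms unfolding embeds_def in_symcl by (blast dest: symD)

text \<open>
  Two paths with the vertices \<open>(0, 0), \<dots>, (0, N)\<close> and \<open>(1, 0), \<dots>, (1, M)\<close>, joined by a path of
  length \<open>k\<close> from \<open>(0, i)\<close> to \<open>(1, j)\<close>. With inner attachment points this is the general tree with two
  vertices of degree 3; with \<open>M = 0\<close> it is the general tree with three leaves.
\<close>

definition mid :: "nat \<Rightarrow> nat \<Rightarrow> nat \<Rightarrow> nat \<Rightarrow> nat \<times> nat" where
  "mid i j k t = (if t = 0 then (0, i) else if t = k then (1, j) else (2, t))"

definition bridged :: "nat \<Rightarrow> nat \<Rightarrow> nat \<Rightarrow> (nat \<times> nat) set" where
  "bridged N M k = {0} \<times> {..N} \<union> {1} \<times> {..M} \<union> {2} \<times> {1..<k}"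

definition bridged_edges :: "nat \<Rightarrow> nat \<Rightarrow> nat \<Rightarrow> ((nat \<times> nat) \<times> (nat \<times> nat)) set" where
  "bridged_edges i j k =
    {((0, x), (0, Suc x)) | x. True} \<union> {((1, x), (1, Suc x)) | x. True} \<union>
    {(mid i j k t, mid i j k (Suc t)) | t. t < k}"

abbreviation bridged_homs where
  "bridged_homs S A N i M j k \<equiv> card (homs S A (bridged N M k) (symcl (bridged_edges i j k)))"

lemma finite_bridged: "finite (bridged N M k)"
  by (simp add: bridged_def)

lemma bridged_edgeE:
  assumes "(x, y) \<in> bridged_edges i j k"
  obtains (left) z where "x = (0, z)" "y = (0, Suc z)"
  | (right) z where "x = (1, z)" "y = (1, Suc z)"
  | (bridge) t where "t < k" "x = mid i j k t" "y = mid i j k (Suc t)"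
  using assms unfolding bridged_edges_def by blast

lemma bridged_edges_intros:
  "((0, z), (0, Suc z)) \<in> bridged_edges i j k"
  "((1, z), (1, Suc z)) \<in> bridged_edges i j k"
  "t < k \<Longrightarrow> (mid i j k t, mid i j k (Suc t)) \<in> bridged_edges i j k"
  unfolding bridged_edges_def by blast+

text \<open>
  Folding the first path at \<open>i + d\<close> moves the rest of the graph from \<open>(0, i)\<close> to \<open>(0, i + 2 * d)\<close>. The
  shorter side is the one that is moved, so its image still lies on the path.
\<close>

lemma bridged_fold:
  assumes S: "finite S" and d: "1 \<le> d" and N: "2 * (i + d) \<le> N" and k: "1 \<le> k"
  shows "bridged_homs S A N i M j k \<le> bridged_homs S A N (i + 2 * d) M j k"
proof (rule card_homs_fold[where r = "(0, i + d)" and B = "{1} \<times> {..M} \<union> {2} \<times> {1..<k}"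
      and L = "{0} \<times> {..<i + d} \<union> ({1} \<times> {..M} \<union> {2} \<times> {1..<k})"
      and \<sigma> = "\<lambda>(s, x). if s = 0 then (0, 2 * (i + d) - x) else (s, x)"])
  let ?B = "{1} \<times> {..M} \<union> {2} \<times> {1..<k} :: (nat \<times> nat) set"
  let ?L = "{0} \<times> {..<i + d} \<union> ?B"
  let ?\<sigma> = "\<lambda>(s, x). if s = 0 then (0, 2 * (i + d) - x) else (s, x) :: nat \<times> nat"
  let ?V = "bridged N M k"
  have mid_B: "mid i' j k (Suc t) \<in> ?B" if "mid i' j k (Suc t) \<in> ?V" for i' t
    using that by (auto simp: mid_def bridged_def split: if_splits)
  have \<sigma>_mid: "?\<sigma> (mid i j k t) = mid (i + 2 * d) j k t" for t by (auto simp: mid_def)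
  have mid_r: "mid i j k t \<noteq> (0, i + d)" for t using d by (auto simp: mid_def)
  have edge_L: "x \<in> ?L \<or> x = (0, i + d)" if "(x, y) \<in> bridged_edges i j k" "y \<in> ?L" "x \<in> ?V" for x y
    using that(1)
  proof (cases rule: bridged_edgeE)
    case (bridge t)
    then show ?thesis using that d by (auto simp: mid_def bridged_def split: if_splits)
  qed (use that in auto)
  have edge_R: "y \<in> ?L \<or> y = (0, i + d)" if "(x, y) \<in> bridged_edges i j k" "x \<in> ?L" "y \<in> ?V" for x y
    using that(1)
  proof (cases rule: bridged_edgeE)
    case (bridge t)
    then show ?thesis using mid_B[of i t] that by auto
  qed (use that in \<open>auto simp: bridged_def\<close>)
  show "finite S" "finite ?V" by (rule S) (rule finite_bridged)
  show "sym (symcl (bridged_edges i j k))" "sym (symcl (bridged_edges (i + 2 * d) j k))"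
    by (rule sym_symcl)+
  show "?L \<subseteq> ?V" using N by (auto simp: bridged_def)
  show "(0, i + d) \<notin> ?L" by auto
  show "?B \<subseteq> ?L" by auto
  show "y \<in> ?L \<or> y = (0, i + d)" if "x \<in> ?L" "y \<in> ?V" "(x, y) \<in> symcl (bridged_edges i j k)" for x y
    using that edge_L edge_R unfolding in_symcl by blast
  show "inj_on ?\<sigma> ?L" by (auto simp: inj_on_def)
  show "?\<sigma> ` ?L \<subseteq> ?V - {(0, i + d)}" using N by (auto simp: bridged_def)
  show "?\<sigma> x = x" if "x \<in> ?B" for x using that by auto
  have hom: "(?\<sigma> x, ?\<sigma> y) \<in> symcl (bridged_edges (i + 2 * d) j k)"
    if "(x, y) \<in> bridged_edges i j k" "x \<in> ?L" "y \<in> ?L" for x y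
    using that(1)
  proof (cases rule: bridged_edgeE)
    case (left z)
    then have "Suc z < i + d" using that by auto
    then have "2 * (i + d) - z = Suc (2 * (i + d) - Suc z)" by simp
    then show ?thesis using left bridged_edges_intros(1)[of "2 * (i + d) - Suc z"] by (simp add: in_symcl)
  next
    case (right z)
    then show ?thesis using bridged_edges_intros(2)[of z] by (simp add: in_symcl)
  next
    case (bridge t)
    then show ?thesis using bridged_edges_intros(3)[of t] \<sigma>_mid by (simp only: in_symcl) blast
  qed
  show "(?\<sigma> x, ?\<sigma> y) \<in> symcl (bridged_edges (i + 2 * d) j k)"
    if "x \<in> ?L" "y \<in> ?L" "(x, y) \<in> symcl (bridged_edges i j k)" for x y
    using that hom[of x y] hom[of y x] unfolding in_symcl by blast
  show "(?\<sigma> x, (0, i + d)) \<in> symcl (bridged_edges (i + 2 * d) j k)"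
    if x: "x \<in> ?L" and "(x, (0, i + d)) \<in> symcl (bridged_edges i j k)" for x
  proof -
    have "x = (0, i + d - 1)"
      using that(2) unfolding in_symcl
    proof
      assume "(x, (0, i + d)) \<in> bridged_edges i j k"
      then show ?thesis
      proof (cases rule: bridged_edgeE)
        case (bridge t)
        then show ?thesis using mid_r by metis
      qed auto
    next
      assume "((0, i + d), x) \<in> bridged_edges i j k"
      then show ?thesis
      proof (cases rule: bridged_edgeE)
        case (bridge t)
        then show ?thesis using mid_r by metis
      qed (use x in auto)
    qed
    moreover have "2 * (i + d) - (i + d - 1) = Suc (i + d)" using d by simp
    ultimately show ?thesis using bridged_edges_intros(1)[of "i + d"] by (simp add: in_symcl)
  qed
  have rest: "(x, y) \<in> bridged_edges (i + 2 * d) j k"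
    if "(x, y) \<in> bridged_edges i j k" "x \<in> ?V - ?B" "y \<in> ?V - ?B" for x y
    using that(1)
  proof (cases rule: bridged_edgeE)
    case (bridge t)
    then show ?thesis using mid_B[of i t] that by blast
  qed (simp_all only: bridged_edges_intros)
  show "(x, y) \<in> symcl (bridged_edges (i + 2 * d) j k)"
    if "x \<in> ?V - ?B" "y \<in> ?V - ?B" "(x, y) \<in> symcl (bridged_edges i j k)" for x y
    using that rest unfolding in_symcl by blast
qed

text \<open>
  The same trees, arranged along a spine: arms of length \<open>a\<close> and \<open>c\<close> hang at the spine vertices
  \<open>(0, i)\<close> and \<open>(0, j)\<close>, and the spine is cut down to the positions \<open>{u..<v}\<close>.
\<close>

definition spine :: "nat \<Rightarrow> nat \<Rightarrow> nat \<Rightarrow> nat \<Rightarrow> (nat \<times> nat) set" where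
  "spine u v a c = {0} \<times> {u..<v} \<union> {1} \<times> {1..a} \<union> {2} \<times> {1..c}"

definition spine_edges :: "nat \<Rightarrow> nat \<Rightarrow> ((nat \<times> nat) \<times> (nat \<times> nat)) set" where
  "spine_edges i j =
    {((0, x), (0, Suc x)) | x. True} \<union> {((s, t), (s, Suc t)) | s t. (s = 1 \<or> s = 2) \<and> 1 \<le> t} \<union>
    {((0, i), (1, 1)), ((0, j), (2, 1))}"

abbreviation spine_homs where
  "spine_homs S A u v i a j c \<equiv> card (homs S A (spine u v a c) (symcl (spine_edges i j)))"

lemma finite_spine: "finite (spine u v a c)"
  by (simp add: spine_def)

lemma spine_edgeE:
  assumes "(x, y) \<in> spine_edges i j"
  obtains (spine) z where "x = (0, z)" "y = (0, Suc z)"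
  | (arm) s t where "s = 1 \<or> s = 2" "1 \<le> t" "x = (s, t)" "y = (s, Suc t)"
  | (first) "x = (0, i)" "y = (1, 1)"
  | (second) "x = (0, j)" "y = (2, 1)"
  using assms unfolding spine_edges_def by blast

lemma spine_edges_intros:
  "((0, z), (0, Suc z)) \<in> spine_edges i j"
  "s = 1 \<or> s = 2 \<Longrightarrow> 1 \<le> t \<Longrightarrow> ((s, t), (s, Suc t)) \<in> spine_edges i j"
  "((0, i), (1, 1)) \<in> spine_edges i j"
  "((0, j), (2, 1)) \<in> spine_edges i j"
  unfolding spine_edges_def by blast+

lemma spine_path:
  assumes "finite S"
  shows "spine_homs S A u v i 0 j 0 = path_homs S A (v - u)"
proof -
  have V: "spine u v 0 0 = {0} \<times> {u..<v}" by (simp add: spine_def)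
  have arcs: "((0, x), (0, y)) \<in> symcl (spine_edges i j) \<longleftrightarrow> (x, y) \<in> path_arcs" for x y
    by (auto simp: in_symcl spine_edges_def path_arcs_def)
  have "spine_homs S A u v i 0 j 0 = card (homs S A {u..<v} path_arcs)"
  proof (rule antisym)
    have "embeds snd (spine u v 0 0) (symcl (spine_edges i j)) {u..<v} path_arcs"
      using arcs by (auto simp: embeds_def V inj_on_def)
    then show "spine_homs S A u v i 0 j 0 \<le> card (homs S A {u..<v} path_arcs)"
      by (rule card_homs_embed) (use assms in auto)
    have "embeds (Pair 0) {u..<v} path_arcs (spine u v 0 0) (symcl (spine_edges i j))"
      using arcs by (auto simp: embeds_def V inj_on_def)
    then show "card (homs S A {u..<v} path_arcs) \<le> spine_homs S A u v i 0 j 0"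
      by (rule card_homs_embed) (use assms finite_spine in auto)
  qed
  then show ?thesis using path_homs_interval[OF assms] by simp
qed

lemma spine_le_bridged:
  assumes S: "finite S" and a: "a \<le> N" and c: "c \<le> M" and k: "1 \<le> k"
  shows "spine_homs S A 0 (N - a + k + (M - c) + 1) (N - a) a (N - a + k) c
    \<le> bridged_homs S A N a M c k"
proof (rule card_homs_embed)
  define n where "n = N - a"
  have N: "N = n + a" using a by (simp add: n_def)
  let ?V = "spine 0 (n + k + (M - c) + 1) a c"
  let ?\<phi> = "\<lambda>(s, x). if s = 0 then (if x \<le> n then (0, N - x) else if x < n + k then (2, x - n)
      else (1, x - (n + k) + c)) else if s = 1 then (0, a - x) else (1, c - x) :: nat \<times> nat"
  let ?E = "symcl (bridged_edges a c k)"
  have "embeds ?\<phi> ?V (symcl (spine_edges n (n + k))) (bridged N M k) ?E"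
  proof (rule embeds_symclI)
    show "inj_on ?\<phi> ?V"
    proof (rule inj_on_inverseI)
      fix x assume "x \<in> ?V"
      then show "(\<lambda>(s, y). if s = 0 then (if a \<le> y then (0, N - y) else (1, a - y))
          else if s = 2 then (0, n + y) else if c \<le> y then (0, n + k + (y - c)) else (2, c - y)) (?\<phi> x) = x"
        using N c k by (cases x) (auto simp: spine_def)
    qed
    show "?\<phi> x \<in> bridged N M k" if "x \<in> ?V" for x
      using that N c k by (cases x) (auto simp: spine_def bridged_def)
    show "sym ?E" by (rule sym_symcl)
    fix x y assume e: "(x, y) \<in> spine_edges n (n + k)" and V: "x \<in> ?V" "y \<in> ?V"
    from e show "(?\<phi> x, ?\<phi> y) \<in> ?E"
    proof (cases rule: spine_edgeE)
      case (spine z)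
      consider "z < n" | t where "z = n + t" "t < k" | "n + k \<le> z"
        by (metis add_less_cancel_left le_Suc_ex linorder_not_le)
      then show ?thesis
      proof cases
        case 1
        then have "N - z = Suc (N - Suc z)" using N by simp
        then show ?thesis using 1 spine bridged_edges_intros(1)[of "N - Suc z"] by (simp add: in_symcl)
      next
        case 2
        have "?\<phi> (0, n + u) = mid a c k u" if "u \<le> k" for u
          using that N k by (auto simp: mid_def)
        from this[of t] this[of "Suc t"] show ?thesis
          using 2 spine bridged_edges_intros(3)[of t k a c] by (simp add: in_symcl)
      next
        case 3
        then have "Suc z - (n + k) + c = Suc (z - (n + k) + c)" by simp
        then show ?thesis using 3 k spine bridged_edges_intros(2)[of "z - (n + k) + c"] by (simp add: in_symcl)
      qed
    next
      case (arm s t)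
      then have "a - t = Suc (a - Suc t)" if "s = 1" using V that by (auto simp: spine_def)
      moreover have "c - t = Suc (c - Suc t)" if "s = 2" using arm V that by (auto simp: spine_def)
      ultimately show ?thesis
        using arm bridged_edges_intros(1)[of "a - Suc t"] bridged_edges_intros(2)[of "c - Suc t"]
        by (auto simp: in_symcl)
    next
      case first
      then have "a = Suc (a - 1)" using V by (auto simp: spine_def)
      then show ?thesis using first N bridged_edges_intros(1)[of "a - 1" a c k] by (simp add: in_symcl)
    next
      case second
      then have "c = Suc (c - 1)" using V by (auto simp: spine_def)
      then show ?thesis using second k bridged_edges_intros(2)[of "c - 1" a c k] by (simp add: in_symcl)
    qed
  qed
  then show "embeds ?\<phi> (spine 0 (N - a + k + (M - c) + 1) a c)
      (symcl (spine_edges (N - a) (N - a + k))) (bridged N M k) ?E"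
    by (simp only: n_def)
qed (use S finite_bridged in auto)

lemma path_le_bridged:
  assumes "finite S" "1 \<le> k"
  shows "path_homs S A (N + k + 1) \<le> bridged_homs S A N 0 0 0 k"
  using spine_le_bridged[OF assms(1), of 0 N 0 0 k A] assms spine_path[OF assms(1), of A 0 "N + k + 1"]
  by simp

text \<open>
  With an even arm, the tree with three leaves is a fold of the path in which the rest of the graph
  hangs at the far end of that arm.
\<close>

lemma even_arm_bridged:
  assumes S: "finite S" and i: "even i" "i \<le> N" and k: "1 \<le> k"
  shows "path_homs S A (N + k + 1) \<le> bridged_homs S A N i 0 0 k"
proof (cases "i = 0")
  case True
  then show ?thesis using path_le_bridged[OF S k] by simp
next
  case False
  obtain d where d: "i = 2 * d" using i by blast
  then have "bridged_homs S A N 0 0 0 k \<le> bridged_homs S A N (0 + 2 * d) 0 0 k"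
    using False i by (intro bridged_fold[OF S _ _ k]) auto
  then show ?thesis using path_le_bridged[OF S k, of A N] d by simp
qed

text \<open>
  The arms of a tripod may be assigned to the roles in the bridged form in any order. This is where
  the symmetry between the three arms enters.
\<close>

lemma tripod_bridged:
  assumes tri: "tripod V E p l" and V: "finite V" "sym E" and S: "finite S"
    and abc: "a < 3" "b < 3" "c < 3" "a \<noteq> b" "a \<noteq> c" "b \<noteq> c"
  shows "bridged_homs S A (l a + l b) (l a) 0 0 (l c) \<le> card (homs S A V E)"
proof (rule card_homs_embed)
  note fr = tri[unfolded tripod_def]
  let ?F = "\<lambda>(s, t). p s t"
  let ?\<iota> = "\<lambda>(s, x). if s = 0 then (if x < l a then (a, l a - x) else if x = l a then (2, 0)
      else (b, x - l a)) else if s = 1 then (c, l c) else (c, x) :: nat \<times> nat"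
  let ?B = "bridged (l a + l b) 0 (l c)"
  have root: "p s 0 = p 2 0" if "s < 3" for s using frame_arm(2)[OF fr that] by (simp only: case_prod_conv)
  have len: "1 \<le> l s" if "s < 3" for s by (rule frame_arm(1)[OF fr that])
  have \<iota>: "?\<iota> x \<in> frame_idx 3 l" if "x \<in> ?B" for x
    using that abc len[OF abc(3)] by (cases x) (auto simp: bridged_def in_frame_idx)
  have inj: "inj_on ?F (frame_idx 3 l)" and ran: "?F ` frame_idx 3 l \<subseteq> V"
    using fr unfolding frame_def by blast+
  show "embeds (?F \<circ> ?\<iota>) ?B (symcl (bridged_edges (l a) 0 (l c))) V E"
  proof (rule embeds_symclI)
    have "inj_on ?\<iota> ?B"
    proof (rule inj_on_inverseI)
      fix x assume "x \<in> ?B"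
      then show "(\<lambda>(q, w). if w = 0 then (0, l a) else if q = a then (0, l a - w)
          else if q = b then (0, l a + w) else if w = l c then (1, 0) else (2, w)) (?\<iota> x) = x"
        using abc len[OF abc(3)] by (cases x) (auto simp: bridged_def)
    qed
    moreover have "inj_on ?F (?\<iota> ` ?B)" by (rule inj_on_subset[OF inj]) (use \<iota> in blast)
    ultimately show "inj_on (?F \<circ> ?\<iota>) ?B" by (rule comp_inj_on)
    show "(?F \<circ> ?\<iota>) x \<in> V" if "x \<in> ?B" for x using \<iota>[OF that] ran by auto
    show "sym E" by (rule V(2))
    have left: "(?F \<circ> ?\<iota>) (0, x) = (if x \<le> l a then p a (l a - x) else p b (x - l a))" for x
      using root[OF abc(1)] by auto
    have bridge: "(?F \<circ> ?\<iota>) (mid (l a) 0 (l c) t) = p c t" for t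
      using root[OF abc(3)] len[OF abc(3)] by (auto simp: mid_def)
    fix x y assume e: "(x, y) \<in> bridged_edges (l a) 0 (l c)" and B: "x \<in> ?B" "y \<in> ?B"
    from e show "((?F \<circ> ?\<iota>) x, (?F \<circ> ?\<iota>) y) \<in> E"
    proof (cases rule: bridged_edgeE)
      case (left z)
      show ?thesis
      proof (cases "z < l a")
        case True
        then have "(p a (l a - Suc z), p a (l a - z)) \<in> E"
          using frame_arm(5)[OF fr abc(1), of "l a - Suc z"] by (simp add: Suc_diff_Suc)
        then have "(p a (l a - z), p a (l a - Suc z)) \<in> E" by (rule symD[OF V(2)])
        then show ?thesis unfolding left \<open>\<And>x. (?F \<circ> ?\<iota>) (0, x) = _ x\<close> using True by simp
      next
        case False
        then have "(p b (z - l a), p b (Suc (z - l a))) \<in> E"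
          using frame_arm(5)[OF fr abc(2), of "z - l a"] left B by (auto simp: bridged_def)
        moreover have "Suc z - l a = Suc (z - l a)" using False by simp
        moreover have "p a (l a - z) = p b (z - l a)" if "z = l a"
          using root[OF abc(1)] root[OF abc(2)] that by simp
        ultimately show ?thesis unfolding left \<open>\<And>x. (?F \<circ> ?\<iota>) (0, x) = _ x\<close> using False by auto
      qed
    next
      case (right z)
      then show ?thesis using B by (auto simp: bridged_def)
    next
      case (bridge t)
      then show ?thesis
        unfolding bridge(2,3) \<open>\<And>t. (?F \<circ> ?\<iota>) (mid (l a) 0 (l c) t) = _ t\<close>
        using frame_arm(5)[OF fr abc(3)] by blast
    qed
  qed
qed (use V S in auto)

lemma dumbbell_bridged:
  assumes dum: "dumbbell V E p l" and V: "finite V" "sym E" and S: "finite S"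
    and ab: "a < 2" "b < 2" "a \<noteq> b" and cd: "c = 2 \<or> c = 3" "d = 2 \<or> d = 3" "c \<noteq> d"
  shows "bridged_homs S A (l a + l b) (l a) (l c + l d) (l c) (l 4) \<le> card (homs S A V E)"
proof (rule card_homs_embed)
  note fr = dum[unfolded dumbbell_def]
  let ?F = "\<lambda>(s, t). p s t"
  let ?\<iota> = "\<lambda>(s, x). if s = 0 then (if x < l a then (a, l a - x) else if x = l a then (4, 0)
      else (b, x - l a)) else if s = 1 then (if x < l c then (c, l c - x) else if x = l c then (4, l 4)
      else (d, x - l c)) else (4, x) :: nat \<times> nat"
  let ?B = "bridged (l a + l b) (l c + l d) (l 4)"
  have s5: "a < 5" "b < 5" "c < 5" "d < 5" "(4::nat) < 5" using ab cd by auto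
  have ne: "a \<noteq> 4" "b \<noteq> 4" "c \<noteq> 4" "d \<noteq> 4" "a \<noteq> b" "c \<noteq> d"
    "c \<noteq> a" "c \<noteq> b" "d \<noteq> a" "d \<noteq> b"
    using ab cd by auto
  have root: "p a 0 = p 4 0" "p b 0 = p 4 0" "p c 0 = p 4 (l 4)" "p d 0 = p 4 (l 4)"
    using frame_arm(2)[OF fr s5(1)] frame_arm(2)[OF fr s5(2)] frame_arm(2)[OF fr s5(3)]
      frame_arm(2)[OF fr s5(4)] ab cd by auto
  have len: "1 \<le> l 4" by (rule frame_arm(1)[OF fr s5(5)])
  have cases_B: thesis
    if "x \<in> ?B" "\<And>y. x = (0, y) \<Longrightarrow> y \<le> l a + l b \<Longrightarrow> thesis"
      "\<And>y. x = (1, y) \<Longrightarrow> y \<le> l c + l d \<Longrightarrow> thesis"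
      "\<And>y. x = (2, y) \<Longrightarrow> 1 \<le> y \<Longrightarrow> y < l 4 \<Longrightarrow> thesis" for x thesis
    using that unfolding bridged_def by auto
  have idx: "(4, 0) \<in> frame_idx 5 l" "(4, l 4) \<in> frame_idx 5 l"
    "\<And>s t. s < 5 \<Longrightarrow> 1 \<le> t \<Longrightarrow> t \<le> l s \<Longrightarrow> (s, t) \<in> frame_idx 5 l"
    using len by (simp_all add: in_frame_idx)
  have \<iota>: "?\<iota> x \<in> frame_idx 5 l" if "x \<in> ?B" for x
  proof (rule cases_B[OF that])
    show ?thesis if "x = (0, y)" "y \<le> l a + l b" for y using that idx s5 by simp
    show ?thesis if "x = (1, y)" "y \<le> l c + l d" for y using that idx s5 by simp
    show ?thesis if "x = (2, y)" "1 \<le> y" "y < l 4" for y using that idx s5 by simp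
  qed
  have inj: "inj_on ?F (frame_idx 5 l)" and ran: "?F ` frame_idx 5 l \<subseteq> V"
    using fr unfolding frame_def by blast+
  show "embeds (?F \<circ> ?\<iota>) ?B (symcl (bridged_edges (l a) (l c) (l 4))) V E"
  proof (rule embeds_symclI)
    have "inj_on ?\<iota> ?B"
    proof (rule inj_on_inverseI)
      let ?\<kappa> = "\<lambda>(q, w). if q = 4 then (if w = 0 then (0, l a) else if w = l 4 then (1, l c) else (2, w))
          else if q = a then (0, l a - w) else if q = b then (0, l a + w)
          else if q = c then (1, l c - w) else (1, l c + w) :: nat \<times> nat"
      fix x assume "x \<in> ?B"
      then show "?\<kappa> (?\<iota> x) = x"
      proof (rule cases_B)
        show "?\<kappa> (?\<iota> x) = x" if "x = (0, y)" for y using that ne by simp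
        show "?\<kappa> (?\<iota> x) = x" if "x = (1, y)" for y using that ne ne[symmetric] len by simp
        show "?\<kappa> (?\<iota> x) = x" if "x = (2, y)" "1 \<le> y" "y < l 4" for y using that by simp
      qed
    qed
    moreover have "inj_on ?F (?\<iota> ` ?B)" by (rule inj_on_subset[OF inj]) (use \<iota> in blast)
    ultimately show "inj_on (?F \<circ> ?\<iota>) ?B" by (rule comp_inj_on)
    show "(?F \<circ> ?\<iota>) x \<in> V" if "x \<in> ?B" for x using \<iota>[OF that] ran by auto
    show "sym E" by (rule V(2))
    have bridge: "(?F \<circ> ?\<iota>) (mid (l a) (l c) (l 4) t) = p 4 t" for t
      using len by (auto simp: mid_def)
    have row: "(p' z, p' (Suc z)) \<in> E"
      if p': "\<And>x. p' x = (if x \<le> l q then p q (l q - x) else p r (x - l q))"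
        and qr: "q < 5" "r < 5" "p q 0 = p r 0" and z: "Suc z \<le> l q + l r" for p' q r z
    proof (cases "z < l q")
      case True
      then have "(p q (l q - Suc z), p q (l q - z)) \<in> E"
        using frame_arm(5)[OF fr qr(1), of "l q - Suc z"] by (simp add: Suc_diff_Suc)
      then have "(p q (l q - z), p q (l q - Suc z)) \<in> E" by (rule symD[OF V(2)])
      then show ?thesis unfolding p' using True by simp
    next
      case False
      then have "(p r (z - l q), p r (Suc (z - l q))) \<in> E"
        using frame_arm(5)[OF fr qr(2), of "z - l q"] z by auto
      moreover have "Suc z - l q = Suc (z - l q)" using False by simp
      moreover have "p q (l q - z) = p r (z - l q)" if "z = l q" using qr(3) that by simp
      ultimately show ?thesis unfolding p' using False by auto
    qed
    fix x y assume e: "(x, y) \<in> bridged_edges (l a) (l c) (l 4)" and B: "x \<in> ?B" "y \<in> ?B"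
    from e show "((?F \<circ> ?\<iota>) x, (?F \<circ> ?\<iota>) y) \<in> E"
    proof (cases rule: bridged_edgeE)
      case (left z)
      show ?thesis
        unfolding left
        by (rule row[of "\<lambda>x. (?F \<circ> ?\<iota>) (0, x)" a b z])
          (use root s5 left B in \<open>auto simp: bridged_def\<close>)
    next
      case (right z)
      show ?thesis
        unfolding right
        by (rule row[of "\<lambda>x. (?F \<circ> ?\<iota>) (1, x)" c d z])
          (use root s5 right B in \<open>auto simp: bridged_def\<close>)
    next
      case (bridge t)
      then show ?thesis
        unfolding bridge(2,3) \<open>\<And>t. (?F \<circ> ?\<iota>) (mid (l a) (l c) (l 4) t) = _ t\<close>
        using frame_arm(5)[OF fr s5(5)] by blast
    qed
  qed
qed (use V S in auto)

text \<open>
  The whole spine is counted exactly; the arms contribute at least what they contribute together with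
  a short piece of the spine.
\<close>

lemma spine_glue:
  assumes S: "finite S" and uv: "u \<le> v" "v \<le> L"
  shows "path_homs S A L + spine_homs S A u v i a j c
    \<le> spine_homs S A 0 L i a j c + path_homs S A (v - u)"
proof -
  have "spine 0 L 0 0 \<union> spine u v a c = spine 0 L a c" "spine 0 L 0 0 \<inter> spine u v a c = spine u v 0 0"
    using uv by (auto simp: spine_def)
  moreover have "spine_homs S A 0 L i 0 j 0 + spine_homs S A u v i a j c
      \<le> card (homs S A (spine 0 L 0 0 \<union> spine u v a c) (symcl (spine_edges i j))) +
        card (homs S A (spine 0 L 0 0 \<inter> spine u v a c) (symcl (spine_edges i j)))"
    by (rule card_homs_glue[OF S finite_spine finite_spine])
  ultimately show ?thesis by (simp add: spine_path[OF S])
qed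

lemma spine_shift:
  assumes "finite S"
  shows "spine_homs S A 0 n i a j c \<le> spine_homs S A u (u + n) (u + i) a (u + j) c"
proof (rule card_homs_embed)
  show "embeds (\<lambda>(s, x). if s = 0 then (0, u + x) else (s, x)) (spine 0 n a c) (symcl (spine_edges i j))
      (spine u (u + n) a c) (symcl (spine_edges (u + i) (u + j)))"
  proof (rule embeds_symclI)
    show "inj_on (\<lambda>(s, x). if s = 0 then (0, u + x) else (s, x)) (spine 0 n a c)"
      by (rule inj_on_inverseI[where g = "\<lambda>(s, x). if s = 0 then (0, x - u) else (s, x)"])
        (auto simp: spine_def)
    show "sym (symcl (spine_edges (u + i) (u + j)))" by (rule sym_symcl)
    show "(case x of (s, x) \<Rightarrow> if s = 0 then (0, u + x) else (s, x)) \<in> spine u (u + n) a c"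
      if "x \<in> spine 0 n a c" for x
      using that by (auto simp: spine_def)
    fix x y assume "(x, y) \<in> spine_edges i j"
    then show "(case x of (s, x) \<Rightarrow> if s = 0 then (0, u + x) else (s, x),
        case y of (s, x) \<Rightarrow> if s = 0 then (0, u + x) else (s, x)) \<in> symcl (spine_edges (u + i) (u + j))"
    proof (cases rule: spine_edgeE)
      case (spine z)
      then show ?thesis using spine_edges_intros(1)[of "u + z"] by (simp add: in_symcl)
    next
      case (arm s t)
      then have "s \<noteq> 0" by auto
      then show ?thesis using arm spine_edges_intros(2)[of s t] by (simp add: in_symcl)
    next
      case first
      then show ?thesis using spine_edges_intros(3) by (simp add: in_symcl)
    next
      case second
      then show ?thesis using spine_edges_intros(4) by (simp add: in_symcl)
    qed
  qed
qed (use assms finite_spine in auto)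

lemma sum_spine:
  fixes g :: "nat \<times> nat \<Rightarrow> 'c :: comm_monoid_add"
  shows "(\<Sum>x\<in>spine 0 n a c. g x) = (\<Sum>x<n. g (0, x)) + (\<Sum>t=1..a. g (1, t)) + (\<Sum>t=1..c. g (2, t))"
proof -
  have img: "{s} \<times> X = Pair s ` X" for s :: nat and X :: "nat set" by auto
  have "(\<Sum>x\<in>{s} \<times> X. g x) = (\<Sum>t\<in>X. g (s, t))" for s X
    unfolding img by (subst sum.reindex) (auto simp: inj_on_def)
  moreover have "(\<Sum>x\<in>spine 0 n a c. g x) =
      (\<Sum>x\<in>{0} \<times> {0..<n}. g x) + (\<Sum>x\<in>{1} \<times> {1..a}. g x) + (\<Sum>x\<in>{2} \<times> {1..c}. g x)"
    unfolding spine_def by (subst sum.union_disjoint; auto)+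
  ultimately show ?thesis by (simp add: atLeast0LessThan)
qed

definition spine_nbrs where
  "spine_nbrs u v a c i j x = {y \<in> spine u v a c. (x, y) \<in> symcl (spine_edges i j)}"

section \<open>Two trees of entropy rate at least ln 2\<close>

lemma spine_adjacent:
  "((0, x), y) \<in> symcl (spine_edges i j) \<longleftrightarrow>
    y = (0, Suc x) \<or> 1 \<le> x \<and> y = (0, x - 1) \<or> x = i \<and> y = (1, 1) \<or> x = j \<and> y = (2, 1)"
  "1 \<le> t \<Longrightarrow> ((1, t), y) \<in> symcl (spine_edges i j) \<longleftrightarrow>
    y = (1, Suc t) \<or> y = (if t = 1 then (0, i) else (1, t - 1))"
  "1 \<le> t \<Longrightarrow> ((2, t), y) \<in> symcl (spine_edges i j) \<longleftrightarrow>
    y = (2, Suc t) \<or> y = (if t = 1 then (0, j) else (2, t - 1))"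
  unfolding in_symcl spine_edges_def by (cases y; cases x; cases t; auto)+

lemma in_spine: "(s, t) \<in> spine u v a c \<longleftrightarrow>
    s = 0 \<and> u \<le> t \<and> t < v \<or> s = 1 \<and> 1 \<le> t \<and> t \<le> a \<or> s = 2 \<and> 1 \<le> t \<and> t \<le> c"
  by (auto simp: spine_def)

lemma spine_nbrs_spine:
  assumes "x < n" "i < n" "j < n"
  shows "spine_nbrs 0 n a c i j (0, x) =
    (if x = 0 then {} else {(0, x - 1)}) \<union> (if Suc x < n then {(0, Suc x)} else {}) \<union>
    (if x = i \<and> 1 \<le> a then {(1, 1)} else {}) \<union> (if x = j \<and> 1 \<le> c then {(2, 1)} else {})"
proof (rule set_eqI)
  fix y
  have "y \<in> spine_nbrs 0 n a c i j (0, x) \<longleftrightarrow> y \<in> spine 0 n a c \<and>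
      (y = (0, Suc x) \<or> 1 \<le> x \<and> y = (0, x - 1) \<or> x = i \<and> y = (1, 1) \<or> x = j \<and> y = (2, 1))"
    unfolding spine_nbrs_def mem_Collect_eq spine_adjacent(1) ..
  also have "\<dots> \<longleftrightarrow> Suc x < n \<and> y = (0, Suc x) \<or> 1 \<le> x \<and> y = (0, x - 1) \<or>
      1 \<le> a \<and> x = i \<and> y = (1, 1) \<or> 1 \<le> c \<and> x = j \<and> y = (2, 1)"
    using assms(1) in_spine[of 0 "Suc x" 0 n a c] in_spine[of 0 "x - 1" 0 n a c]
      in_spine[of 1 1 0 n a c] in_spine[of 2 1 0 n a c] by auto
  finally show "y \<in> spine_nbrs 0 n a c i j (0, x) \<longleftrightarrow>
    y \<in> (if x = 0 then {} else {(0, x - 1)}) \<union> (if Suc x < n then {(0, Suc x)} else {}) \<union>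
      (if x = i \<and> 1 \<le> a then {(1, 1)} else {}) \<union> (if x = j \<and> 1 \<le> c then {(2, 1)} else {})"
    by auto
qed

lemma spine_nbrs_arms:
  assumes "i < n" "j < n"
  shows "1 \<le> t \<Longrightarrow> t \<le> a \<Longrightarrow> spine_nbrs 0 n a c i j (1, t) =
      {if t = 1 then (0, i) else (1, t - 1)} \<union> (if t < a then {(1, Suc t)} else {})"
    and "1 \<le> t \<Longrightarrow> t \<le> c \<Longrightarrow> spine_nbrs 0 n a c i j (2, t) =
      {if t = 1 then (0, j) else (2, t - 1)} \<union> (if t < c then {(2, Suc t)} else {})"
proof -
  show "spine_nbrs 0 n a c i j (1, t) =
      {if t = 1 then (0, i) else (1, t - 1)} \<union> (if t < a then {(1, Suc t)} else {})"
    if "1 \<le> t" "t \<le> a"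
    using assms that unfolding spine_nbrs_def spine_adjacent(2)[OF that(1)] by (auto simp: spine_def)
  show "spine_nbrs 0 n a c i j (2, t) =
      {if t = 1 then (0, j) else (2, t - 1)} \<union> (if t < c then {(2, Suc t)} else {})"
    if "1 \<le> t" "t \<le> c"
    using assms that unfolding spine_nbrs_def spine_adjacent(3)[OF that(1)] by (auto simp: spine_def)
qed

text \<open>
  The balanced weights on a tree with two branch vertices: weight 2 on the path between them and
  weight 1 on the arms. Then the branch vertices make up for the leaves and the entropy rate is
  exactly \<open>ln 2\<close>.
\<close>

lemma ln2_ge_two_thirds: "2 / 3 \<le> ln (2::real)"
proof -
  \<comment> \<open>The quadratic upper bound for \<open>exp\<close> is sharp enough at \<open>1 / 12\<close>.\<close>
  have "exp (2 / 3 :: real) = exp (1 / 12) ^ 8" by (simp flip: exp_of_nat_mult)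
  also have "\<dots> \<le> (1 + 1 / 12 + (1 / 12)\<^sup>2) ^ 8" by (intro power_mono exp_bound) auto
  also have "\<dots> \<le> 2" by (simp add: power2_eq_square power_divide)
  finally show ?thesis using ln_ge_iff[of 2 "2 / 3 :: real"] by linarith
qed

lemma two_forks_homs:
  assumes T0: "grown A S" and k: "1 \<le> k" and a: "a = 1 \<or> a = 2" and c: "c = 1 \<or> c = 2"
  shows "(k + a + c + 1) * 2 ^ (card S - 1) \<le> spine_homs S A 0 (k + 3) 1 a (k + 1) c"
proof -
  let ?V = "spine 0 (k + 3) a c" and ?E = "symcl (spine_edges 1 (k + 1))"
  let ?N = "spine_nbrs 0 (k + 3) a c 1 (k + 1)"
  define inner where "inner x \<longleftrightarrow> fst x = 0 \<and> 1 \<le> snd x \<and> snd x \<le> k + 1" for x :: "nat \<times> nat"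
  define w where "w x y = (if inner x \<and> inner y then 2 else 1 :: real)" for x y
  define W where "W x = (if inner x then 4 else if x = (1, a) \<or> x = (2, c) \<or> fst x = 0 then 1 else 2 :: real)" for x
  define u where "u x = (if inner x then (if snd x = 1 \<or> snd x = k + 1 then 2 else 4) else 0) * ln (2::real)" for x
  \<comment> \<open>\<open>u x\<close> is the sum of \<open>w ln w\<close> over the edges at \<open>x\<close>, in closed form.\<close>
  define T where "T = 4 * real k + 2 * real a + 2 * real c + 4"
  have fin: "finite ?V" "?V \<noteq> {}" by (auto simp: spine_def)
  \<comment> \<open>The ends of the spine, the branch vertices, the vertices between them, and the arms.\<close>
  have elem: "P x" if "x \<in> ?V" "P (0, 0)" "P (0, k + 2)" "P (0, 1)" "P (0, k + 1)"
      "\<And>x. 1 < x \<Longrightarrow> x < k + 1 \<Longrightarrow> P (0, x)" "P (1, 1)" "a = 2 \<Longrightarrow> P (1, 2)" "P (2, 1)" "c = 2 \<Longrightarrow> P (2, 2)"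
    for P and x :: "nat \<times> nat"
  proof -
    obtain s t where x: "x = (s, t)" by (cases x)
    have "s = 0 \<and> t < k + 3 \<or> s = 1 \<and> 1 \<le> t \<and> t \<le> a \<or> s = 2 \<and> 1 \<le> t \<and> t \<le> c"
      using that(1) x by (auto simp: spine_def)
    then consider (0) "s = 0" "t < k + 3" | (1) "s = 1" "1 \<le> t" "t \<le> a" | (2) "s = 2" "1 \<le> t" "t \<le> c"
      by blast
    then show ?thesis
    proof cases
      case 0
      then have "t = 0 \<or> t = k + 2 \<or> t = 1 \<or> t = k + 1 \<or> 1 < t \<and> t < k + 1" by arith
      then show ?thesis using that(2-6) unfolding x 0(1) by blast
    next
      case 1
      then have "t = 1 \<or> t = 2 \<and> a = 2" using a by arith
      then show ?thesis using that(7,8) unfolding x 1(1) by blast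
    next
      case 2
      then have "t = 1 \<or> t = 2 \<and> c = 2" using c by arith
      then show ?thesis using that(9,10) unfolding x 2(1) by blast
    qed
  qed
  have ends: "(\<Sum>x<k + 3. g x) = g 0 + (\<Sum>x=1..k + 1. g x) + g (k + 2)" for g :: "nat \<Rightarrow> real"
  proof -
    have "{..<k + 3} = insert 0 (insert (k + 2) {1..k + 1})" by auto
    then show ?thesis by simp
  qed
  have short: "(\<Sum>t=1..b. g t) = (if b = 1 then g 1 else g 1 + g 2)" if "b = 1 \<or> b = 2"
    for g :: "nat \<Rightarrow> real" and b :: nat
    using that by (auto simp: numeral_2_eq_2)
  have spine_const: "(\<Sum>x=1..k + 1. g x) = (real k + 1) * z" if "\<And>x. 1 \<le> x \<Longrightarrow> x \<le> k + 1 \<Longrightarrow> g x = z"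
    for g and z :: real
  proof -
    have "(\<Sum>x=1..k + 1. g x) = (\<Sum>x=1..k + 1. z)" using that by (intro sum.cong) auto
    then show ?thesis by simp
  qed
  have ln4: "ln (4::real) = 2 * ln 2" using ln_realpow[of 2 2] by simp
  have T: "T = (\<Sum>x\<in>?V. W x)"
    unfolding sum_spine ends short[OF a] short[OF c]
    by (subst spine_const[where z = 4]) (use a c in \<open>auto simp: W_def inner_def T_def\<close>)
  have X: "(\<Sum>x\<in>?V. W x * ln (W x)) = (8 * real k + 2 * real a + 2 * real c + 4) * ln 2"
    unfolding sum_spine ends short[OF a] short[OF c]
    by (subst spine_const[where z = "8 * ln 2"]) (use a c ln4 in \<open>auto simp: W_def inner_def algebra_simps\<close>)
  have U: "(\<Sum>x\<in>?V. u x) = 4 * real k * ln 2"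
  proof -
    have "{1..k + 1} = insert 1 (insert (k + 1) {2..k})" using k by auto
    then have "(\<Sum>x=1..k + 1. u (0, x)) = u (0, 1) + (u (0, k + 1) + (\<Sum>x=2..k. u (0, x)))"
      using k by simp
    also have "(\<Sum>x=2..k. u (0, x)) = (\<Sum>x=2..k. 4 * ln 2)"
      by (intro sum.cong) (auto simp: u_def inner_def)
    finally have "(\<Sum>x=1..k + 1. u (0, x)) = 4 * real k * ln 2"
      using k by (simp add: u_def inner_def of_nat_diff algebra_simps)
    then show ?thesis
      unfolding sum_spine ends short[OF a] short[OF c] using a c by (auto simp: u_def inner_def)
  qed
  have sums: "W x = (\<Sum>y\<in>?N x. w x y) \<and> u x = (\<Sum>y\<in>?N x. w x y * ln (w x y))" if "x \<in> ?V" for x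
  proof (rule elem[OF that])
    show "W (0, x) = (\<Sum>y\<in>?N (0, x). w (0, x) y) \<and> u (0, x) = (\<Sum>y\<in>?N (0, x). w (0, x) y * ln (w (0, x) y))"
      if "1 < x" "x < k + 1" for x
      using that by (cases x) (auto simp: spine_nbrs_spine W_def w_def u_def inner_def)
  qed (use a c k in \<open>auto simp: spine_nbrs_spine spine_nbrs_arms[unfolded One_nat_def] W_def w_def u_def inner_def\<close>)
  have rate: "(\<Sum>x\<in>?V. W x * ln (W x) - (\<Sum>y\<in>?N x. w x y * ln (w x y))) = T * ln 2"
  proof -
    have "(\<Sum>x\<in>?V. W x * ln (W x) - (\<Sum>y\<in>?N x. w x y * ln (w x y))) = (\<Sum>x\<in>?V. W x * ln (W x) - u x)"
      using sums by (intro sum.cong) auto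
    then show ?thesis unfolding sum_subtractf X U by (simp add: T_def algebra_simps)
  qed
  have Tpos: "0 < T" by (simp add: T_def)
  have "T * exp (- ((\<Sum>x\<in>?V. W x * ln (W x)) / T)) * 2 ^ (card S - 1) \<le> spine_homs S A 0 (k + 3) 1 a (k + 1) c"
  proof (rule homs_doubling_bound[OF T0 fin sym_symcl _ _ _ T, where w = w])
    show "0 < w x y \<and> w y x = w x y" for x y by (simp add: w_def)
    show "W x = (\<Sum>y\<in>{y \<in> ?V. (x, y) \<in> ?E}. w x y)" if "x \<in> ?V" for x
      using sums[OF that] by (simp add: spine_nbrs_def)
    show "0 < W x" for x by (simp add: W_def)
    show "(\<Sum>x\<in>?V. W x * ln (W x) - (\<Sum>y\<in>{y \<in> ?V. (x, y) \<in> ?E}. w x y * ln (w x y))) = T * ln 2"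
      using rate by (simp only: spine_nbrs_def)
  qed
  moreover have "real (k + a + c + 1) \<le> T * exp (- ((\<Sum>x\<in>?V. W x * ln (W x)) / T))"
  proof -
    \<comment> \<open>\<open>B\<close> is the total length of the four arms; the estimate holds for \<open>B \<le> 6\<close>.\<close>
    define B where "B = real a + real c + 2"
    have TB: "T = 4 * real k + 2 * B" "(8 * real k + 2 * real a + 2 * real c + 4) = 2 * T - 2 * B"
      by (simp_all add: T_def B_def)
    have "- ((\<Sum>x\<in>?V. W x * ln (W x)) / T) = 2 * B / T * ln 2 - ln 4"
      unfolding X TB(2) ln4 using Tpos by (simp add: field_simps)
    then have walk: "T * exp (- ((\<Sum>x\<in>?V. W x * ln (W x)) / T)) = T / 4 * exp (2 * B / T * ln 2)"
      by (simp add: exp_diff)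
    have "B \<le> 6" using a c by (auto simp: B_def)
    then have "real (k + a + c + 1) \<le> T / 4 + B / 2 * (2 / 3)"
      by (simp add: TB(1) B_def field_simps)
    also have "\<dots> \<le> T / 4 + B / 2 * ln 2"
      using ln2_ge_two_thirds by (intro add_left_mono mult_left_mono) (auto simp: B_def)
    also have "\<dots> = T / 4 * (1 + 2 * B / T * ln 2)" using Tpos by (simp add: field_simps)
    also have "\<dots> \<le> T / 4 * exp (2 * B / T * ln 2)"
      using Tpos exp_ge_add_one_self by (intro mult_left_mono) auto
    finally show ?thesis unfolding walk .
  qed
  ultimately have "real (k + a + c + 1) * 2 ^ (card S - 1) \<le> spine_homs S A 0 (k + 3) 1 a (k + 1) c"
    by (meson mult_right_mono order_trans zero_le_numeral zero_le_power)
  then have "real ((k + a + c + 1) * 2 ^ (card S - 1)) \<le> real (spine_homs S A 0 (k + 3) 1 a (k + 1) c)"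
    by (simp only: of_nat_mult of_nat_power of_nat_numeral)
  then show ?thesis by linarith
qed

text \<open>
  In the tree with arms of length 1, 3 and 3 the function \<open>\<mu>\<close> below is positive and satisfies
  \<open>(\<Sum>y. \<mu> y) = 2 * \<mu> x\<close>, the sum being over the neighbours of \<open>x\<close>: an eigenvector of the adjacency
  matrix for the eigenvalue 2. The weights \<open>\<mu> x * \<mu> y\<close> give the walk of maximal entropy rate, here
  \<open>ln 2\<close>, and the entropy of its stationary distribution exceeds \<open>ln (23 / 4)\<close>.
\<close>

lemma arms133_homs:
  assumes T: "grown A S"
  shows "23 * 2 ^ (card S - 1) \<le> 4 * spine_homs S A 0 7 3 1 4 0"
proof -
  let ?V = "spine 0 7 1 0" and ?E = "symcl (spine_edges 3 4)"
  let ?N = "spine_nbrs 0 7 1 0 3 4"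
  define \<mu> where "\<mu> x = (if x = (1, 1) then 2 else if x = (0, 0) \<or> x = (0, 6) then 1
    else if x = (0, 1) \<or> x = (0, 5) then 2 else if x = (0, 2) \<or> x = (0, 4) then 3 else 4 :: real)" for x :: "nat \<times> nat"
  define w where "w x y = \<mu> x * \<mu> y" for x y
  define W where "W x = 2 * \<mu> x * \<mu> x" for x
  have fin: "finite ?V" "?V \<noteq> {}" by (auto simp: spine_def)
  have pos: "0 < \<mu> x" for x by (simp add: \<mu>_def)
  have "{0..<7} = {0, Suc 0, 2, 3, 4, 5, 6 :: nat}" by auto
  then have V: "?V = {(0, 0), (0, Suc 0), (0, 2), (0, 3), (0, 4), (0, 5), (0, 6), (Suc 0, Suc 0)}"
    by (auto simp: spine_def)
  have N: "?N (0, 0) = {(0, Suc 0)}" "?N (0, Suc 0) = {(0, 0), (0, 2)}" "?N (0, 2) = {(0, Suc 0), (0, 3)}"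
    "?N (0, 3) = {(0, 2), (0, 4), (Suc 0, Suc 0)}" "?N (0, 4) = {(0, 3), (0, 5)}"
    "?N (0, 5) = {(0, 4), (0, 6)}" "?N (0, 6) = {(0, 5)}" "?N (Suc 0, Suc 0) = {(0, 3)}"
    by (subst spine_nbrs_spine; auto)+ (subst spine_nbrs_arms(1)[unfolded One_nat_def]; auto)
  note N' = N[unfolded One_nat_def]
  have \<mu>s: "\<mu> (0, 0) = 1" "\<mu> (0, Suc 0) = 2" "\<mu> (0, 2) = 3" "\<mu> (0, 3) = 4" "\<mu> (0, 4) = 3"
    "\<mu> (0, 5) = 2" "\<mu> (0, 6) = 1" "\<mu> (Suc 0, Suc 0) = 2"
    by (simp_all add: \<mu>_def)
  have harmonic: "(\<Sum>y\<in>?N x. \<mu> y) = 2 * \<mu> x" if "x \<in> ?V" for x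
    using that unfolding V by (elim insertE emptyE) (simp_all add: N' \<mu>s)
  have lns: "ln (4::real) = 2 * ln 2" "ln (8::real) = 3 * ln 2" "ln (32::real) = 5 * ln 2" "ln (18::real) = ln 2 + 2 * ln 3"
    "ln (6::real) = ln 2 + ln 3" "ln (12::real) = 2 * ln 2 + ln 3"
    using ln_mult[of 2 3] ln_mult[of 4 3] ln_realpow[of 2 2] ln_realpow[of 2 3] ln_realpow[of 2 5] ln_mult[of 2 9] ln_realpow[of 3 2] by simp_all
  have T: "96 = (\<Sum>x\<in>?V. W x)" unfolding V by (simp add: W_def \<mu>s)
  have X: "(\<Sum>x\<in>?V. W x * ln (W x)) = 272 * ln 2 + 72 * ln 3"
    unfolding V by (simp add: W_def \<mu>s lns)
  have rate: "(\<Sum>x\<in>?V. W x * ln (W x) - (\<Sum>y\<in>?N x. w x y * ln (w x y))) = 96 * ln 2"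
    unfolding V by (simp add: N' W_def w_def \<mu>s lns)
  have "96 * exp (- ((\<Sum>x\<in>?V. W x * ln (W x)) / 96)) * 2 ^ (card S - 1) \<le> spine_homs S A 0 7 3 1 4 0"
  proof (rule homs_doubling_bound[OF assms fin sym_symcl _ _ _ T, where w = w])
    show "0 < w x y \<and> w y x = w x y" for x y using pos by (simp add: w_def)
    show "W x = (\<Sum>y\<in>{y \<in> ?V. (x, y) \<in> ?E}. w x y)" if "x \<in> ?V" for x
      using harmonic[OF that] by (simp add: spine_nbrs_def w_def W_def flip: sum_distrib_left)
    show "0 < W x" for x using pos by (simp add: W_def)
    show "(\<Sum>x\<in>?V. W x * ln (W x) - (\<Sum>y\<in>{y \<in> ?V. (x, y) \<in> ?E}. w x y * ln (w x y))) = 96 * ln 2"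
      using rate by (simp only: spine_nbrs_def)
  qed
  moreover have "23 / 4 \<le> 96 * exp (- ((\<Sum>x\<in>?V. W x * ln (W x)) / 96))"
  proof -
    have rearrange: "y - z \<le> - ((272 * a + 72 * b) / 96)" if "34 * a + 9 * b + 12 * y \<le> 12 * z"
      for a b y z :: real
    proof -
      have "(272 * a + 72 * b) / 96 = (34 * a + 9 * b) / 12" by (simp add: field_simps)
      then show ?thesis using that by (simp add: field_simps)
    qed
    have ln_prod: "ln (x * y * z) = ln x + ln y + ln z" if "0 < x" "0 < y" "0 < z" for x y z :: real
      using that by (simp add: ln_mult)
    \<comment> \<open>The twelfth power of the claim, cleared of denominators.\<close>
    have "34 * ln 2 + 9 * ln 3 + 12 * ln 23 = ln ((2::real) ^ 34 * 3 ^ 9 * 23 ^ 12)"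
      by (subst ln_prod; simp only: zero_less_power zero_less_numeral ln_realpow of_nat_numeral)
    also have "\<dots> \<le> ln (384 ^ 12)" by (subst ln_le_cancel_iff) simp_all
    also have "\<dots> = 12 * ln (384::real)" by (simp only: ln_realpow zero_less_numeral of_nat_numeral)
    finally have "ln 23 - ln 384 \<le> - ((\<Sum>x\<in>?V. W x * ln (W x)) / 96)" unfolding X by (rule rearrange)
    then have "exp (ln 23 - ln 384) \<le> exp (- ((\<Sum>x\<in>?V. W x * ln (W x)) / 96))" by simp
    then show ?thesis by (simp add: exp_diff)
  qed
  ultimately have "23 / 4 * 2 ^ (card S - 1) \<le> real (spine_homs S A 0 7 3 1 4 0)"
    by (meson mult_right_mono order_trans zero_le_numeral zero_le_power)
  then have "real (23 * 2 ^ (card S - 1)) \<le> real (4 * spine_homs S A 0 7 3 1 4 0)" by simp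
  then show ?thesis by linarith
qed

section \<open>Trees with two or three branches\<close>

lemma bridged_le_spine:
  assumes S: "finite S"
  shows "bridged_homs S A N i 0 0 1 \<le> spine_homs S A 0 (N + 1) i 1 j 0"
proof (rule card_homs_embed)
  let ?\<phi> = "\<lambda>(s, x). if s = 0 then (0, x) else (1, 1) :: nat \<times> nat"
  show "embeds ?\<phi> (bridged N 0 1) (symcl (bridged_edges i 0 1)) (spine 0 (N + 1) 1 0) (symcl (spine_edges i j))"
  proof (rule embeds_symclI)
    show "inj_on ?\<phi> (bridged N 0 1)" by (auto simp: inj_on_def bridged_def)
    show "?\<phi> x \<in> spine 0 (N + 1) 1 0" if "x \<in> bridged N 0 1" for x
      using that by (auto simp: bridged_def spine_def)
    show "sym (symcl (spine_edges i j))" by (rule sym_symcl)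
    fix x y assume e: "(x, y) \<in> bridged_edges i 0 1" and V: "x \<in> bridged N 0 1" "y \<in> bridged N 0 1"
    from e show "(?\<phi> x, ?\<phi> y) \<in> symcl (spine_edges i j)"
    proof (cases rule: bridged_edgeE)
      case (left z)
      then show ?thesis using spine_edges_intros(1)[of z] by (simp add: in_symcl)
    next
      case (right z)
      then show ?thesis using V by (simp add: bridged_def)
    next
      case (bridge t)
      then show ?thesis using spine_edges_intros(3)[of i j] by (simp add: in_symcl mid_def)
    qed
  qed
qed (use S finite_spine in auto)

lemma spine_no_second_arm:
  assumes S: "finite S"
  shows "spine_homs S A u v i a j 0 \<le> spine_homs S A u v i a j' 0"
proof (rule card_homs_embed)
  show "embeds id (spine u v a 0) (symcl (spine_edges i j)) (spine u v a 0) (symcl (spine_edges i j'))"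
  proof (rule embeds_symclI)
    show "sym (symcl (spine_edges i j'))" by (rule sym_symcl)
    fix x y assume e: "(x, y) \<in> spine_edges i j" and V: "x \<in> spine u v a 0" "y \<in> spine u v a 0"
    from e have "(x, y) \<in> spine_edges i j'"
    proof (cases rule: spine_edgeE)
      case second
      then show ?thesis using V by (simp add: spine_def)
    qed (simp_all only: spine_edges_intros)
    then show "(id x, id y) \<in> symcl (spine_edges i j')" by (simp add: in_symcl)
  qed auto
qed (use S finite_spine in auto)

lemma bridged_swap:
  assumes S: "finite S" and k: "1 \<le> k"
  shows "bridged_homs S A N i M j k \<le> bridged_homs S A M j N i k"
proof (rule card_homs_embed)
  let ?\<phi> = "\<lambda>(s, x). if s = 0 then (1, x) else if s = 1 then (0, x) else (2, k - x) :: nat \<times> nat"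
  show "embeds ?\<phi> (bridged N M k) (symcl (bridged_edges i j k)) (bridged M N k) (symcl (bridged_edges j i k))"
  proof (rule embeds_symclI)
    show "inj_on ?\<phi> (bridged N M k)"
      by (rule inj_on_inverseI[where g = "\<lambda>(s, x). if s = 0 then (1, x) else if s = 1 then (0, x) else (2, k - x)"])
        (auto simp: bridged_def)
    show "?\<phi> x \<in> bridged M N k" if "x \<in> bridged N M k" for x
      using that by (auto simp: bridged_def)
    show "sym (symcl (bridged_edges j i k))" by (rule sym_symcl)
    have mid: "?\<phi> (mid i j k t) = mid j i k (k - t)" if "t \<le> k" for t
      using that k by (auto simp: mid_def)
    fix x y assume e: "(x, y) \<in> bridged_edges i j k"
    from e show "(?\<phi> x, ?\<phi> y) \<in> symcl (bridged_edges j i k)"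
    proof (cases rule: bridged_edgeE)
      case (left z)
      then show ?thesis using bridged_edges_intros(2)[of z] by (simp add: in_symcl)
    next
      case (right z)
      then show ?thesis using bridged_edges_intros(1)[of z] by (simp add: in_symcl)
    next
      case (bridge t)
      then have "k - t = Suc (k - Suc t)" by simp
      then show ?thesis
        using bridge mid[of t] mid[of "Suc t"] bridged_edges_intros(3)[of "k - Suc t" k j i]
        by (simp only: in_symcl) simp
    qed
  qed
qed (use S finite_bridged in auto)

text \<open>By folding, the shorter of two arms at a branch vertex can be shortened to length 1 or 2.\<close>

lemma shorten_arm:
  assumes S: "finite S" and i: "1 \<le> i" "2 * i \<le> N" and k: "1 \<le> k"
  shows "\<exists>i'. (i' = 1 \<or> i' = 2) \<and> i' \<le> i \<and> bridged_homs S A N i' M j k \<le> bridged_homs S A N i M j k"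
proof (cases "i \<le> 2")
  case True
  then show ?thesis using i by (intro exI[of _ i]) auto
next
  case False
  define i' where "i' = (if odd i then 1 else 2 :: nat)"
  have "even (i - i')" using False by (auto simp: i'_def)
  then obtain d where d: "i - i' = 2 * d" by blast
  have i': "i' = 1 \<or> i' = 2" by (simp add: i'_def)
  then have "i' < i" using False by linarith
  then have id: "i = i' + 2 * d" "1 \<le> d" using d by linarith+
  have "2 * (i' + d) \<le> N" using i(2) id by presburger
  then have "bridged_homs S A N i' M j k \<le> bridged_homs S A N (i' + 2 * d) M j k"
    by (intro bridged_fold[OF S id(2) _ k])
  then show ?thesis using id i' by (intro exI[of _ i']) simp
qed

text \<open>
  After both shorter arms are reduced to lengths \<open>a'\<close> and \<open>c'\<close> at most 2, the spine misses only
  \<open>a' + c'\<close> vertices. The two forks with one spine vertex beyond each branch vertex contribute enough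
  for these, since the path between them receives few homomorphisms from a source that is not a star.
\<close>

lemma dumbbell_homs:
  assumes T: "grown A S" and ts: "simple_path A S ts" "length ts = 4"
    and V: "finite V" "sym E" and dum: "dumbbell V E p l" and n: "(\<Sum>s<5. l s) + 1 = card V"
  shows "path_homs S A (card V) \<le> card (homs S A V E)"
proof -
  have S: "finite S" using T grown_finite by blast
  let ?c = "2 ^ (card S - 1) :: nat"
  have L1: "1 \<le> l s" if "s < 5" for s
    using frame_arm(1)[OF dum[unfolded dumbbell_def] that] .
  obtain a b where ab: "a < 2" "b < 2" "a \<noteq> b" "l a \<le> l b" "l a + l b = l 0 + l 1"
  proof (cases "l 0 \<le> l 1")
    case True then show ?thesis using that[of 0 1] by simp
  next
    case False then show ?thesis using that[of 1 0] by simp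
  qed
  obtain c d where cd: "c = 2 \<or> c = 3" "d = 2 \<or> d = 3" "c \<noteq> d" "l c \<le> l d" "l c + l d = l 2 + l 3"
  proof (cases "l 2 \<le> l 3")
    case True then show ?thesis using that[of 2 3] by simp
  next
    case False then show ?thesis using that[of 3 2] by simp
  qed
  define N M k where "N = l a + l b" and "M = l c + l d" and "k = l 4"
  have k: "1 \<le> k" using L1[of 4] by (simp add: k_def)
  have la: "1 \<le> l a" "2 * l a \<le> N" using L1[of a] ab by (auto simp: N_def)
  have lc: "1 \<le> l c" "2 * l c \<le> M" using L1[of c] cd by (auto simp: M_def)
  obtain a' where a': "a' = 1 \<or> a' = 2" "a' \<le> l a"
    and foldA: "bridged_homs S A N a' M (l c) k \<le> bridged_homs S A N (l a) M (l c) k"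
    using shorten_arm[OF S la k, of A M "l c"] by blast
  obtain c' where c': "c' = 1 \<or> c' = 2" "c' \<le> l c"
    and foldC: "bridged_homs S A M c' N a' k \<le> bridged_homs S A M (l c) N a' k"
    using shorten_arm[OF S lc k, of A N a'] by blast
  define i j L where "i = N - a'" and "j = N - a' + k" and "L = N - a' + k + (M - c') + 1"
  have le: "a' < N" "c' < M" using a' c' la lc by linarith+
  have size: "card V = L + (a' + c')"
  proof -
    have "(\<Sum>s<5. l s) = l 0 + l 1 + l 2 + l 3 + l 4" by (simp add: eval_nat_numeral)
    then show ?thesis using n le ab(5) cd(5) by (simp add: L_def N_def M_def k_def)
  qed
  have "path_homs S A L + spine_homs S A (i - 1) (j + 2) i a' j c'
      \<le> spine_homs S A 0 L i a' j c' + path_homs S A (j + 2 - (i - 1))"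
    by (rule spine_glue[OF S]) (use le in \<open>auto simp: i_def j_def L_def\<close>)
  moreover have "j + 2 - (i - 1) = k + 3" using le by (simp add: i_def j_def)
  moreover have "path_homs S A (k + 3) \<le> (k + 1) * ?c" by (rule path_homs_path4[OF T ts])
  moreover have "(k + a' + c' + 1) * ?c \<le> spine_homs S A (i - 1) (j + 2) i a' j c'"
  proof -
    have "(i - 1) + (k + 3) = j + 2" "(i - 1) + 1 = i" "(i - 1) + (k + 1) = j"
      using le by (simp_all add: i_def j_def)
    then show ?thesis
      using two_forks_homs[OF T k a'(1) c'(1)] spine_shift[OF S, where A = A and n = "k + 3" and i = 1
          and a = a' and j = "k + 1" and c = c' and u = "i - 1"] by simp
  qed
  ultimately have "path_homs S A L + (a' + c') * ?c \<le> spine_homs S A 0 L i a' j c'"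
    by (simp add: algebra_simps)
  then have "path_homs S A (card V) \<le> spine_homs S A 0 L i a' j c'"
    using path_homs_steps[OF T, of L "a' + c'"] size by simp
  also have "\<dots> \<le> bridged_homs S A N a' M c' k"
    unfolding L_def i_def j_def by (rule spine_le_bridged[OF S _ _ k]) (use le in auto)
  also have "\<dots> \<le> bridged_homs S A M c' N a' k" by (rule bridged_swap[OF S k])
  also note foldC
  also have "bridged_homs S A M (l c) N a' k \<le> bridged_homs S A N a' M (l c) k" by (rule bridged_swap[OF S k])
  also note foldA
  also have "bridged_homs S A N (l a) M (l c) k \<le> card (homs S A V E)"
    unfolding N_def M_def k_def by (rule dumbbell_bridged[OF dum V S ab(1-3) cd(1-3)])
  finally show ?thesis .
qed

text \<open>
  The arms of length \<open>p\<close> and \<open>k\<close> form a spine with \<open>p + k + 1\<close> vertices, which carries the arm of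
  length 1. If no homomorphism
  covers the path on one vertex more from end to end, path counts grow linearly there, and deleting
  an end of the spine makes an arm even. Otherwise the source contains a long path, which makes it
  spread out: few homomorphisms into a path on 7 vertices remain, while the smallest tree of this
  kind has many.
\<close>

lemma odd_arms_homs:
  assumes T: "grown A S" and p: "odd p" "3 \<le> p" and k: "3 \<le> k"
  shows "path_homs S A (p + k + 2) \<le> spine_homs S A 0 (p + k + 1) p 1 (p + k) 0"
proof -
  have S: "finite S" using T grown_finite by blast
  let ?c = "2 ^ (card S - 1) :: nat" and ?L = "p + k + 1"
  show ?thesis
  proof (cases "\<exists>f \<in> homs S A {..<p + k + 2} path_arcs. 0 \<in> f ` S \<and> p + k + 1 \<in> f ` S")
    case False
    have "path_homs S A (p + k + 2) + path_homs S A (p + k) = 2 * path_homs S A (p + k + 1)"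
      by (rule path_homs_linear[OF S False])
    moreover have "path_homs S A ?L + spine_homs S A 1 ?L p 1 (p + k) 0
        \<le> spine_homs S A 0 ?L p 1 (p + k) 0 + path_homs S A (?L - 1)"
      by (rule spine_glue[OF S]) auto
    moreover have "path_homs S A ?L \<le> spine_homs S A 1 ?L p 1 (p + k) 0"
    proof -
      have "path_homs S A ((p + k - 1) + 1 + 1) \<le> bridged_homs S A (p + k - 1) (p - 1) 0 0 1"
        by (rule even_arm_bridged[OF S]) (use p in auto)
      also have "\<dots> \<le> spine_homs S A 0 (p + k - 1 + 1) (p - 1) 1 (p + k - 1) 0"
        by (rule bridged_le_spine[OF S])
      also have "\<dots> \<le> spine_homs S A 1 (1 + (p + k - 1 + 1)) (1 + (p - 1)) 1 (1 + (p + k - 1)) 0"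
        by (rule spine_shift[OF S])
      finally show ?thesis using p by simp
    qed
    ultimately show ?thesis by simp
  next
    case True
    then obtain f where "f \<in> homs S A {..<p + k + 2} path_arcs" "0 \<in> f ` S" "p + k + 2 - 1 \<in> f ` S"
      by auto
    then obtain ts where ts: "simple_path A S ts" "length ts = 5"
      using full_hom_path5[OF T, of f "p + k + 2"] k by auto
    have "4 * path_homs S A 7 \<le> 19 * ?c" by (rule path_homs_path5[OF T ts])
    moreover have "path_homs S A ?L + spine_homs S A (p - 3) (p + 4) p 1 (p + k) 0
        \<le> spine_homs S A 0 ?L p 1 (p + k) 0 + path_homs S A (p + 4 - (p - 3))"
      by (rule spine_glue[OF S]) (use k in auto)
    moreover have "23 * ?c \<le> 4 * spine_homs S A (p - 3) (p + 4) p 1 (p + k) 0"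
    proof -
      have "spine_homs S A 0 7 3 1 4 0
          \<le> spine_homs S A (p - 3) (p - 3 + 7) (p - 3 + 3) 1 (p - 3 + 4) 0"
        by (rule spine_shift[OF S])
      also have "\<dots> \<le> spine_homs S A (p - 3) (p - 3 + 7) (p - 3 + 3) 1 (p + k) 0"
        by (rule spine_no_second_arm[OF S])
      finally have "spine_homs S A 0 7 3 1 4 0
          \<le> spine_homs S A (p - 3) (p - 3 + 7) (p - 3 + 3) 1 (p + k) 0" .
      moreover have "p - 3 + 7 = p + 4" "p - 3 + 3 = p" using p by simp_all
      ultimately have "spine_homs S A 0 7 3 1 4 0 \<le> spine_homs S A (p - 3) (p + 4) p 1 (p + k) 0"
        by (simp only:)
      then show ?thesis using arms133_homs[OF T] by linarith
    qed
    moreover have "path_homs S A (?L + 1) \<le> path_homs S A ?L + ?c" by (rule path_homs_step[OF T])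
    moreover have "p + 4 - (p - 3) = 7" using p by simp
    ultimately show ?thesis by simp
  qed
qed

text \<open>
  With an even arm the path can be folded. Otherwise arm \<open>a\<close> is first folded into the others until
  its length is 1, which lengthens arm \<open>b\<close> and keeps its length odd.
\<close>

lemma tripod_homs:
  assumes T: "grown A S" and V: "finite V" "sym E"
    and tri: "tripod V E p l" and n: "(\<Sum>s<3. l s) + 1 = card V"
    and abc: "a < 3" "b < 3" "c < 3" "a \<noteq> b" "a \<noteq> c" "b \<noteq> c"
    and good: "even (l a) \<or> odd (l a) \<and> odd (l b) \<and> 3 \<le> l b \<and> 3 \<le> l c"
  shows "path_homs S A (card V) \<le> card (homs S A V E)"
proof -
  have S: "finite S" using T grown_finite by blast
  have L1: "1 \<le> l s" if "s < 3" for s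
    using frame_arm(1)[OF tri[unfolded tripod_def] that] .
  have perm: "{..<3} = {a, b, c}" using abc by auto
  have size: "card V = l a + l b + l c + 1" using n abc unfolding perm by simp
  have le: "bridged_homs S A (l a + l b) (l a) 0 0 (l c) \<le> card (homs S A V E)"
    by (rule tripod_bridged[OF tri V S abc])
  from good show ?thesis
  proof
    assume "even (l a)"
    then have "path_homs S A (l a + l b + l c + 1) \<le> bridged_homs S A (l a + l b) (l a) 0 0 (l c)"
      using L1[OF abc(3)] by (intro even_arm_bridged[OF S]) auto
    then show ?thesis using le size by simp
  next
    assume odd: "odd (l a) \<and> odd (l b) \<and> 3 \<le> l b \<and> 3 \<le> l c"
    define q where "q = l a + l b - 1"
    have q: "odd q" "3 \<le> q" "l a + l b = q + 1" using odd L1[OF abc(1)] by (auto simp: q_def)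
    have "path_homs S A (q + l c + 2) \<le> spine_homs S A 0 (q + l c + 1) q 1 (q + l c) 0"
      by (rule odd_arms_homs[OF T q(1,2)]) (use odd in simp)
    also have "\<dots> \<le> bridged_homs S A (q + 1) 1 0 0 (l c)"
      using spine_le_bridged[OF S, of 1 "q + 1" 0 0 "l c" A] odd by simp
    also have "\<dots> \<le> bridged_homs S A (q + 1) (l a) 0 0 (l c)"
    proof (cases "l a = 1")
      case False
      obtain d where d: "l a = 2 * d + 1" using odd oddE by blast
      then have "bridged_homs S A (q + 1) 1 0 0 (l c) \<le> bridged_homs S A (q + 1) (1 + 2 * d) 0 0 (l c)"
        using False odd q(3) by (intro bridged_fold[OF S]) auto
      then show ?thesis using d by simp
    qed simp
    finally show ?thesis using le size q(3) by simp
  qed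
qed

section \<open>Comparison with the exceptional tree\<close>

text \<open>
  Trees of the same order have the same number of arcs, so an embedding that is onto the vertices is
  onto the arcs.
\<close>

lemma tree_embedding_iso:
  assumes H: "undirected_tree H" and G: "undirected_tree G"
    and emb: "embeds \<phi> (pverts H) (parcs H) (pverts G) (parcs G)"
    and card: "card (pverts H) = card (pverts G)"
  shows "digraph_iso (with_proj H) (with_proj G)"
proof -
  interpret H: pair_graph H using H by (simp add: undirected_tree_def)
  interpret G: pair_graph G using G by (simp add: undirected_tree_def)
  let ?F = "\<lambda>(x, y). (\<phi> x, \<phi> y)"
  have inj: "inj_on \<phi> (pverts H)" and ran: "\<phi> ` pverts H \<subseteq> pverts G"
    and arc: "\<And>x y. x \<in> pverts H \<Longrightarrow> y \<in> pverts H \<Longrightarrow> (x, y) \<in> parcs H \<Longrightarrow> (\<phi> x, \<phi> y) \<in> parcs G"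
    using emb unfolding embeds_def by blast+
  have verts: "\<phi> ` pverts H = pverts G"
    using card_subset_eq[OF G.pair_finite_verts ran] card_image[OF inj] card by simp
  have H_arcs: "parcs H = {(x, y). x \<in> pverts H \<and> y \<in> pverts H \<and> (x, y) \<in> parcs H}"
    using H.in_arcsD1 H.in_arcsD2 by blast
  have G_arcs: "parcs G = {(x, y). x \<in> pverts G \<and> y \<in> pverts G \<and> (x, y) \<in> parcs G}"
    using G.in_arcsD1 G.in_arcsD2 by blast
  have "card (parcs H) = card (parcs G)"
    using grown_card_arcs[OF undirected_tree_grown(1)[OF H]] grown_card_arcs[OF undirected_tree_grown(1)[OF G]]
      card H_arcs G_arcs by simp
  moreover have injF: "inj_on ?F (parcs H)"
  proof (rule inj_onI)
    fix e e' assume e: "e \<in> parcs H" "e' \<in> parcs H" "?F e = ?F e'"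
    then have "\<phi> (fst e) = \<phi> (fst e')" "\<phi> (snd e) = \<phi> (snd e')" by (simp_all add: case_prod_beta)
    then show "e = e'"
      using e inj H.arc_fst_in_verts H.arc_snd_in_verts by (simp add: inj_on_eq_iff prod_eq_iff)
  qed
  moreover have sub: "?F ` parcs H \<subseteq> parcs G"
  proof clarify
    fix x y assume e: "(x, y) \<in> parcs H"
    show "(\<phi> x, \<phi> y) \<in> parcs G" by (rule arc[OF H.in_arcsD1[OF e] H.in_arcsD2[OF e] e])
  qed
  ultimately have arcs: "?F ` parcs H = parcs G"
    using card_subset_eq[OF G.pair_finite_arcs sub] card_image[OF injF] by simp
  let ?f = "\<lparr>iso_verts = \<phi>, iso_arcs = ?F, iso_head = snd, iso_tail = fst\<rparr>"
  have "pre_digraph.digraph_isomorphism (with_proj H) ?f"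
    unfolding pre_digraph.digraph_isomorphism_def
    using H.wf_digraph_axioms inj injF by (simp add: case_prod_beta)
  moreover have "with_proj G = app_iso ?f (with_proj H)"
    using verts arcs by (simp add: app_iso_def with_proj_def)
  ultimately show ?thesis unfolding digraph_iso_def by blast
qed

lemma tripod_iso_Y:
  assumes G: "undirected_tree G" and tri: "tripod (pverts G) (parcs G) p l"
    and n: "(\<Sum>s<3. l s) + 1 = card (pverts G)"
    and abc: "a < 3" "b < 3" "c < 3" "a \<noteq> b" "a \<noteq> c" "b \<noteq> c" and l: "l a = 1" "l b = 1"
  shows "digraph_iso (with_proj G) (with_proj (Y_graph 1 1 (l c)))"
proof -
  note fr = tri[unfolded tripod_def]
  let ?Y = "Y_graph 1 1 (l c)" and ?V = "pverts G" and ?E = "parcs G"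
  let ?F = "\<lambda>(s, t). p s t"
  \<comment> \<open>In \<open>Y_graph 1 1 (l c)\<close> the vertices 1 and 2 are the short arms and the long arm starts at 3.\<close>
  define \<iota> where "\<iota> i = (if i = 0 then (2, 0) else if i = 1 then (a, 1) else if i = 2 then (b, 1)
    else (c, i - 2))" for i :: nat
  have perm: "{..<3} = {a, b, c}" using abc by auto
  have size: "card ?V = l c + 3" using n abc l unfolding perm by simp
  have lc: "1 \<le> l c" by (rule frame_arm(1)[OF fr abc(3)])
  have root: "p s 0 = p 2 0" if "s < 3" for s using frame_arm(2)[OF fr that] by (simp only: case_prod_conv)
  have inj: "inj_on ?F (frame_idx 3 l)" and ran: "?F ` frame_idx 3 l \<subseteq> ?V"
    using fr unfolding frame_def by blast+
  have Yverts: "pverts ?Y = {0..2 + l c}" by (simp add: Y_graph_def)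
  have \<iota>: "\<iota> i \<in> frame_idx 3 l" if "i \<in> pverts ?Y" for i
  proof -
    have "i \<le> 2 + l c" using that unfolding Yverts by simp
    then show ?thesis using abc l lc by (auto simp: \<iota>_def in_frame_idx)
  qed
  define R where "R = {(if i = 2 \<or> i = 3 then 0 else i - 1, i) | i. i \<in> {1..2 + l c}}"
  have Yarcs: "parcs ?Y = symcl R" by (simp add: Y_graph_def R_def numeral_2_eq_2 numeral_3_eq_3)
  have Y: "undirected_tree ?Y" by (rule undirected_tree_Y_graph) (use lc in auto)
  have "embeds (?F \<circ> \<iota>) (pverts ?Y) (symcl R) ?V ?E"
  proof (rule embeds_symclI)
    have "inj_on \<iota> (pverts ?Y)"
    proof (rule inj_on_inverseI)
      fix i assume "i \<in> pverts ?Y"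
      show "(\<lambda>(q, w). if w = 0 then 0 else if q = a then 1 else if q = b then 2 else w + 2) (\<iota> i) = i"
        using abc by (auto simp: \<iota>_def)
    qed
    moreover have "inj_on ?F (\<iota> ` pverts ?Y)" by (rule inj_on_subset[OF inj]) (use \<iota> in blast)
    ultimately show "inj_on (?F \<circ> \<iota>) (pverts ?Y)" by (rule comp_inj_on)
    show "(?F \<circ> \<iota>) i \<in> ?V" if "i \<in> pverts ?Y" for i using \<iota>[OF that] ran by auto
    show "sym ?E" by (rule undirected_tree_grown(2)[OF G])
    fix x y assume "(x, y) \<in> R"
    then have y: "1 \<le> y" "y \<le> 2 + l c" "x = (if y = 2 \<or> y = 3 then 0 else y - 1)" by (auto simp: R_def)
    have arm: "(p s t, p s (Suc t)) \<in> ?E" if "s < 3" "t < l s" for s t by (rule frame_arm(5)[OF fr that])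
    consider "y = 1" | "y = 2" | "y = 3" | t where "y = t + 4" "t + 1 < l c"
    proof -
      have "y = 1 \<or> y = 2 \<or> y = 3 \<or> y = (y - 4) + 4 \<and> (y - 4) + 1 < l c" using y by arith
      then show ?thesis using that by blast
    qed
    then show "((?F \<circ> \<iota>) x, (?F \<circ> \<iota>) y) \<in> ?E"
    proof cases
      case 1 then show ?thesis using y arm[of a 0] root[of a] abc l by (simp add: \<iota>_def)
    next
      case 2 then show ?thesis using y arm[of b 0] root[of b] abc l by (simp add: \<iota>_def)
    next
      case 3 then show ?thesis using y arm[of c 0] root[of c] abc lc by (simp add: \<iota>_def)
    next
      case 4 then show ?thesis using y arm[of c "t + 1"] abc by (simp add: \<iota>_def)
    qed
  qed
  then have emb: "embeds (?F \<circ> \<iota>) (pverts ?Y) (parcs ?Y) ?V ?E" unfolding Yarcs .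
  have card: "card (pverts ?Y) = card ?V" unfolding Yverts size by simp
  have "digraph_iso (with_proj ?Y) (with_proj G)" by (rule tree_embedding_iso[OF Y G emb card])
  moreover have "wf_digraph (with_proj ?Y)"
    using Y by (simp add: undirected_tree_def wf_digraph_wp_iff pair_graph_def pair_digraph_def pair_fin_digraph_def)
  ultimately show ?thesis by (rule digraph_iso_swap[rotated])
qed

lemma hom_count_homs:
  assumes "undirected_tree G"
  shows "hom_count G H = card (homs (pverts G) (parcs G) (pverts H) (parcs H))"
proof -
  interpret pair_graph G using assms by (simp add: undirected_tree_def)
  show ?thesis
    unfolding hom_count_def hom_set_def homs_def using in_arcsD1 in_arcsD2
    by (intro arg_cong[where f = card]) blast
qed

lemma hom_count_path_graph:
  assumes "undirected_tree G"
  shows "hom_count G (path_graph n) = path_homs (pverts G) (parcs G) n"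
proof -
  have "homs S A {..<n} {(i, j). i < n \<and> j < n \<and> (j = i + 1 \<or> i = j + 1)} = homs S A {..<n} path_arcs"
    for S :: "'a set" and A
    unfolding homs_def path_arcs_def by (auto simp: PiE_iff)
  then show ?thesis unfolding hom_count_homs[OF assms] path_homs_def path_graph_def by simp
qed

theorem theorem1p6:
  fixes Tn :: "'a pair_pre_digraph" and Tm :: "'b pair_pre_digraph" and n m :: nat
  assumes "undirected_tree Tn" and "card (pverts Tn) = n"
    and "undirected_tree Tm" and "card (pverts Tm) = m"
    and "hom_count Tm Tn < hom_count Tm (path_graph n)"
  shows "4 \<le> n \<and> digraph_iso (with_proj Tn) (with_proj (Y_graph 1 1 (n - 3))) \<and> even n"
proof -
  define S A V E where "S = pverts Tm" and "A = parcs Tm" and "V = pverts Tn" and "E = parcs Tn"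
  have T: "grown A S" using undirected_tree_grown[OF assms(3)] by (simp add: S_def A_def)
  have G: "grown E V" "sym E" using undirected_tree_grown[OF assms(1)] by (simp_all add: V_def E_def)
  have fin: "finite S" "finite V" using T G grown_finite by blast+
  have n: "card V = n" using assms(2) by (simp add: V_def)
  have less: "card (homs S A V E) < path_homs S A n"
    using assms(5) hom_count_path_graph[OF assms(3), of n] hom_count_homs[OF assms(3), of Tn]
    by (simp add: S_def A_def V_def E_def)
  have no_path: "\<not> embeds \<phi> {..<n} path_arcs V E" for \<phi>
    using card_homs_embed[of \<phi> "{..<n}" path_arcs V E S A] fin less by (auto simp: path_homs_def)
  obtain p0 l0 where tri0: "tripod V E p0 l0"
    using spanning_path_or_tripod[OF G] no_path n by auto
  have "4 \<le> n"
  proof -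
    have "1 \<le> l0 s" if "s < 3" for s using frame_arm(1)[OF tri0[unfolded tripod_def] that] .
    from this[of 0] this[of 1] this[of 2] show ?thesis
      using frame_size[OF tri0[unfolded tripod_def] fin(2)] n by (simp add: numeral_3_eq_3 numeral_2_eq_2)
  qed
  then have n2: "2 \<le> card V" using n by simp
  \<comment> \<open>Stars are excluded before branching is considered: that also gives \<open>2 \<le> m\<close>.\<close>
  have "\<not> (\<exists>c\<in>S. \<forall>x\<in>S. \<forall>y\<in>S. (x, y) \<in> A \<longleftrightarrow> x \<noteq> y \<and> (x = c \<or> y = c))"
    using star_path_homs_le[OF T _ _ G n2] less n by (metis leD)
  then obtain ts where ts: "simple_path A S ts" "length ts = 4"
    using grown_star_or_path4[OF T] by blast
  have m2: "2 \<le> card S" using simple_path_length[OF T ts(1)] ts(2) by simp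
  have nb: "\<not> branchy V E"
  proof
    assume "branchy V E"
    then have "(n - 1) * 2 ^ (card S - 1) \<le> card (homs S A V E)"
      using branchy_homs[OF T m2 G n2] n by simp
    moreover have "path_homs S A (Suc (n - 1)) \<le> (n - 1) * 2 ^ (card S - 1)"
      by (rule path_homs_le_edges[OF T m2])
    ultimately show False using less \<open>4 \<le> n\<close> by simp
  qed
  have "\<not> dumbbell V E p l" for p l
    using spanning_dumbbell[OF G _ nb] dumbbell_homs[OF T ts fin(2) G(2)] less n by (metis leD)
  then obtain p l where tri: "tripod V E p l" and size: "(\<Sum>s<3. l s) + 1 = card V"
    using spanning_tripod_or_dumbbell[OF G tri0 nb] by blast
  have bad: "\<not> (even (l a) \<or> odd (l a) \<and> odd (l b) \<and> 3 \<le> l b \<and> 3 \<le> l c)"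
    if "a < 3" "b < 3" "c < 3" "a \<noteq> b" "a \<noteq> c" "b \<noteq> c" for a b c
    using tripod_homs[OF T fin(2) G(2) tri size that] less n by (metis leD)
  have iso: ?thesis
    if abc: "a < 3" "b < 3" "c < 3" "a \<noteq> b" "a \<noteq> c" "b \<noteq> c" and l: "l a = 1" "l b = 1" for a b c
  proof -
    have "{..<3} = {a, b, c}" using abc by auto
    then have nc: "n = l c + 3" using size n abc l by simp
    have "odd (l c)" using bad[of c a b] abc by auto
    moreover have "digraph_iso (with_proj Tn) (with_proj (Y_graph 1 1 (l c)))"
      by (rule tripod_iso_Y[OF assms(1) tri[unfolded V_def E_def] size[unfolded V_def] abc l])
    ultimately show ?thesis using nc \<open>4 \<le> n\<close> by simp
  qed
  have odd: "odd (l 0)" "odd (l 1)" "odd (l 2)" using bad[of 0 1 2] bad[of 1 0 2] bad[of 2 0 1] by auto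
  \<comment> \<open>All arms are odd and no two of them have length 3 or more, so two have length 1.\<close>
  have short: "l b = 1 \<or> l c = 1" if "a < 3" "b < 3" "c < 3" "a \<noteq> b" "a \<noteq> c" "b \<noteq> c" for a b c
  proof -
    have "odd (l a)" "odd (l b)" "odd (l c)" "l b < 3 \<or> l c < 3"
      using bad[OF that] bad[of b a c] bad[of c a b] that by auto
    moreover have "x = 1" if "odd x" "x < 3" for x :: nat
    proof -
      have "x = 0 \<or> x = 1 \<or> x = 2" using that(2) by arith
      then show ?thesis using that(1) by auto
    qed
    ultimately show ?thesis by blast
  qed
  from short[of 2 0 1] short[of 1 0 2] short[of 0 1 2]
  have "l 0 = 1 \<and> l 1 = 1 \<or> l 0 = 1 \<and> l 2 = 1 \<or> l 1 = 1 \<and> l 2 = 1" by auto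
  then consider "l 0 = 1" "l 1 = 1" | "l 0 = 1" "l 2 = 1" | "l 1 = 1" "l 2 = 1" by blast
  then show ?thesis
  proof cases
    case 1 then show ?thesis by (intro iso[of 0 1 2]) auto
  next
    case 2 then show ?thesis by (intro iso[of 0 2 1]) auto
  next
    case 3 then show ?thesis by (intro iso[of 1 2 0]) auto
  qed
qed

end
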